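(* Let $u:(M^m,g)\to(N,h)$ be a smooth map between Riemannian manifolds and let $u_t:(M^m,g)\to(N,h)$, $-\delta<t<\delta$, be a smooth compactly supported variation of $u$ with $u_0=u$ and variation vector field $v=\frac{\partial u_t}{\partial t}\big|_{t=0}$. Then $$\frac{d}{dt}E_{\Phi_{(3)}}(u_t)\Big|_{t=0}=-\int_M h\big(v,\tau_{\Phi_{(3)}}(u)\big)\,dv_g .$$
   Context: Let $\{e_i\}_{i=1}^m$ be a local orthonormal frame on $(M,g)$, $\nabla$ the Levi-Civita connection of $M$, and $\widetilde\nabla$ the induced connection on the pullback bundle $u^{-1}TN$. The $1$-form $d_{(3)}u$ with values in $u^{-1}TN$ is $$d_{(3)}u(X)=\sum_{j,k=1}^m h(du(X),du(e_j))\,h(du(e_j),du(e_k))\,du(e_k),$$ and $\|d_{(3)}u\|^2=\sum_{i=1}^m h(d_{(3)}u(e_i),du(e_i))=\sum_{i,j,k}h(du(e_i),du(e_j))h(du(e_j),du(e_k))h(du(e_k),du(e_i))$. The $\Phi_{(3)}$-energy is $E_{\Phi_{(3)}}(u)=\int_M\frac{\|d_{(3)}u\|^2}{6}\,dv_g$. The $\Phi_{(3)}$-tension field is $\tau_{\Phi_{(3)}}(u)=\operatorname{div}(d_{(3)}u)=\sum_{i=1}^m\big(\widetilde\nabla_{e_i}(d_{(3)}u(e_i))-d_{(3)}u(\nabla_{e_i}e_i)\big)$. Compactly supported variation means that there is a compact set $K\subset M$ with $u_t=u$ outside $K$ for all $t$; if $M$ is noncompact, the derivative of the energy is understood as the derivative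 of the energy integrated over such a $K$. Manifolds are without boundary. *)

theory Defs
  imports "HOL-Analysis.Analysis"
begin

section \<open>Smooth functions on open subsets of Euclidean spaces\<close>

text \<open>Meant for open sets only: the derivatives are full derivatives, not derivatives within the set.\<close>

primrec Ck_on :: "nat \<Rightarrow> 'e::euclidean_space set \<Rightarrow> ('e \<Rightarrow> 'f::real_normed_vector) \<Rightarrow> bool" where
  "Ck_on 0 S f \<longleftrightarrow> continuous_on S f"
| "Ck_on (Suc k) S f \<longleftrightarrow>
     (\<forall>x\<in>S. f differentiable (at x)) \<and> (\<forall>v. Ck_on k S (\<lambda>x. frechet_derivative f (at x) v))"

definition smooth_on :: "'e::euclidean_space set \<Rightarrow> ('e \<Rightarrow> 'f::real_normed_vector) \<Rightarrow> bool" where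
  "smooth_on S f \<longleftrightarrow> (\<forall>k. Ck_on k S f)"


section \<open>Manifolds\<close>

text \<open>
  A manifold without boundary is a Hausdorff, second countable type together with a smooth atlas.
  The atlas need not be maximal.
\<close>

type_synonym ('a, 'm) chart = "'a set \<times> ('a \<Rightarrow> real ^ 'm)"

abbreviation chart_dom :: "('a, 'm) chart \<Rightarrow> 'a set" where "chart_dom \<equiv> fst"

abbreviation chart_map :: "('a, 'm) chart \<Rightarrow> 'a \<Rightarrow> real ^ 'm" where "chart_map \<equiv> snd"

abbreviation chart_inv :: "('a, 'm) chart \<Rightarrow> real ^ 'm \<Rightarrow> 'a" where
  "chart_inv c \<equiv> inv_into (chart_dom c) (chart_map c)"

definition smooth_atlas :: "('a::{t2_space,second_countable_topology}, 'm::finite) chart set \<Rightarrow> bool" where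
  "smooth_atlas A \<longleftrightarrow>
     (\<Union>c\<in>A. chart_dom c) = UNIV \<and>
     (\<forall>c\<in>A. open (chart_dom c) \<and> open (chart_map c ` chart_dom c) \<and>
        homeomorphism (chart_dom c) (chart_map c ` chart_dom c) (chart_map c) (chart_inv c)) \<and>
     (\<forall>c\<in>A. \<forall>d\<in>A. smooth_on (chart_map c ` (chart_dom c \<inter> chart_dom d)) (chart_map d \<circ> chart_inv c))"

text \<open>
  Tangent spaces are encoded by choosing one chart \<open>chart_at A p\<close> around every point \<open>p\<close>: a vector
  of \<open>real ^ 'm\<close>, regarded as a tangent vector at \<open>p\<close>, is the list of its components with respect to
  \<open>chart_at A p\<close>.  Hence \<open>'a \<Rightarrow> real ^ 'm\<close> is the type of (possibly rough) vector fields.  The chosen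
  chart jumps from point to point, so regularity of fields is always expressed
  through their components \<open>tangent_coord\<close> with respect to a fixed chart.
\<close>

definition chart_at :: "('a, 'm) chart set \<Rightarrow> 'a \<Rightarrow> ('a, 'm) chart" where
  "chart_at A p = (SOME c. c \<in> A \<and> p \<in> chart_dom c)"

text \<open>\<open>deriv_at A f p X\<close> is \<open>df\<^sub>p(X)\<close> for a vector-valued function \<open>f\<close> defined near \<open>p\<close>.\<close>

definition deriv_at ::
  "('a, 'm::finite) chart set \<Rightarrow> ('a \<Rightarrow> 'f::real_normed_vector) \<Rightarrow> 'a \<Rightarrow> real ^ 'm \<Rightarrow> 'f" where
  "deriv_at A f p X =
     frechet_derivative (f \<circ> chart_inv (chart_at A p)) (at (chart_map (chart_at A p) p)) X"

definition tangent_coord :: "('a, 'm::finite) chart set \<Rightarrow> ('a, 'm) chart \<Rightarrow> 'a \<Rightarrow> real ^ 'm \<Rightarrow> real ^ 'm" where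
  "tangent_coord A c p X = deriv_at A (chart_map c) p X"

text \<open>
  The vector field on \<open>chart_dom c\<close> whose components with respect to \<open>c\<close> are the constants \<open>v\<close>;
  for \<open>v = axis i 1\<close> this is the coordinate field \<open>\<partial>\<^sub>i\<close> of \<open>c\<close>.
\<close>

definition coord_field :: "('a, 'm::finite) chart set \<Rightarrow> ('a, 'm) chart \<Rightarrow> real ^ 'm \<Rightarrow> 'a \<Rightarrow> real ^ 'm" where
  "coord_field A c v p =
     frechet_derivative (chart_map (chart_at A p) \<circ> chart_inv c) (at (chart_map c p)) v"

definition smooth_fun_on ::
  "('a, 'm::finite) chart set \<Rightarrow> 'a set \<Rightarrow> ('a \<Rightarrow> 'f::real_normed_vector) \<Rightarrow> bool" where
  "smooth_fun_on A W f \<longleftrightarrow>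
     (\<forall>c\<in>A. smooth_on (chart_map c ` (chart_dom c \<inter> W)) (f \<circ> chart_inv c))"

definition smooth_field_on :: "('a, 'm::finite) chart set \<Rightarrow> 'a set \<Rightarrow> ('a \<Rightarrow> real ^ 'm) \<Rightarrow> bool" where
  "smooth_field_on A W X \<longleftrightarrow>
     (\<forall>c\<in>A. smooth_fun_on A (chart_dom c \<inter> W) (\<lambda>p. tangent_coord A c p (X p)))"

definition smooth_map ::
  "('a::topological_space, 'm::finite) chart set \<Rightarrow> ('b::topological_space, 'n::finite) chart set \<Rightarrow>
     ('a \<Rightarrow> 'b) \<Rightarrow> bool" where
  "smooth_map A B u \<longleftrightarrow>
     continuous_on UNIV u \<and>
     (\<forall>c\<in>A. \<forall>d\<in>B. smooth_on (chart_map c ` (chart_dom c \<inter> u -` chart_dom d))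
        (chart_map d \<circ> u \<circ> chart_inv c))"

definition differential ::
  "('a, 'm::finite) chart set \<Rightarrow> ('b, 'n::finite) chart set \<Rightarrow> ('a \<Rightarrow> 'b) \<Rightarrow> 'a \<Rightarrow> real ^ 'm \<Rightarrow> real ^ 'n" where
  "differential A B u p X = deriv_at A (chart_map (chart_at B (u p)) \<circ> u) p X"

definition lie_bracket ::
  "('a, 'm::finite) chart set \<Rightarrow> ('a \<Rightarrow> real ^ 'm) \<Rightarrow> ('a \<Rightarrow> real ^ 'm) \<Rightarrow> 'a \<Rightarrow> real ^ 'm" where
  "lie_bracket A X Y p =
     (let c = chart_at A p in
        deriv_at A (\<lambda>q. tangent_coord A c q (Y q)) p (X p)
      - deriv_at A (\<lambda>q. tangent_coord A c q (X q)) p (Y p))"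


section \<open>Riemannian manifolds\<close>

type_synonym ('a, 'm) metric = "'a \<Rightarrow> real ^ 'm \<Rightarrow> real ^ 'm \<Rightarrow> real"

definition riemannian_metric :: "('a, 'm::finite) chart set \<Rightarrow> ('a, 'm) metric \<Rightarrow> bool" where
  "riemannian_metric A g \<longleftrightarrow>
     (\<forall>p. bilinear (g p) \<and> (\<forall>X Y. g p X Y = g p Y X) \<and> (\<forall>X. X \<noteq> 0 \<longrightarrow> g p X X > 0)) \<and>
     (\<forall>c\<in>A. \<forall>v w. smooth_fun_on A (chart_dom c)
        (\<lambda>p. g p (coord_field A c v p) (coord_field A c w p)))"

definition riemannian_manifold ::
  "('a::{t2_space,second_countable_topology}, 'm::finite) chart set \<Rightarrow> ('a, 'm) metric \<Rightarrow> bool" where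
  "riemannian_manifold A g \<longleftrightarrow> smooth_atlas A \<and> riemannian_metric A g"

text \<open>\<open>D p X Y\<close> is \<open>\<nabla>\<^sub>X Y\<close> at \<open>p\<close>, for a tangent vector \<open>X\<close> at \<open>p\<close> and a vector field \<open>Y\<close> that is
  smooth near \<open>p\<close> (nothing is said about other \<open>Y\<close>).\<close>

type_synonym ('a, 'm) connection = "'a \<Rightarrow> real ^ 'm \<Rightarrow> ('a \<Rightarrow> real ^ 'm) \<Rightarrow> real ^ 'm"

definition affine_connection ::
  "('a::topological_space, 'm::finite) chart set \<Rightarrow> ('a, 'm) connection \<Rightarrow> bool" where
  "affine_connection A D \<longleftrightarrow>
     (\<forall>W. open W \<longrightarrow>
       (\<forall>p\<in>W. \<forall>Y. smooth_field_on A W Y \<longrightarrow> linear (\<lambda>X. D p X Y)) \<and>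
       (\<forall>p\<in>W. \<forall>X Y Z. smooth_field_on A W Y \<and> (\<forall>q\<in>W. Y q = Z q) \<longrightarrow> D p X Y = D p X Z) \<and>
       (\<forall>p\<in>W. \<forall>X Y Z. smooth_field_on A W Y \<and> smooth_field_on A W Z \<longrightarrow>
          D p X (\<lambda>q. Y q + Z q) = D p X Y + D p X Z) \<and>
       (\<forall>p\<in>W. \<forall>X Y. \<forall>f :: 'a \<Rightarrow> real. smooth_field_on A W Y \<and> smooth_fun_on A W f \<longrightarrow>
          D p X (\<lambda>q. f q *\<^sub>R Y q) = deriv_at A f p X *\<^sub>R Y p + f p *\<^sub>R D p X Y) \<and>
       (\<forall>X Y. smooth_field_on A W X \<and> smooth_field_on A W Y \<longrightarrow>
          smooth_field_on A W (\<lambda>p. D p (X p) Y)))"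

definition levi_civita_connection ::
  "('a::topological_space, 'm::finite) chart set \<Rightarrow> ('a, 'm) metric \<Rightarrow> ('a, 'm) connection \<Rightarrow> bool" where
  "levi_civita_connection A g D \<longleftrightarrow>
     affine_connection A D \<and>
     (\<forall>W. open W \<longrightarrow>
       (\<forall>p\<in>W. \<forall>X Y. smooth_field_on A W X \<and> smooth_field_on A W Y \<longrightarrow>
          D p (X p) Y - D p (Y p) X = lie_bracket A X Y p) \<and>
       (\<forall>p\<in>W. \<forall>X Y Z. smooth_field_on A W Y \<and> smooth_field_on A W Z \<longrightarrow>
          deriv_at A (\<lambda>q. g q (Y q) (Z q)) p X = g p (D p X Y) (Z p) + g p (Y p) (D p X Z)))"

text \<open>The matrix \<open>(g\<^sub>i\<^sub>j)\<close> of the metric in the chart \<open>c\<close>, as a function of the coordinates \<open>x\<close>.\<close>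

definition metric_matrix ::
  "('a, 'm::finite) chart set \<Rightarrow> ('a, 'm) metric \<Rightarrow> ('a, 'm) chart \<Rightarrow> real ^ 'm \<Rightarrow> real ^ 'm ^ 'm" where
  "metric_matrix A g c x =
     (\<chi> i j. g (chart_inv c x) (coord_field A c (axis i 1) (chart_inv c x))
                               (coord_field A c (axis j 1) (chart_inv c x)))"

text \<open>The Riemannian measure is the unique Borel measure given by \<open>\<surd>det(g\<^sub>i\<^sub>j) dx\<close> in every chart.\<close>

definition riemannian_measure ::
  "('a::topological_space, 'm::finite) chart set \<Rightarrow> ('a, 'm) metric \<Rightarrow> 'a measure \<Rightarrow> bool" where
  "riemannian_measure A g \<mu> \<longleftrightarrow>
     sets \<mu> = sets borel \<and>
     (\<forall>c\<in>A. \<forall>S\<in>sets borel. S \<subseteq> chart_dom c \<longrightarrow>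
        emeasure \<mu> S =
          (\<integral>\<^sup>+ x \<in> chart_map c ` S. ennreal (sqrt (det (metric_matrix A g c x))) \<partial>lborel))"

definition orthonormal_basis_at :: "('a, 'm::finite) metric \<Rightarrow> 'a \<Rightarrow> ('m \<Rightarrow> real ^ 'm) \<Rightarrow> bool" where
  "orthonormal_basis_at g p e \<longleftrightarrow> (\<forall>i j. g p (e i) (e j) = (if i = j then 1 else 0))"

definition local_orthonormal_frame ::
  "('a::topological_space, 'm::finite) chart set \<Rightarrow> ('a, 'm) metric \<Rightarrow> 'a set \<Rightarrow>
     ('m \<Rightarrow> 'a \<Rightarrow> real ^ 'm) \<Rightarrow> bool" where
  "local_orthonormal_frame A g W e \<longleftrightarrow>
     open W \<and> (\<forall>i. smooth_field_on A W (e i)) \<and> (\<forall>p\<in>W. orthonormal_basis_at g p (\<lambda>i. e i p))"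


section \<open>The \<open>\<Phi>\<close>(3)-energy and the \<open>\<Phi>\<close>(3)-tension field\<close>

text \<open>
  The induced connection on the pullback bundle \<open>u\<^sup>-\<^sup>1TN\<close>.  A section \<open>V\<close> has values \<open>V q\<close> in the
  tangent space at \<open>u q\<close>.  With the coordinate fields \<open>\<partial>\<^sub>a\<close> of a chart around \<open>u p\<close> one has
  \<open>V = \<Sum>\<^sub>a V\<^sub>a (\<partial>\<^sub>a \<circ> u)\<close> near \<open>p\<close>, and the induced connection is determined by the Leibniz rule and by
  \<open>\<nabla>\<^sub>X (\<partial>\<^sub>a \<circ> u) = \<nabla>\<^sup>N\<^sub>d\<^sub>u\<^sub>(\<^sub>X\<^sub>) \<partial>\<^sub>a\<close>.
\<close>

definition pullback_connection ::
  "('a, 'm::finite) chart set \<Rightarrow> ('b, 'n::finite) chart set \<Rightarrow> ('b, 'n) connection \<Rightarrow> ('a \<Rightarrow> 'b) \<Rightarrow>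
     'a \<Rightarrow> real ^ 'm \<Rightarrow> ('a \<Rightarrow> real ^ 'n) \<Rightarrow> real ^ 'n" where
  "pullback_connection A B DN u p X V =
     (let c = chart_at B (u p);
          frame = (\<lambda>a. coord_field B c (axis a 1));
          comp = (\<lambda>a q. tangent_coord B c (u q) (V q) $ a)
      in \<Sum>a\<in>UNIV. deriv_at A (comp a) p X *\<^sub>R frame a (u p)
                 + comp a p *\<^sub>R DN (u p) (differential A B u p X) (frame a))"

text \<open>
  The divergence of a \<open>u\<^sup>-\<^sup>1TN\<close>-valued 1-form, computed in a local orthonormal frame around \<open>p\<close>;
  the result does not depend on the frame.
\<close>

definition divergence ::
  "('a::topological_space, 'm::finite) chart set \<Rightarrow> ('a, 'm) metric \<Rightarrow> ('a, 'm) connection \<Rightarrow>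
     ('b, 'n::finite) chart set \<Rightarrow> ('b, 'n) connection \<Rightarrow> ('a \<Rightarrow> 'b) \<Rightarrow>
     ('a \<Rightarrow> real ^ 'm \<Rightarrow> real ^ 'n) \<Rightarrow> 'a \<Rightarrow> real ^ 'n" where
  "divergence A g DM B DN u \<omega> p =
     (let e = (SOME e. \<exists>W. p \<in> W \<and> local_orthonormal_frame A g W e)
      in \<Sum>i\<in>UNIV. pullback_connection A B DN u p (e i p) (\<lambda>q. \<omega> q (e i q))
                 - \<omega> p (DM p (e i p) (e i)))"

text \<open>\<open>d3\<close> is the 1-form \<open>d\<^sub>(\<^sub>3\<^sub>)u\<close> and \<open>d3_norm2\<close> is \<open>\<parallel>d\<^sub>(\<^sub>3\<^sub>)u\<parallel>\<^sup>2\<close>; both are independent of the chosen basis.\<close>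

definition d3 ::
  "('a, 'm::finite) chart set \<Rightarrow> ('a, 'm) metric \<Rightarrow> ('b, 'n::finite) chart set \<Rightarrow> ('b, 'n) metric \<Rightarrow>
     ('a \<Rightarrow> 'b) \<Rightarrow> 'a \<Rightarrow> real ^ 'm \<Rightarrow> real ^ 'n" where
  "d3 A g B h u p X =
     (let e = (SOME e. orthonormal_basis_at g p e); du = differential A B u p
      in \<Sum>j\<in>UNIV. \<Sum>k\<in>UNIV.
           (h (u p) (du X) (du (e j)) * h (u p) (du (e j)) (du (e k))) *\<^sub>R du (e k))"

definition d3_norm2 ::
  "('a, 'm::finite) chart set \<Rightarrow> ('a, 'm) metric \<Rightarrow> ('b, 'n::finite) chart set \<Rightarrow> ('b, 'n) metric \<Rightarrow>
     ('a \<Rightarrow> 'b) \<Rightarrow> 'a \<Rightarrow> real" where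
  "d3_norm2 A g B h u p =
     (let e = (SOME e. orthonormal_basis_at g p e)
      in \<Sum>i\<in>UNIV. h (u p) (d3 A g B h u p (e i)) (differential A B u p (e i)))"

definition Phi3_energy_on ::
  "('a, 'm::finite) chart set \<Rightarrow> ('a, 'm) metric \<Rightarrow> 'a measure \<Rightarrow>
     ('b, 'n::finite) chart set \<Rightarrow> ('b, 'n) metric \<Rightarrow> 'a set \<Rightarrow> ('a \<Rightarrow> 'b) \<Rightarrow> real" where
  "Phi3_energy_on A g \<mu> B h K u = (LINT p:K|\<mu>. d3_norm2 A g B h u p / 6)"

definition Phi3_energy ::
  "('a, 'm::finite) chart set \<Rightarrow> ('a, 'm) metric \<Rightarrow> 'a measure \<Rightarrow>
     ('b, 'n::finite) chart set \<Rightarrow> ('b, 'n) metric \<Rightarrow> ('a \<Rightarrow> 'b) \<Rightarrow> real" where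
  "Phi3_energy A g \<mu> B h u = (LINT p|\<mu>. d3_norm2 A g B h u p / 6)"

definition Phi3_tension ::
  "('a::topological_space, 'm::finite) chart set \<Rightarrow> ('a, 'm) metric \<Rightarrow> ('a, 'm) connection \<Rightarrow>
     ('b, 'n::finite) chart set \<Rightarrow> ('b, 'n) metric \<Rightarrow> ('b, 'n) connection \<Rightarrow>
     ('a \<Rightarrow> 'b) \<Rightarrow> 'a \<Rightarrow> real ^ 'n" where
  "Phi3_tension A g DM B h DN u = divergence A g DM B DN u (d3 A g B h u)"


section \<open>Variations\<close>

text \<open>
  Smoothness of \<open>(t, p) \<mapsto> U t p\<close> on the product \<open>{-\<delta><..<\<delta>} \<times> M\<close>.  Only the
  parameters \<open>t\<close> in \<open>{-\<delta><..<\<delta>}\<close> matter.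
\<close>

definition smooth_variation ::
  "('a::topological_space, 'm::finite) chart set \<Rightarrow> ('b::topological_space, 'n::finite) chart set \<Rightarrow>
     ('a \<Rightarrow> 'b) \<Rightarrow> real \<Rightarrow> (real \<Rightarrow> 'a \<Rightarrow> 'b) \<Rightarrow> bool" where
  "smooth_variation A B u \<delta> U \<longleftrightarrow>
     U 0 = u \<and>
     continuous_on ({-\<delta><..<\<delta>} \<times> UNIV) (\<lambda>(t, p). U t p) \<and>
     (\<forall>c\<in>A. \<forall>d\<in>B.
        smooth_on {(t, x). t \<in> {-\<delta><..<\<delta>} \<and> x \<in> chart_map c ` chart_dom c \<and> U t (chart_inv c x) \<in> chart_dom d}
          (\<lambda>(t, x). chart_map d (U t (chart_inv c x))))"

definition variation_supported_in :: "('a \<Rightarrow> 'b) \<Rightarrow> real \<Rightarrow> (real \<Rightarrow> 'a \<Rightarrow> 'b) \<Rightarrow> 'a set \<Rightarrow> bool" where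
  "variation_supported_in u \<delta> U K \<longleftrightarrow> (\<forall>t\<in>{-\<delta><..<\<delta>}. \<forall>p. p \<notin> K \<longrightarrow> U t p = u p)"

definition variation_field ::
  "('b, 'n::finite) chart set \<Rightarrow> (real \<Rightarrow> 'a \<Rightarrow> 'b) \<Rightarrow> 'a \<Rightarrow> real ^ 'n" where
  "variation_field B U p =
     vector_derivative (\<lambda>t. chart_map (chart_at B (U 0 p)) (U t p)) (at 0)"

end

theory Submission
  imports Defs
begin

text \<open>
  The first variation formula rests on a pointwise identity and on the divergence theorem.

  Let \<open>e\<^sub>i\<close> be an orthonormal frame of \<open>M\<close> and \<open>K\<^sub>i\<^sub>j = h(du(e\<^sub>i), du(e\<^sub>j))\<close>.  The energy density of
  \<open>u\<^sub>t\<close> is \<open>tr K\<^sup>3 / 6\<close>.  The frame does not depend on \<open>t\<close>, and the covariant derivative of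
  \<open>du\<^sub>t(e\<^sub>i)\<close> in the direction of \<open>t\<close> is \<open>\<nabla>\<^sub>e\<^sub>i v\<close>, because second derivatives commute and the
  connection of \<open>N\<close> is torsion free (\<open>nabla_t_du_frame\<close>).  Hence the density has the derivative
  \<open>\<Sum>\<^sub>i h(\<nabla>\<^sub>e\<^sub>i v, d\<^sub>(\<^sub>3\<^sub>)u(e\<^sub>i))\<close> at \<open>t = 0\<close> (\<open>energy_density_derivative\<close>).  On the other hand, metric
  compatibility of the induced connection lets one move \<open>v\<close> through the divergence that defines the
  tension field (\<open>tension_inner\<close>).  In the sum of the two expressions the terms with \<open>\<nabla>v\<close> cancel,
  and what is left is
  \<open>\<Sum>\<^sub>i e\<^sub>i(h(v, d\<^sub>(\<^sub>3\<^sub>)u(e\<^sub>i))) - h(v, d\<^sub>(\<^sub>3\<^sub>)u(\<nabla>\<^sub>e\<^sub>i e\<^sub>i))\<close>, the divergence of the vector field \<open>flux\<close> on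
  \<open>M\<close> that is dual to the 1-form \<open>Y \<mapsto> h(v, d\<^sub>(\<^sub>3\<^sub>)u(Y))\<close> (\<open>flux_divergence\<close>).  Like \<open>v\<close>
  it has compact support, so its divergence has integral zero (\<open>divergence_theorem\<close>).  It remains to
  differentiate under the integral over a compact set (\<open>derivative_under_integral\<close>).

  All computations take place in a chart \<open>c\<close> of \<open>M\<close> and a chart \<open>d\<close> of \<open>N\<close>.  There a connection is the
  ordinary derivative plus a bilinear map, \<open>christoffel\<close>, and only two of its properties enter:
  symmetry and compatibility with the metric.  Orthonormal bases take the place of inverse metric
  matrices: \<open>\<Sum>\<^sub>i b(e\<^sub>i, e\<^sub>i)\<close> does not depend on the orthonormal basis (\<open>orthonormal_trace\<close>), which
  reconciles the bases chosen independently of each other in the definitions of \<open>d\<^sub>(\<^sub>3\<^sub>)u\<close>, of its norm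
  and of the divergence.  The density \<open>w = \<surd>det g\<close> enters through its logarithmic derivative
  \<open>\<Sum>\<^sub>i g(\<nabla>e\<^sub>i, e\<^sub>i)\<close>, where the \<open>e\<^sub>i\<close> are extended with constant coefficients
  (\<open>vol_density_has_derivative\<close>).  It turns the divergence of \<open>flux\<close> into the coordinate expression
  \<open>w\<^sup>-\<^sup>1 \<Sum>\<^sub>k \<partial>\<^sub>k(w X\<^sup>k)\<close>.

  The divergence theorem is reduced by a partition of unity to compactly supported fields in
  Euclidean space.  There it follows from translation invariance of the Lebesgue integral, again by
  differentiation under the integral.  In every chart the pointwise identity equates the coordinate
  expression of the divergence with the same function on \<open>M\<close>, so that the chart independence of the
  divergence comes for free.
\<close>

section \<open>Calculus of smooth functions\<close>

lemma Ck_on_subset: "Ck_on k S f \<Longrightarrow> T \<subseteq> S \<Longrightarrow> Ck_on k T f"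
  by (induction k arbitrary: f) (auto intro: continuous_on_subset)

lemma Ck_on_cong:
  assumes "open S" "\<And>x. x \<in> S \<Longrightarrow> f x = g x" "Ck_on k S f"
  shows "Ck_on k S g"
  using assms(2,3)
proof (induction k arbitrary: f g)
  case 0
  then show ?case using continuous_on_cong[of S S f g] by simp
next
  case (Suc k)
  have d: "(g has_derivative frechet_derivative f (at x)) (at x)" if "x \<in> S" for x
    using Suc.prems that assms(1)
    by (metis Ck_on.simps(2) frechet_derivative_works has_derivative_transform_within_open)
  then have eq: "frechet_derivative f (at x) = frechet_derivative g (at x)" if "x \<in> S" for x
    using that frechet_derivative_at by blast
  have "Ck_on k S (\<lambda>x. frechet_derivative g (at x) v)" for v
    by (rule Suc.IH[of "\<lambda>x. frechet_derivative f (at x) v"]) (use Suc.prems eq in auto)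
  then show ?case using d by (auto simp: differentiable_def)
qed

lemma Ck_on_locally:
  assumes "\<And>x. x \<in> S \<Longrightarrow> \<exists>T. open T \<and> x \<in> T \<and> Ck_on k T f"
  shows "Ck_on k S f"
  using assms
proof (induction k arbitrary: f)
  case 0
  show ?case unfolding Ck_on.simps
    by (rule continuous_at_imp_continuous_on)
      (use 0 continuous_on_eq_continuous_at in fastforce)
next
  case (Suc k)
  have "Ck_on k S (\<lambda>x. frechet_derivative f (at x) v)" for v
    by (rule Suc.IH) (use Suc.prems in fastforce)
  moreover have "\<forall>x\<in>S. f differentiable (at x)" using Suc.prems by fastforce
  ultimately show ?case by simp
qed

lemma Ck_on_imp_continuous_on: "Ck_on k S f \<Longrightarrow> continuous_on S f"
  by (cases k) (auto intro!: continuous_at_imp_continuous_on differentiable_imp_continuous_within)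

lemma Ck_on_SucD: "Ck_on (Suc k) S f \<Longrightarrow> Ck_on k S f"
proof (induction k arbitrary: f)
  case 0
  then show ?case using Ck_on_imp_continuous_on[OF 0] by simp
next
  case (Suc k)
  then show ?case using Ck_on.simps(2) by blast
qed

lemma Ck_on_has_derivative:
  "Ck_on (Suc k) S f \<Longrightarrow> x \<in> S \<Longrightarrow> (f has_derivative frechet_derivative f (at x)) (at x)"
  using frechet_derivative_works by auto

text \<open>The way to establish differentiability classes: a formula for the derivative determines
  \<open>frechet_derivative\<close> by uniqueness, so its regularity can be read off the formula.\<close>

lemma Ck_on_SucI:
  assumes "open S" "\<And>x. x \<in> S \<Longrightarrow> (f has_derivative f' x) (at x)" "\<And>v. Ck_on k S (\<lambda>x. f' x v)"
  shows "Ck_on (Suc k) S f"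
proof -
  have "f' x = frechet_derivative f (at x)" if "x \<in> S" for x
    using assms(2)[OF that] frechet_derivative_at by blast
  then have "Ck_on k S (\<lambda>x. frechet_derivative f (at x) v)" for v
    by (intro Ck_on_cong[OF assms(1) _ assms(3)[of v]]) auto
  then show ?thesis using assms(2) by (auto simp: differentiable_def)
qed

lemma Ck_on_const: "open S \<Longrightarrow> Ck_on k S (\<lambda>x. c)"
  by (induction k arbitrary: c) auto

lemma Ck_on_linear:
  assumes "open S" "bounded_linear L" shows "Ck_on k S L"
proof (cases k)
  case 0
  then show ?thesis using assms by (simp add: linear_continuous_on)
next
  case (Suc j)
  show ?thesis unfolding Suc
    by (rule Ck_on_SucI[where f' = "\<lambda>_. L"])
      (auto intro: assms Ck_on_const bounded_linear_imp_has_derivative)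
qed

lemma Ck_on_add:
  assumes "open S" "Ck_on k S f" "Ck_on k S g"
  shows "Ck_on k S (\<lambda>x. f x + g x)"
  using assms(2,3)
proof (induction k arbitrary: f g)
  case 0
  then show ?case by (auto intro: continuous_intros)
next
  case (Suc k)
  show ?case
    by (rule Ck_on_SucI[where f' = "\<lambda>x v. frechet_derivative f (at x) v + frechet_derivative g (at x) v"])
      (use Suc assms(1) in \<open>auto intro!: has_derivative_add Ck_on_has_derivative\<close>)
qed

lemma Ck_on_sum:
  assumes "open S" "\<And>i. i \<in> I \<Longrightarrow> Ck_on k S (f i)"
  shows "Ck_on k S (\<lambda>x. \<Sum>i\<in>I. f i x)"
  using assms(2)
  by (induction I rule: infinite_finite_induct) (auto intro: Ck_on_const Ck_on_add assms(1))

text \<open>The product rule writes the derivative as a sum of two products of the same kind, with one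
  degree of differentiability less.\<close>

lemma Ck_on_bilinear:
  assumes B: "bounded_bilinear B" and "open S" "Ck_on k S f" "Ck_on k S g"
  shows "Ck_on k S (\<lambda>x. B (f x) (g x))"
  using assms(3,4)
proof (induction k arbitrary: f g)
  case 0
  then show ?case using bounded_bilinear.continuous_on[OF B] by auto
next
  case (Suc k)
  have c: "Ck_on k S (\<lambda>x. B (f x) (frechet_derivative g (at x) v) + B (frechet_derivative f (at x) v) (g x))" for v
    using Suc.prems Ck_on_SucD[OF Suc.prems(1)] Ck_on_SucD[OF Suc.prems(2)]
    by (intro Ck_on_add \<open>open S\<close> Suc.IH) simp_all
  have d: "((\<lambda>x. B (f x) (g x)) has_derivative
     (\<lambda>v. B (f x) (frechet_derivative g (at x) v) + B (frechet_derivative f (at x) v) (g x))) (at x)"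
    if "x \<in> S" for x
    using Suc.prems that by (intro bounded_bilinear.FDERIV[OF B] Ck_on_has_derivative) auto
  show ?case by (rule Ck_on_SucI[OF \<open>open S\<close> d c])
qed

lemmas Ck_on_scaleR = Ck_on_bilinear[OF bounded_bilinear_scaleR]
lemmas Ck_on_mult = Ck_on_bilinear[OF bounded_bilinear_mult]

lemma Ck_on_compose_linear:
  assumes "open S" "bounded_linear L" "Ck_on k S f" shows "Ck_on k S (\<lambda>x. L (f x))"
  using assms(3)
proof (induction k arbitrary: f)
  case 0
  then show ?case using bounded_linear.continuous_on[OF assms(2)] by auto
next
  case (Suc k)
  have "Ck_on k S (\<lambda>x. L (frechet_derivative f (at x) v))" for v
    using Suc by auto
  from Ck_on_SucI[OF assms(1)
      bounded_linear.has_derivative[OF assms(2) Ck_on_has_derivative[OF Suc.prems]] this]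
  show ?case .
qed

lemma linear_Basis_expansion:
  fixes f :: "'f::euclidean_space \<Rightarrow> 'g::real_vector"
  assumes "linear f" shows "(\<Sum>b\<in>Basis. (x \<bullet> b) *\<^sub>R f b) = f x"
proof -
  have "f x = f (\<Sum>b\<in>Basis. (x \<bullet> b) *\<^sub>R b)" by (simp add: euclidean_representation)
  also have "\<dots> = (\<Sum>b\<in>Basis. (x \<bullet> b) *\<^sub>R f b)"
    by (simp add: linear_sum[OF assms] linear_scale[OF assms])
  finally show ?thesis by simp
qed

text \<open>By the chain rule the derivative in direction \<open>v\<close> is \<open>\<Sum>\<^sub>b (Dg(v) \<bullet> b) (Df \<circ> g)(b)\<close>.  Expanding in a
  basis keeps the directions \<open>b\<close> constant, so that the induction hypothesis applies to \<open>Df(b) \<circ> g\<close>.\<close>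

lemma Ck_on_compose:
  fixes f :: "'f::euclidean_space \<Rightarrow> 'g::real_normed_vector" and g :: "'e::euclidean_space \<Rightarrow> 'f"
  assumes "open S" "open T" "\<And>x. x \<in> S \<Longrightarrow> g x \<in> T" "Ck_on k T f" "Ck_on k S g"
  shows "Ck_on k S (\<lambda>x. f (g x))"
  using assms(4,5)
proof (induction k arbitrary: f)
  case 0
  then show ?case using assms(3) by (auto intro: continuous_on_compose2)
next
  case (Suc k)
  have d: "((\<lambda>x. f (g x)) has_derivative
     (\<lambda>v. frechet_derivative f (at (g x)) (frechet_derivative g (at x) v))) (at x)"
    if "x \<in> S" for x
    using has_derivative_compose[OF Ck_on_has_derivative[OF Suc.prems(2) that]
        Ck_on_has_derivative[OF Suc.prems(1) assms(3)[OF that]]] .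
  have "(\<lambda>x. \<Sum>b\<in>Basis. (frechet_derivative g (at x) v \<bullet> b) *\<^sub>R frechet_derivative f (at (g x)) b) x
     = frechet_derivative f (at (g x)) (frechet_derivative g (at x) v)" if "x \<in> S" for x v
  proof -
    have "linear (frechet_derivative f (at (g x)))"
      using Suc.prems assms(3) that by (simp add: linear_frechet_derivative)
    then show ?thesis
      by (rule linear_Basis_expansion)
  qed
  moreover have c: "Ck_on k S (\<lambda>x. \<Sum>b\<in>Basis. (frechet_derivative g (at x) v \<bullet> b) *\<^sub>R frechet_derivative f (at (g x)) b)" for v
    using Suc.prems Ck_on_SucD[OF Suc.prems(2)]
    by (intro Ck_on_sum Ck_on_scaleR Ck_on_compose_linear[OF _ bounded_linear_inner_left] assms(1) Suc.IH)
       simp_all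
  ultimately have "Ck_on k S (\<lambda>x. frechet_derivative f (at (g x)) (frechet_derivative g (at x) v))" for v
    using Ck_on_cong[OF \<open>open S\<close> _ c[of v]] by simp
  from Ck_on_SucI[OF \<open>open S\<close> d this] show ?case .
qed

text \<open>The derivatives of \<open>1/x\<close> and \<open>1/\<surd>x\<close> are polynomials in the functions themselves, so
  smoothness follows by induction from the product rule.\<close>

lemma Ck_on_inverse_real: "Ck_on k (- {0::real}) inverse"
proof (induction k)
  case 0
  then show ?case by (auto intro: continuous_intros)
next
  case (Suc k)
  show ?case
    by (rule Ck_on_SucI[where f' = "\<lambda>x v. - (inverse x * v * inverse x)"])
     (auto intro!: has_derivative_inverse' open_Compl Suc Ck_on_mult Ck_on_const
         Ck_on_compose_linear[where L = uminus] bounded_linear_minus bounded_linear_ident)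
qed

lemma Ck_on_rsqrt_real: "Ck_on k {0::real<..} (\<lambda>x. inverse (sqrt x))"
proof (induction k)
  case 0
  then show ?case by (auto intro!: continuous_intros)
next
  case (Suc k)
  have d: "((\<lambda>x. inverse (sqrt x)) has_derivative
     (\<lambda>v. (- (1/2) * v) * (inverse (sqrt x) * (inverse (sqrt x) * inverse (sqrt x))))) (at x)"
    if "x \<in> {0<..}" for x :: real
    using that
    by (auto intro!: derivative_eq_intros ext simp: field_simps)
  have "Ck_on k {0::real<..}
     (\<lambda>x. (- (1/2) * v) * (inverse (sqrt x) * (inverse (sqrt x) * inverse (sqrt x))))" for v
    by (rule Ck_on_mult[OF _ Ck_on_const Ck_on_mult[OF _ Suc Ck_on_mult[OF _ Suc Suc]]]) simp_all
  from Ck_on_SucI[OF open_greaterThan d this] show ?case .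
qed

lemma smooth_onD: "smooth_on S f \<Longrightarrow> Ck_on k S f"
  by (simp add: smooth_on_def)

lemma smooth_on_subset: "smooth_on S f \<Longrightarrow> T \<subseteq> S \<Longrightarrow> smooth_on T f"
  by (auto simp: smooth_on_def intro: Ck_on_subset)

lemma smooth_on_cong: "open S \<Longrightarrow> (\<And>x. x \<in> S \<Longrightarrow> f x = g x) \<Longrightarrow> smooth_on S f \<Longrightarrow> smooth_on S g"
  unfolding smooth_on_def using Ck_on_cong by blast

lemma smooth_on_locally:
  "(\<And>x. x \<in> S \<Longrightarrow> \<exists>T. open T \<and> x \<in> T \<and> smooth_on T f) \<Longrightarrow> smooth_on S f"
  unfolding smooth_on_def by (intro allI Ck_on_locally) metis

lemma smooth_on_imp_continuous_on: "smooth_on S f \<Longrightarrow> continuous_on S f"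
  using Ck_on_imp_continuous_on smooth_onD by blast

lemma smooth_on_has_derivative:
  "smooth_on S f \<Longrightarrow> x \<in> S \<Longrightarrow> (f has_derivative frechet_derivative f (at x)) (at x)"
  using Ck_on_has_derivative smooth_onD by blast

lemma smooth_on_differentiable: "smooth_on S f \<Longrightarrow> x \<in> S \<Longrightarrow> f differentiable at x"
  using smooth_on_has_derivative differentiable_def by blast

lemma smooth_on_linear_derivative: "smooth_on S f \<Longrightarrow> x \<in> S \<Longrightarrow> linear (frechet_derivative f (at x))"
  using smooth_on_differentiable linear_frechet_derivative by blast

lemma smooth_on_const: "open S \<Longrightarrow> smooth_on S (\<lambda>x. c)"
  by (simp add: smooth_on_def Ck_on_const)

lemma smooth_on_linear: "open S \<Longrightarrow> bounded_linear L \<Longrightarrow> smooth_on S L"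
  by (simp add: smooth_on_def Ck_on_linear)

lemma smooth_on_add: "open S \<Longrightarrow> smooth_on S f \<Longrightarrow> smooth_on S g \<Longrightarrow> smooth_on S (\<lambda>x. f x + g x)"
  by (simp add: smooth_on_def Ck_on_add)

lemma smooth_on_sum:
  "open S \<Longrightarrow> (\<And>i. i \<in> I \<Longrightarrow> smooth_on S (f i)) \<Longrightarrow> smooth_on S (\<lambda>x. \<Sum>i\<in>I. f i x)"
  by (simp add: smooth_on_def Ck_on_sum)

lemma smooth_on_scaleR:
  "open S \<Longrightarrow> smooth_on S f \<Longrightarrow> smooth_on S g \<Longrightarrow> smooth_on S (\<lambda>x. f x *\<^sub>R g x)"
  by (simp add: smooth_on_def Ck_on_scaleR)

lemma smooth_on_mult:
  fixes f g :: "'e::euclidean_space \<Rightarrow> real"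
  shows "open S \<Longrightarrow> smooth_on S f \<Longrightarrow> smooth_on S g \<Longrightarrow> smooth_on S (\<lambda>x. f x * g x)"
  by (simp add: smooth_on_def Ck_on_mult)

lemma smooth_on_prod:
  fixes f :: "'i \<Rightarrow> 'e::euclidean_space \<Rightarrow> real"
  assumes "open S" "\<And>i. i \<in> I \<Longrightarrow> smooth_on S (f i)"
  shows "smooth_on S (\<lambda>x. \<Prod>i\<in>I. f i x)"
  using assms(2)
  by (induction I rule: infinite_finite_induct) (auto intro: smooth_on_const smooth_on_mult assms(1))

lemma smooth_on_compose_linear:
  "open S \<Longrightarrow> bounded_linear L \<Longrightarrow> smooth_on S f \<Longrightarrow> smooth_on S (\<lambda>x. L (f x))"
  by (simp add: smooth_on_def Ck_on_compose_linear)

lemma smooth_on_compose: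
  fixes f :: "'f::euclidean_space \<Rightarrow> 'g::real_normed_vector" and g :: "'e::euclidean_space \<Rightarrow> 'f"
  assumes "open S" "open T" "\<And>x. x \<in> S \<Longrightarrow> g x \<in> T" "smooth_on T f" "smooth_on S g"
  shows "smooth_on S (\<lambda>x. f (g x))"
  using Ck_on_compose[OF assms(1-3) smooth_onD[OF assms(4)] smooth_onD[OF assms(5)]]
  by (simp add: smooth_on_def)

lemma smooth_on_diff:
  assumes "open S" "smooth_on S f" "smooth_on S g" shows "smooth_on S (\<lambda>x. f x - g x)"
  using smooth_on_add[OF assms(1,2) smooth_on_compose_linear[OF assms(1) _ assms(3), of uminus]]
  by (simp add: bounded_linear_minus bounded_linear_ident)

lemma smooth_on_Pair:
  fixes f :: "'e::euclidean_space \<Rightarrow> 'f::euclidean_space" and g :: "'e \<Rightarrow> 'g::euclidean_space"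
  assumes "open S" "smooth_on S f" "smooth_on S g" shows "smooth_on S (\<lambda>x. (f x, g x))"
proof -
  have "smooth_on S (\<lambda>x. (f x, 0) + (0, g x))"
    by (intro smooth_on_add assms smooth_on_compose_linear[of _ "\<lambda>y. (y, 0)" f]
          smooth_on_compose_linear[of _ "\<lambda>y. (0, y)" g] bounded_linear_Pair
          bounded_linear_ident bounded_linear_zero)
  then show ?thesis by simp
qed

lemma smooth_on_rsqrt:
  fixes f :: "'e::euclidean_space \<Rightarrow> real"
  assumes "open S" "smooth_on S f" "\<And>x. x \<in> S \<Longrightarrow> f x > 0"
  shows "smooth_on S (\<lambda>x. inverse (sqrt (f x)))"
  using assms(3) by (intro smooth_on_compose[OF assms(1) _ _ _ assms(2), of "{0<..}"])
    (auto simp: smooth_on_def Ck_on_rsqrt_real)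

lemma smooth_on_sqrt:
  fixes f :: "'e::euclidean_space \<Rightarrow> real"
  assumes "open S" "smooth_on S f" "\<And>x. x \<in> S \<Longrightarrow> f x > 0"
  shows "smooth_on S (\<lambda>x. sqrt (f x))"
  by (rule smooth_on_cong[OF assms(1) _ smooth_on_mult[OF assms(1,2) smooth_on_rsqrt[OF assms]]])
    (use assms(3) in \<open>auto simp: divide_inverse[symmetric] real_div_sqrt less_imp_le\<close>)

lemma smooth_on_frechet_derivative: "smooth_on S f \<Longrightarrow> smooth_on S (\<lambda>x. frechet_derivative f (at x) v)"
  unfolding smooth_on_def using Ck_on.simps(2) by blast

text \<open>Expanding the direction in a basis reduces this to sums of products of coordinate functions
  with derivatives in constant directions.\<close>

lemma smooth_on_frechet_derivative_along:
  fixes f :: "'f::euclidean_space \<Rightarrow> 'g::real_normed_vector" and g X :: "'e::euclidean_space \<Rightarrow> 'f"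
  assumes "open S" "open T" "smooth_on T f" "smooth_on S g" "smooth_on S X" "\<And>x. x \<in> S \<Longrightarrow> g x \<in> T"
  shows "smooth_on S (\<lambda>x. frechet_derivative f (at (g x)) (X x))"
proof (rule smooth_on_cong[OF assms(1)])
  show "smooth_on S (\<lambda>x. \<Sum>b\<in>Basis. (X x \<bullet> b) *\<^sub>R frechet_derivative f (at (g x)) b)"
    by (intro smooth_on_sum smooth_on_scaleR assms smooth_on_compose_linear[of _ "\<lambda>y. y \<bullet> b" for b]
        bounded_linear_inner_left
        smooth_on_compose[OF _ assms(2) _ smooth_on_frechet_derivative]) auto
  fix x assume "x \<in> S"
  then have "linear (frechet_derivative f (at (g x)))"
    using assms smooth_on_linear_derivative by blast
  then show "(\<Sum>b\<in>Basis. (X x \<bullet> b) *\<^sub>R frechet_derivative f (at (g x)) b)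
      = frechet_derivative f (at (g x)) (X x)"
    by (rule linear_Basis_expansion)
qed

lemma smooth_on_vec_nth: "open S \<Longrightarrow> smooth_on S f \<Longrightarrow> smooth_on S (\<lambda>x. f x $ i)"
  by (rule smooth_on_compose_linear[OF _ bounded_linear_vec_nth])

subsection \<open>Symmetry of second derivatives\<close>

text \<open>The second difference over a small parallelogram is symmetric in \<open>a\<close> and \<open>b\<close>, and the mean value
  theorem, applied twice, expresses it by the iterated derivative at a point of the parallelogram.\<close>

lemma second_difference_mean_value:
  fixes f :: "'e::euclidean_space \<Rightarrow> real"
  assumes f: "smooth_on S f" and s: "s > 0"
    and sub: "\<And>q r. q \<in> {0..s} \<Longrightarrow> r \<in> {0..s} \<Longrightarrow> x + q *\<^sub>R a + r *\<^sub>R b \<in> S"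
  shows "\<exists>q\<in>{0..s}. \<exists>r\<in>{0..s}.
     f (x + s *\<^sub>R a + s *\<^sub>R b) - f (x + s *\<^sub>R a) - f (x + s *\<^sub>R b) + f x =
     s * s * frechet_derivative (\<lambda>y. frechet_derivative f (at y) a) (at (x + q *\<^sub>R a + r *\<^sub>R b)) b"
proof -
  define p where "p q = f (x + q *\<^sub>R a + s *\<^sub>R b) - f (x + q *\<^sub>R a)" for q
  define p' where "p' q = frechet_derivative f (at (x + q *\<^sub>R a + s *\<^sub>R b)) a
      - frechet_derivative f (at (x + q *\<^sub>R a)) a" for q
  have dir: "((\<lambda>q. h (y + q *\<^sub>R c)) has_real_derivative frechet_derivative h (at (y + q *\<^sub>R c)) c) (at q)"
    if "smooth_on S h" "y + q *\<^sub>R c \<in> S" for h :: "'e \<Rightarrow> real" and y c q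
  proof -
    have "((\<lambda>q. y + q *\<^sub>R c) has_derivative (\<lambda>t. t *\<^sub>R c)) (at q)"
      by (auto intro!: derivative_eq_intros)
    from has_derivative_compose[OF this smooth_on_has_derivative[OF that]]
    show ?thesis
      using linear_scale[OF smooth_on_linear_derivative[OF that]]
      by (simp add: has_field_derivative_def fun_eq_iff mult.commute mult_commute_abs)
  qed
  have "\<exists>q. 0 < q \<and> q < s \<and> p s - p 0 = (s - 0) * p' q"
  proof (rule MVT2[OF s])
    fix q assume q: "0 \<le> q" "q \<le> s"
    have "((\<lambda>q. f (x + s *\<^sub>R b + q *\<^sub>R a) - f (x + q *\<^sub>R a)) has_real_derivative
       (frechet_derivative f (at (x + s *\<^sub>R b + q *\<^sub>R a)) a - frechet_derivative f (at (x + q *\<^sub>R a)) a)) (at q)"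
      using sub[of q s] sub[of q 0] q s by (intro DERIV_diff dir f) (auto simp: algebra_simps)
    then show "(p has_real_derivative p' q) (at q)"
      unfolding p_def p'_def by (simp add: add_ac)
  qed
  then obtain q where q: "0 < q" "q < s" "p s - p 0 = s * p' q" by auto
  define k where "k r = frechet_derivative f (at (x + q *\<^sub>R a + r *\<^sub>R b)) a" for r
  have "\<exists>r. 0 < r \<and> r < s \<and> k s - k 0 = (s - 0) *
    frechet_derivative (\<lambda>y. frechet_derivative f (at y) a) (at (x + q *\<^sub>R a + r *\<^sub>R b)) b"
    unfolding k_def
    by (rule MVT2[OF s]) (use q sub in \<open>auto intro!: dir smooth_on_frechet_derivative f\<close>)
  then obtain r where "0 < r" "r < s" "k s - k 0 = s *
    frechet_derivative (\<lambda>y. frechet_derivative f (at y) a) (at (x + q *\<^sub>R a + r *\<^sub>R b)) b" by auto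
  then show ?thesis using q
    by (intro bexI[of _ q] bexI[of _ r]) (auto simp: p_def p'_def k_def algebra_simps)
qed

text \<open>If the two iterated derivatives differed at \<open>x\<close>, they would by continuity take disjoint sets of
  values near \<open>x\<close>, whereas both represent the same second difference.\<close>

lemma second_derivative_symmetric_real:
  fixes f :: "'e::euclidean_space \<Rightarrow> real"
  assumes S: "open S" and f: "smooth_on S f" and x: "x \<in> S"
  shows "frechet_derivative (\<lambda>y. frechet_derivative f (at y) a) (at x) b
       = frechet_derivative (\<lambda>y. frechet_derivative f (at y) b) (at x) a"
    (is "?F a b x = ?F b a x")
proof (rule ccontr)
  assume ne: "?F a b x \<noteq> ?F b a x"
  have cont: "continuous_on S (?F a b)" "continuous_on S (?F b a)"
    by (intro smooth_on_imp_continuous_on smooth_on_frechet_derivative f)+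
  define e where "e = \<bar>?F a b x - ?F b a x\<bar> / 2"
  have e: "e > 0" using ne by (simp add: e_def)
  obtain d where d: "d > 0" "ball x d \<subseteq> S"
    "\<And>y. y \<in> ball x d \<Longrightarrow> dist (?F a b y) (?F a b x) < e"
    "\<And>y. y \<in> ball x d \<Longrightarrow> dist (?F b a y) (?F b a x) < e"
  proof -
    obtain d0 where "d0 > 0" "ball x d0 \<subseteq> S" using S x openE by blast
    moreover obtain d1 where "d1 > 0" "\<And>y. y \<in> S \<Longrightarrow> dist y x < d1 \<Longrightarrow> dist (?F a b y) (?F a b x) < e"
      using cont(1) x e unfolding continuous_on_iff by meson
    moreover obtain d2 where "d2 > 0" "\<And>y. y \<in> S \<Longrightarrow> dist y x < d2 \<Longrightarrow> dist (?F b a y) (?F b a x) < e"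
      using cont(2) x e unfolding continuous_on_iff by meson
    ultimately show ?thesis
      by (intro that[of "min d0 (min d1 d2)"]) (auto simp: dist_commute subset_iff)
  qed
  \<comment> \<open>small enough for the parallelogram spanned by \<open>s a\<close> and \<open>s b\<close> at \<open>x\<close> to lie in the ball\<close>
  define s where "s = d / (2 * (norm a + norm b + 1))"
  have pos: "norm a + norm b + 1 > 0" by (smt (verit) norm_ge_zero)
  then have s: "s > 0" using d by (simp add: s_def)
  have "s * (norm a + norm b) \<le> s * (norm a + norm b + 1)" using s by simp
  also have "\<dots> = d / 2" using pos by (simp add: s_def field_simps)
  finally have sab: "s * norm a + s * norm b < d" using d by (simp add: algebra_simps)
  have in_ball: "x + q *\<^sub>R a + r *\<^sub>R b \<in> ball x d" if "q \<in> {0..s}" "r \<in> {0..s}" for q r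
  proof -
    have "norm (q *\<^sub>R a + r *\<^sub>R b) \<le> q * norm a + r * norm b"
      using norm_triangle_ineq[of "q *\<^sub>R a" "r *\<^sub>R b"] that by simp
    also have "\<dots> \<le> s * norm a + s * norm b"
      using that by (intro add_mono mult_right_mono) auto
    finally have "norm (q *\<^sub>R a + r *\<^sub>R b) < d" using sab by simp
    moreover have "dist x (x + q *\<^sub>R a + r *\<^sub>R b) = norm (q *\<^sub>R a + r *\<^sub>R b)"
      by (metis add.assoc dist_add_cancel dist_0_norm add.right_neutral)
    ultimately show ?thesis by simp
  qed
  have in_ball': "x + q *\<^sub>R b + r *\<^sub>R a \<in> ball x d" if "q \<in> {0..s}" "r \<in> {0..s}" for q r
    using in_ball[OF that(2,1)] by (simp add: add_ac)
  obtain q r where qr: "q \<in> {0..s}" "r \<in> {0..s}"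
     "f (x + s *\<^sub>R a + s *\<^sub>R b) - f (x + s *\<^sub>R a) - f (x + s *\<^sub>R b) + f x =
     s * s * ?F a b (x + q *\<^sub>R a + r *\<^sub>R b)"
    using second_difference_mean_value[OF f s, of x a b] in_ball d(2) by blast
  obtain q' r' where qr': "q' \<in> {0..s}" "r' \<in> {0..s}"
     "f (x + s *\<^sub>R b + s *\<^sub>R a) - f (x + s *\<^sub>R b) - f (x + s *\<^sub>R a) + f x =
     s * s * ?F b a (x + q' *\<^sub>R b + r' *\<^sub>R a)"
    using second_difference_mean_value[OF f s, of x b a] in_ball' d(2) by blast
  have "s * s * ?F a b (x + q *\<^sub>R a + r *\<^sub>R b) = s * s * ?F b a (x + q' *\<^sub>R b + r' *\<^sub>R a)"
    using qr(3) qr'(3) by (simp add: algebra_simps)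
  then have eq: "?F a b (x + q *\<^sub>R a + r *\<^sub>R b) = ?F b a (x + q' *\<^sub>R b + r' *\<^sub>R a)"
    using s by simp
  from d(4)[OF in_ball'[OF qr'(1,2)]] d(3)[OF in_ball[OF qr(1,2)]] eq show False
    unfolding e_def dist_real_def by (smt (verit) field_sum_of_halves)
qed

lemma second_derivative_symmetric:
  fixes f :: "'e::euclidean_space \<Rightarrow> 'f::euclidean_space"
  assumes S: "open S" and f: "smooth_on S f" and x: "x \<in> S"
  shows "frechet_derivative (\<lambda>y. frechet_derivative f (at y) a) (at x) b
       = frechet_derivative (\<lambda>y. frechet_derivative f (at y) b) (at x) a"
proof (rule euclidean_eqI)
  fix i :: 'f assume "i \<in> Basis"
  let ?f = "\<lambda>y. f y \<bullet> i"
  have comp: "frechet_derivative (\<lambda>z. h z \<bullet> i) (at y) c = frechet_derivative h (at y) c \<bullet> i"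
    if "smooth_on S h" "y \<in> S" for h :: "'e \<Rightarrow> 'f" and y c
    using has_derivative_inner_left[OF smooth_on_has_derivative[OF that], of i]
    by (metis frechet_derivative_at)
  have *: "frechet_derivative (\<lambda>y. frechet_derivative ?f (at y) a) (at x) b
     = frechet_derivative (\<lambda>y. frechet_derivative f (at y) a) (at x) b \<bullet> i" for a b
  proof -
    have "frechet_derivative (\<lambda>y. frechet_derivative ?f (at y) a) (at x)
        = frechet_derivative (\<lambda>y. frechet_derivative f (at y) a \<bullet> i) (at x)"
      by (rule frechet_derivative_transform_within_open[OF _ S x])
         (use x f smooth_on_frechet_derivative[OF f] comp in
           \<open>auto intro!: smooth_on_differentiable[of S] smooth_on_frechet_derivative
             smooth_on_compose_linear[OF S bounded_linear_inner_left]\<close>)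
    then show ?thesis using comp[OF smooth_on_frechet_derivative[OF f] x] by simp
  qed
  have "smooth_on S ?f" by (rule smooth_on_compose_linear[OF S bounded_linear_inner_left f])
  from second_derivative_symmetric_real[OF S this x]
  show "frechet_derivative (\<lambda>y. frechet_derivative f (at y) a) (at x) b \<bullet> i
       = frechet_derivative (\<lambda>y. frechet_derivative f (at y) b) (at x) a \<bullet> i"
    by (simp add: *)
qed

section \<open>Manifolds in charts\<close>

locale smooth_manifold =
  fixes A :: "('a::{t2_space,second_countable_topology}, 'm::finite) chart set"
  assumes atlas: "smooth_atlas A"
begin

abbreviation img :: "('a, 'm) chart \<Rightarrow> (real ^ 'm) set" where
  "img c \<equiv> chart_map c ` chart_dom c"

lemma chart_at: "chart_at A p \<in> A" "p \<in> chart_dom (chart_at A p)"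
proof -
  have "\<exists>c. c \<in> A \<and> p \<in> chart_dom c" using atlas unfolding smooth_atlas_def by blast
  from someI_ex[OF this] show "chart_at A p \<in> A" "p \<in> chart_dom (chart_at A p)"
    by (auto simp: chart_at_def)
qed

context
  fixes c assumes c: "c \<in> A"
begin

lemma open_dom: "open (chart_dom c)" and open_img: "open (img c)"
  and chart_homeomorphism: "homeomorphism (chart_dom c) (img c) (chart_map c) (chart_inv c)"
  using atlas c unfolding smooth_atlas_def by blast+

lemma chart_inv_map: "p \<in> chart_dom c \<Longrightarrow> chart_inv c (chart_map c p) = p"
  and chart_map_inv: "x \<in> img c \<Longrightarrow> chart_map c (chart_inv c x) = x"
  and chart_inv_dom: "x \<in> img c \<Longrightarrow> chart_inv c x \<in> chart_dom c"
  using chart_homeomorphism by (auto simp: homeomorphism_def)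

lemma continuous_on_chart_map: "continuous_on (chart_dom c) (chart_map c)"
  and continuous_on_chart_inv: "continuous_on (img c) (chart_inv c)"
  using chart_homeomorphism by (auto simp: homeomorphism_def)

lemma open_chart_image: "open W \<Longrightarrow> W \<subseteq> chart_dom c \<Longrightarrow> open (chart_map c ` W)"
  using homeomorphism_imp_open_map[OF chart_homeomorphism, of W] open_dom open_img
  by (simp add: openin_open_eq)

lemma open_chart_inv_image: "open W \<Longrightarrow> W \<subseteq> img c \<Longrightarrow> open (chart_inv c ` W)"
  using homeomorphism_imp_open_map[OF homeomorphism_symD[OF chart_homeomorphism], of W] open_dom open_img
  by (simp add: openin_open_eq)

lemma chart_image_inv_image: "W \<subseteq> img c \<Longrightarrow> chart_map c ` chart_inv c ` W = W"
  using chart_map_inv by (force simp: image_iff)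

lemma chart_inv_image_subset: "W \<subseteq> img c \<Longrightarrow> chart_inv c ` W \<subseteq> chart_dom c"
  using chart_inv_dom by auto

end

lemma smooth_transition:
  "c \<in> A \<Longrightarrow> d \<in> A \<Longrightarrow> smooth_on (chart_map c ` (chart_dom c \<inter> chart_dom d)) (chart_map d \<circ> chart_inv c)"
  using atlas unfolding smooth_atlas_def by blast

lemma open_overlap:
  "c \<in> A \<Longrightarrow> d \<in> A \<Longrightarrow> open (chart_map c ` (chart_dom c \<inter> chart_dom d))"
  by (intro open_chart_image open_Int open_dom) auto

text \<open>The chain rule for a change of charts.  All statements about components of tangent vectors follow
  from it, since \<open>deriv_at\<close>, \<open>tangent_coord\<close> and \<open>coord_field\<close> are derivatives of such compositions.\<close>

lemma chart_change:
  assumes c: "c \<in> A" "p \<in> chart_dom c" and d: "d \<in> A" "p \<in> chart_dom d"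
    and f: "(f \<circ> chart_inv d) differentiable at (chart_map d p)"
  shows "(f \<circ> chart_inv c) differentiable at (chart_map c p)"
    and "frechet_derivative (f \<circ> chart_inv c) (at (chart_map c p)) v =
      frechet_derivative (f \<circ> chart_inv d) (at (chart_map d p))
        (frechet_derivative (chart_map d \<circ> chart_inv c) (at (chart_map c p)) v)"
proof -
  let ?S = "chart_map c ` (chart_dom c \<inter> chart_dom d)"
  have p: "chart_map c p \<in> ?S" using assms by auto
  have "(chart_map d \<circ> chart_inv c) (chart_map c p) = chart_map d p"
    using c chart_inv_map by simp
  with has_derivative_compose[OF smooth_on_has_derivative[OF smooth_transition[OF c(1) d(1)] p],
      of "f \<circ> chart_inv d" "frechet_derivative (f \<circ> chart_inv d) (at (chart_map d p))"] f
  have "((\<lambda>x. (f \<circ> chart_inv d) ((chart_map d \<circ> chart_inv c) x)) has_derivative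
     (\<lambda>v. frechet_derivative (f \<circ> chart_inv d) (at (chart_map d p))
        (frechet_derivative (chart_map d \<circ> chart_inv c) (at (chart_map c p)) v))) (at (chart_map c p))"
    by (simp add: frechet_derivative_works)
  then have D: "((f \<circ> chart_inv c) has_derivative
     (\<lambda>v. frechet_derivative (f \<circ> chart_inv d) (at (chart_map d p))
        (frechet_derivative (chart_map d \<circ> chart_inv c) (at (chart_map c p)) v))) (at (chart_map c p))"
    by (rule has_derivative_transform_within_open[OF _ open_overlap[OF c(1) d(1)] p])
      (auto simp: chart_inv_map c d)
  then show "(f \<circ> chart_inv c) differentiable at (chart_map c p)"
    by (auto simp: differentiable_def)
  show "frechet_derivative (f \<circ> chart_inv c) (at (chart_map c p)) v =
      frechet_derivative (f \<circ> chart_inv d) (at (chart_map d p))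
        (frechet_derivative (chart_map d \<circ> chart_inv c) (at (chart_map c p)) v)"
    using frechet_derivative_at[OF D] by metis
qed

lemma transition_differentiable:
  assumes "c \<in> A" "p \<in> chart_dom c" "d \<in> A" "p \<in> chart_dom d"
  shows "(chart_map d \<circ> chart_inv c) differentiable at (chart_map c p)"
  using smooth_on_differentiable[OF smooth_transition[OF assms(1,3)]] assms by blast

lemma transition_self:
  assumes "c \<in> A" "p \<in> chart_dom c"
  shows "frechet_derivative (chart_map c \<circ> chart_inv c) (at (chart_map c p)) v = v"
proof -
  have "((chart_map c \<circ> chart_inv c) has_derivative (\<lambda>v. v)) (at (chart_map c p))"
    by (rule has_derivative_transform_within_open[OF has_derivative_ident open_img[OF assms(1)]])
      (use assms chart_inv_map in auto)
  then show ?thesis using frechet_derivative_at by metis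
qed

lemma tangent_coord_coord_field':
  assumes "c \<in> A" "p \<in> chart_dom c" "d \<in> A" "p \<in> chart_dom d"
  shows "tangent_coord A d p (coord_field A c v p)
    = frechet_derivative (chart_map d \<circ> chart_inv c) (at (chart_map c p)) v"
  unfolding tangent_coord_def deriv_at_def coord_field_def
  using chart_change(2)[OF assms(1,2) chart_at transition_differentiable[OF chart_at assms(3,4)]]
  by simp

lemma tangent_coord_coord_field:
  assumes "c \<in> A" "p \<in> chart_dom c"
  shows "tangent_coord A c p (coord_field A c v p) = v"
  by (simp add: tangent_coord_coord_field'[OF assms assms] transition_self assms)

lemma coord_field_tangent_coord:
  assumes "c \<in> A" "p \<in> chart_dom c"
  shows "coord_field A c (tangent_coord A c p X) p = X"
  unfolding tangent_coord_def deriv_at_def coord_field_def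
  using chart_change(2)[OF chart_at assms transition_differentiable[OF assms chart_at], symmetric]
  by (simp add: transition_self chart_at)

lemma linear_coord_field:
  assumes "c \<in> A" "p \<in> chart_dom c" shows "linear (\<lambda>v. coord_field A c v p)"
  unfolding coord_field_def
  using linear_frechet_derivative[OF transition_differentiable[OF assms chart_at]] .

lemma linear_tangent_coord:
  assumes "c \<in> A" "p \<in> chart_dom c" shows "linear (tangent_coord A c p)"
proof -
  have "tangent_coord A c p = frechet_derivative (chart_map c \<circ> chart_inv (chart_at A p)) (at (chart_map (chart_at A p) p))"
    by (auto simp: fun_eq_iff tangent_coord_def deriv_at_def)
  then show ?thesis using linear_frechet_derivative[OF transition_differentiable[OF chart_at assms]]
    by simp
qed

lemma tangent_coord_change:
  assumes "c \<in> A" "p \<in> chart_dom c" "d \<in> A" "p \<in> chart_dom d"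
  shows "tangent_coord A d p X =
    frechet_derivative (chart_map d \<circ> chart_inv c) (at (chart_map c p)) (tangent_coord A c p X)"
  using tangent_coord_coord_field'[OF assms, of "tangent_coord A c p X"]
  by (simp add: coord_field_tangent_coord assms)

text \<open>The chart chosen by \<open>chart_at\<close> can be replaced by any chart around the point.\<close>

lemma deriv_at_chart:
  assumes "c \<in> A" "p \<in> chart_dom c" and "(f \<circ> chart_inv c) differentiable at (chart_map c p)"
  shows "deriv_at A f p X
    = frechet_derivative (f \<circ> chart_inv c) (at (chart_map c p)) (tangent_coord A c p X)"
  unfolding deriv_at_def tangent_coord_def
  using chart_change(2)[OF chart_at assms] by simp

lemma smooth_fun_onD:
  "smooth_fun_on A W f \<Longrightarrow> c \<in> A \<Longrightarrow> smooth_on (chart_map c ` (chart_dom c \<inter> W)) (f \<circ> chart_inv c)"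
  by (simp add: smooth_fun_on_def)

text \<open>Because the transition maps are smooth, one chart suffices for testing smoothness.\<close>

lemma smooth_fun_onI:
  assumes "c \<in> A" "open W" "W \<subseteq> chart_dom c" "smooth_on (chart_map c ` W) (f \<circ> chart_inv c)"
  shows "smooth_fun_on A W f"
  unfolding smooth_fun_on_def
proof
  fix d assume d: "d \<in> A"
  let ?S = "chart_map d ` (chart_dom d \<inter> W)"
  have S: "open ?S" using d assms by (intro open_chart_image open_Int open_dom) auto
  have "smooth_on ?S (\<lambda>x. (f \<circ> chart_inv c) ((chart_map c \<circ> chart_inv d) x))"
    by (rule smooth_on_compose[OF S open_chart_image[OF assms(1-3)] _ assms(4)
          smooth_on_subset[OF smooth_transition[OF d assms(1)]]])
      (use assms d in \<open>auto simp: chart_inv_map\<close>)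
  then show "smooth_on ?S (f \<circ> chart_inv d)"
    by (rule smooth_on_cong[OF S, rotated]) (use assms d in \<open>auto simp: chart_inv_map subsetD\<close>)
qed

abbreviation field_coord :: "('a, 'm) chart \<Rightarrow> ('a \<Rightarrow> real ^ 'm) \<Rightarrow> real ^ 'm \<Rightarrow> real ^ 'm" where
  "field_coord c Y \<equiv> (\<lambda>x. tangent_coord A c (chart_inv c x) (Y (chart_inv c x)))"

lemma smooth_field_onD:
  assumes "smooth_field_on A W Y" "c \<in> A"
  shows "smooth_on (chart_map c ` (chart_dom c \<inter> W)) (field_coord c Y)"
  using smooth_fun_onD[OF _ assms(2), of "chart_dom c \<inter> W" "\<lambda>p. tangent_coord A c p (Y p)"] assms
  by (simp add: smooth_field_on_def Int_absorb2 flip: Int_assoc) (simp add: comp_def)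

text \<open>Components with respect to two charts differ by the derivative of the transition map, which is
  smooth; so a single chart suffices again.\<close>

lemma smooth_field_onI:
  assumes "c \<in> A" "open W" "W \<subseteq> chart_dom c" "smooth_on (chart_map c ` W) (field_coord c Y)"
  shows "smooth_field_on A W Y"
  unfolding smooth_field_on_def
proof
  fix d assume d: "d \<in> A"
  let ?W = "chart_dom d \<inter> W"
  let ?S = "chart_map c ` ?W"
  have S: "open ?S" using d assms by (intro open_chart_image open_Int open_dom) auto
  have "smooth_on ?S (\<lambda>x. frechet_derivative (chart_map d \<circ> chart_inv c) (at x) (field_coord c Y x))"
    by (rule smooth_on_frechet_derivative_along[OF S S
        smooth_on_subset[OF smooth_transition[OF assms(1) d]]
        smooth_on_linear[OF S bounded_linear_ident] smooth_on_subset[OF assms(4)]])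
      (use assms in auto)
  then have "smooth_on ?S ((\<lambda>p. tangent_coord A d p (Y p)) \<circ> chart_inv c)"
  proof (rule smooth_on_cong[OF S, rotated])
    fix x assume "x \<in> ?S"
    then obtain p where p: "p \<in> chart_dom d" "p \<in> chart_dom c" "x = chart_map c p"
      using assms by auto
    then show "frechet_derivative (chart_map d \<circ> chart_inv c) (at x) (field_coord c Y x) =
      ((\<lambda>p. tangent_coord A d p (Y p)) \<circ> chart_inv c) x"
      using tangent_coord_change[OF assms(1) p(2) d p(1)] by (simp add: chart_inv_map assms(1))
  qed
  then show "smooth_fun_on A ?W (\<lambda>p. tangent_coord A d p (Y p))"
    by (intro smooth_fun_onI[OF assms(1)]) (use assms open_dom[OF d] in auto)
qed

lemma field_coord_coord_field:
  "c \<in> A \<Longrightarrow> x \<in> img c \<Longrightarrow> field_coord c (coord_field A c v) x = v"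
  by (simp add: tangent_coord_coord_field chart_inv_dom)

lemma smooth_coord_field:
  assumes "c \<in> A" shows "smooth_field_on A (chart_dom c) (coord_field A c v)"
proof (rule smooth_field_onI[OF assms open_dom[OF assms] order_refl])
  show "smooth_on (img c) (field_coord c (coord_field A c v))"
    by (rule smooth_on_cong[OF open_img[OF assms] _ smooth_on_const[OF open_img[OF assms], of v]])
      (rule field_coord_coord_field[OF assms, symmetric])
qed

lemma smooth_field_on_subset: "smooth_field_on A W Y \<Longrightarrow> V \<subseteq> W \<Longrightarrow> smooth_field_on A V Y"
  unfolding smooth_field_on_def smooth_fun_on_def
  by (intro ballI, drule bspec, assumption, drule bspec, assumption, erule smooth_on_subset) auto

end

locale two_manifolds = M: smooth_manifold A + N: smooth_manifold B
  for A :: "('a::{t2_space,second_countable_topology}, 'm::finite) chart set"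
    and B :: "('b::{t2_space,second_countable_topology}, 'n::finite) chart set"
begin

lemma differential_chart:
  assumes c: "c \<in> A" "p \<in> chart_dom c" and d: "d \<in> B"
    and W: "open W" "chart_map c p \<in> W" "W \<subseteq> M.img c" "\<And>x. x \<in> W \<Longrightarrow> f (chart_inv c x) \<in> chart_dom d"
    and diff: "(\<lambda>x. chart_map d (f (chart_inv c x))) differentiable at (chart_map c p)"
  shows "tangent_coord B d (f p) (differential A B f p X) =
     frechet_derivative (\<lambda>x. chart_map d (f (chart_inv c x))) (at (chart_map c p)) (tangent_coord A c p X)"
proof -
  let ?b = "chart_at B (f p)" and ?x = "chart_map c p"
  let ?F = "\<lambda>x. chart_map d (f (chart_inv c x))"
  have fp: "f p \<in> chart_dom d" using W(2,4) M.chart_inv_map[OF c] by force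
  have "(chart_map ?b \<circ> chart_inv d) differentiable at (?F ?x)"
    using N.transition_differentiable[OF d fp N.chart_at] by (simp add: M.chart_inv_map[OF c])
  from has_derivative_compose[OF iffD1[OF frechet_derivative_works diff] iffD1[OF frechet_derivative_works this]]
  have "((chart_map ?b \<circ> f \<circ> chart_inv c) has_derivative
     (\<lambda>v. frechet_derivative (chart_map ?b \<circ> chart_inv d) (at (?F ?x)) (frechet_derivative ?F (at ?x) v))) (at ?x)"
    by (rule has_derivative_transform_within_open[OF _ W(1,2)])
      (use W in \<open>auto simp: N.chart_inv_map[OF d]\<close>)
  then have "differential A B f p X = coord_field B d (frechet_derivative ?F (at ?x) (tangent_coord A c p X)) (f p)"
    unfolding differential_def coord_field_def
    using M.deriv_at_chart[OF c, of "chart_map ?b \<circ> f" X]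
    by (metis M.chart_inv_map[OF c] differentiableI frechet_derivative_at)
  then show ?thesis by (simp add: N.tangent_coord_coord_field[OF d fp])
qed

end

section \<open>Bilinear forms depending on a parameter\<close>

lemma bilinear_Basis_expansion:
  fixes B :: "'y::euclidean_space \<Rightarrow> 'z::euclidean_space \<Rightarrow> real"
  assumes "bilinear B"
  shows "B a b = (\<Sum>i\<in>Basis. \<Sum>j\<in>Basis. (a \<bullet> i) * (b \<bullet> j) * B i j)"
proof -
  have "B a b = (\<Sum>i\<in>Basis. (a \<bullet> i) * B i b)"
    using linear_Basis_expansion[of "\<lambda>a. B a b" a] assms by (simp add: bilinear_def)
  also have "\<dots> = (\<Sum>i\<in>Basis. (a \<bullet> i) * (\<Sum>j\<in>Basis. (b \<bullet> j) * B i j))"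
    using linear_Basis_expansion[of "B i" b for i] assms by (simp add: bilinear_def)
  finally show ?thesis by (simp add: sum_distrib_left mult.assoc)
qed

lemma smooth_on_bilinear_form:
  fixes B :: "'x::euclidean_space \<Rightarrow> 'y::euclidean_space \<Rightarrow> 'z::euclidean_space \<Rightarrow> real"
  assumes S: "open S" and B: "\<And>x. x \<in> S \<Longrightarrow> bilinear (B x)" "\<And>a b. smooth_on S (\<lambda>x. B x a b)"
    and ab: "smooth_on S a" "smooth_on S b"
  shows "smooth_on S (\<lambda>x. B x (a x) (b x))"
proof (rule smooth_on_cong[OF S])
  show "smooth_on S (\<lambda>x. \<Sum>i\<in>Basis. \<Sum>j\<in>Basis. (a x \<bullet> i) * (b x \<bullet> j) * B x i j)"
    by (intro smooth_on_sum smooth_on_mult S B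
        smooth_on_compose_linear[OF S bounded_linear_inner_left ab(1)]
        smooth_on_compose_linear[OF S bounded_linear_inner_left ab(2)])
qed (rule bilinear_Basis_expansion[OF B(1), symmetric])

text \<open>Three contributions: the form is differentiated with frozen arguments, then each argument with the
  form frozen.\<close>

lemma bilinear_form_has_derivative:
  fixes B :: "'x::euclidean_space \<Rightarrow> 'y::euclidean_space \<Rightarrow> 'z::euclidean_space \<Rightarrow> real"
  assumes S: "open S" "x \<in> S"
    and B: "\<And>x. x \<in> S \<Longrightarrow> bilinear (B x)" "\<And>a b. (\<lambda>x. B x a b) differentiable at x"
    and a: "(a has_derivative a') (at x)" and b: "(b has_derivative b') (at x)"
  shows "((\<lambda>x. B x (a x) (b x)) has_derivative
    (\<lambda>z. frechet_derivative (\<lambda>y. B y (a x) (b x)) (at x) z + (B x (a' z) (b x) + B x (a x) (b' z)))) (at x)"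
proof -
  let ?D = "\<lambda>i j. frechet_derivative (\<lambda>y. B y i j) (at x)"
  have D: "((\<lambda>y. B y i j) has_derivative ?D i j) (at x)" for i j
    by (rule iffD1[OF frechet_derivative_works B(2)])
  have "((\<lambda>y. \<Sum>i\<in>Basis. \<Sum>j\<in>Basis. (a x \<bullet> i) * (b x \<bullet> j) * B y i j) has_derivative
    (\<lambda>z. \<Sum>i\<in>Basis. \<Sum>j\<in>Basis. (a x \<bullet> i) * (b x \<bullet> j) * ?D i j z)) (at x)"
    by (intro has_derivative_sum has_derivative_mult_right D)
  then have "((\<lambda>y. B y (a x) (b x)) has_derivative
    (\<lambda>z. \<Sum>i\<in>Basis. \<Sum>j\<in>Basis. (a x \<bullet> i) * (b x \<bullet> j) * ?D i j z)) (at x)"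
    by (rule has_derivative_transform_within_open[OF _ S])
      (rule bilinear_Basis_expansion[OF B(1), symmetric])
  then have froz: "frechet_derivative (\<lambda>y. B y (a x) (b x)) (at x)
     = (\<lambda>z. \<Sum>i\<in>Basis. \<Sum>j\<in>Basis. (a x \<bullet> i) * (b x \<bullet> j) * ?D i j z)"
    by (rule frechet_derivative_at[symmetric])
  have "((\<lambda>y. \<Sum>i\<in>Basis. \<Sum>j\<in>Basis. (a y \<bullet> i) * (b y \<bullet> j) * B y i j) has_derivative
    (\<lambda>z. \<Sum>i\<in>Basis. \<Sum>j\<in>Basis. (a x \<bullet> i) * (b x \<bullet> j) * ?D i j z +
       ((a x \<bullet> i) * (b' z \<bullet> j) + (a' z \<bullet> i) * (b x \<bullet> j)) * B x i j)) (at x)"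
    by (intro has_derivative_sum has_derivative_mult D has_derivative_inner_left a b)
  then have "((\<lambda>y. B y (a y) (b y)) has_derivative
    (\<lambda>z. \<Sum>i\<in>Basis. \<Sum>j\<in>Basis. (a x \<bullet> i) * (b x \<bullet> j) * ?D i j z +
       ((a x \<bullet> i) * (b' z \<bullet> j) + (a' z \<bullet> i) * (b x \<bullet> j)) * B x i j)) (at x)"
    by (rule has_derivative_transform_within_open[OF _ S])
      (rule bilinear_Basis_expansion[OF B(1), symmetric])
  moreover have "(\<lambda>z. \<Sum>i\<in>Basis. \<Sum>j\<in>Basis. (a x \<bullet> i) * (b x \<bullet> j) * ?D i j z +
       ((a x \<bullet> i) * (b' z \<bullet> j) + (a' z \<bullet> i) * (b x \<bullet> j)) * B x i j)
    = (\<lambda>z. frechet_derivative (\<lambda>y. B y (a x) (b x)) (at x) z + (B x (a' z) (b x) + B x (a x) (b' z)))"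
    unfolding froz bilinear_Basis_expansion[OF B(1)[OF S(2)], of "a' _"]
      bilinear_Basis_expansion[OF B(1)[OF S(2)], of "a x" "b' _"]
    by (simp add: sum.distrib algebra_simps)
  ultimately show ?thesis by simp
qed

section \<open>Orthonormal bases\<close>

text \<open>An inner product on \<open>real ^ 'm\<close>: the metric at a point, in the coordinates of a chart.\<close>

locale inner_form =
  fixes G :: "real ^ 'm::finite \<Rightarrow> real ^ 'm \<Rightarrow> real"
  assumes bilinear: "bilinear G" and sym: "G x y = G y x" and pos: "x \<noteq> 0 \<Longrightarrow> G x x > 0"
begin

abbreviation orthonormal :: "('m \<Rightarrow> real ^ 'm) \<Rightarrow> bool" where
  "orthonormal e \<equiv> \<forall>i j. G (e i) (e j) = (if i = j then 1 else 0)"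

lemma linear_left: "linear (\<lambda>x. G x y)" and linear_right: "linear (G x)"
  using bilinear by (auto simp: bilinear_def)

lemma sum_left: "G (\<Sum>i\<in>I. f i) y = (\<Sum>i\<in>I. G (f i) y)"
  and scale_left: "G (r *\<^sub>R x) y = r * G x y"
  and add_left: "G (x + x') y = G x y + G x' y"
  and diff_left: "G (x - x') y = G x y - G x' y"
  and zero_left: "G 0 y = 0"
  using linear_sum[OF linear_left[of y]] linear_scale[OF linear_left[of y]]
    linear_add[OF linear_left[of y]] linear_diff[OF linear_left[of y]] linear_0[OF linear_left[of y]]
  by simp_all

lemma sum_right: "G y (\<Sum>i\<in>I. f i) = (\<Sum>i\<in>I. G y (f i))"
  and scale_right: "G y (r *\<^sub>R x) = r * G y x"
  and add_right: "G y (x + x') = G y x + G y x'"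
  and diff_right: "G y (x - x') = G y x - G y x'"
  and zero_right: "G y 0 = 0"
  using linear_sum[OF linear_right[of y]] linear_scale[OF linear_right[of y]]
    linear_add[OF linear_right[of y]] linear_diff[OF linear_right[of y]] linear_0[OF linear_right[of y]]
  by simp_all

text \<open>Orthonormality says that the matrix with rows \<open>G (e i) \<cdot>\<close> is a left inverse of the matrix
  with columns \<open>e i\<close>; being square, it is also a right inverse, which is the expansion.\<close>

lemma orthonormal_expansion:
  assumes "orthonormal e"
  shows "(\<Sum>i\<in>UNIV. G x (e i) *\<^sub>R e i) = x"
proof -
  let ?P = "(\<chi> i k. G (e i) (axis k 1)) :: real ^ 'm ^ 'm" and ?Q = "(\<chi> k i. e i $ k) :: real ^ 'm ^ 'm"
  have ax: "G y z = (\<Sum>k\<in>UNIV. G y (axis k 1) * z $ k)" for y z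
  proof -
    have "G y z = G y (\<Sum>k\<in>UNIV. z $ k *\<^sub>R axis k 1)"
      using basis_expansion[of z] by (simp add: scalar_mult_eq_scaleR)
    then show ?thesis by (simp only: sum_right scale_right mult.commute)
  qed
  have "?P ** ?Q = mat 1"
    using assms by (simp add: vec_eq_iff matrix_matrix_mult_def mat_def flip: ax)
  then have "?Q ** ?P = mat 1" using matrix_left_right_inverse by blast
  then have *: "(\<Sum>i\<in>UNIV. e i $ k * G (e i) (axis l 1)) = (if k = l then 1 else 0)" for k l
    by (auto simp: vec_eq_iff matrix_matrix_mult_def mat_def)
  have "(\<Sum>i\<in>UNIV. G x (e i) *\<^sub>R e i) $ k = x $ k" for k
  proof -
    have "(\<Sum>i\<in>UNIV. G x (e i) *\<^sub>R e i) $ k = (\<Sum>i\<in>UNIV. (\<Sum>l\<in>UNIV. G (e i) (axis l 1) * x $ l) * e i $ k)"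
      by (simp add: sym[of x] flip: ax)
    also have "\<dots> = (\<Sum>l\<in>UNIV. (\<Sum>i\<in>UNIV. e i $ k * G (e i) (axis l 1)) * x $ l)"
      by (subst (2) sum_distrib_right, subst sum_distrib_right, subst sum.swap) (simp add: mult_ac)
    also have "\<dots> = x $ k" by (simp add: * if_distrib if_distribR cong: if_cong)
    finally show ?thesis .
  qed
  then show ?thesis by (simp add: vec_eq_iff)
qed

lemma orthonormal_parseval:
  assumes "orthonormal e"
  shows "(\<Sum>i\<in>UNIV. G x (e i) * G y (e i)) = G x y"
proof -
  have "G x y = G x (\<Sum>i\<in>UNIV. G y (e i) *\<^sub>R e i)" by (simp add: orthonormal_expansion[OF assms])
  then show ?thesis by (simp add: sum_right scale_right mult.commute)
qed

text \<open>Expand \<open>e\<^sub>i\<close> in the basis \<open>f\<close>; by Parseval the coefficients satisfy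
  \<open>\<Sum>\<^sub>i G(e\<^sub>i, f\<^sub>j) G(e\<^sub>i, f\<^sub>k) = G(f\<^sub>j, f\<^sub>k)\<close>.\<close>

lemma orthonormal_trace:
  assumes e: "orthonormal e" and f: "orthonormal f" and b: "bilinear b"
  shows "(\<Sum>i\<in>UNIV. b (e i) (e i)) = (\<Sum>i\<in>UNIV. b (f i) (f i))"
proof -
  have lin: "linear (\<lambda>x. b x y)" "linear (b x)" for x y using b by (auto simp: bilinear_def)
  have "b (e i) (e i) = (\<Sum>j\<in>UNIV. \<Sum>k\<in>UNIV. (G (e i) (f j) * G (e i) (f k)) *\<^sub>R b (f j) (f k))" for i
  proof -
    have "b (e i) (e i) = b (\<Sum>j\<in>UNIV. G (e i) (f j) *\<^sub>R f j) (\<Sum>k\<in>UNIV. G (e i) (f k) *\<^sub>R f k)"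
      by (simp add: orthonormal_expansion[OF f])
    also have "\<dots> = (\<Sum>k\<in>UNIV. \<Sum>j\<in>UNIV. (G (e i) (f j) * G (e i) (f k)) *\<^sub>R b (f j) (f k))"
      by (simp add: mult.commute linear_sum[OF lin(1)] linear_sum[OF lin(2)] linear_scale[OF lin(1)]
          linear_scale[OF lin(2)] scaleR_sum_right)
    also have "\<dots> = (\<Sum>j\<in>UNIV. \<Sum>k\<in>UNIV. (G (e i) (f j) * G (e i) (f k)) *\<^sub>R b (f j) (f k))"
      by (rule sum.swap)
    finally show ?thesis .
  qed
  then have "(\<Sum>i\<in>UNIV. b (e i) (e i)) =
     (\<Sum>i\<in>UNIV. \<Sum>j\<in>UNIV. \<Sum>k\<in>UNIV. (G (e i) (f j) * G (e i) (f k)) *\<^sub>R b (f j) (f k))" by simp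
  also have "\<dots> = (\<Sum>j\<in>UNIV. \<Sum>i\<in>UNIV. \<Sum>k\<in>UNIV. (G (e i) (f j) * G (e i) (f k)) *\<^sub>R b (f j) (f k))"
    by (rule sum.swap)
  also have "\<dots> = (\<Sum>j\<in>UNIV. \<Sum>k\<in>UNIV. (\<Sum>i\<in>UNIV. G (e i) (f j) * G (e i) (f k)) *\<^sub>R b (f j) (f k))"
    unfolding scaleR_sum_left by (rule sum.cong[OF refl], rule sum.swap)
  also have "\<dots> = (\<Sum>j\<in>UNIV. \<Sum>k\<in>UNIV. (if j = k then 1 else 0) *\<^sub>R b (f j) (f k))"
    using orthonormal_parseval[OF e] f by (simp add: sym[of "e _"])
  also have "\<dots> = (\<Sum>j\<in>UNIV. b (f j) (f j))"
    by (simp add: if_distrib if_distribR cong: if_cong)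
  finally show ?thesis .
qed

lemma trace_orthonormal:
  fixes L :: "real ^ 'm \<Rightarrow> real ^ 'm"
  assumes e: "orthonormal e" and L: "linear L"
  shows "(\<Sum>k\<in>UNIV. L (axis k 1) $ k) = (\<Sum>i\<in>UNIV. G (L (e i)) (e i))"
proof -
  have "(\<Sum>k\<in>UNIV. L (axis k 1) $ k) = (\<Sum>k\<in>UNIV. L (\<Sum>i\<in>UNIV. G (axis k 1) (e i) *\<^sub>R e i) $ k)"
    by (simp add: orthonormal_expansion[OF e])
  also have "\<dots> = (\<Sum>k\<in>UNIV. \<Sum>i\<in>UNIV. G (axis k 1) (e i) * L (e i) $ k)"
    by (simp add: linear_sum[OF L] linear_scale[OF L])
  also have "\<dots> = (\<Sum>i\<in>UNIV. G (\<Sum>k\<in>UNIV. L (e i) $ k *\<^sub>R axis k 1) (e i))"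
    by (subst sum.swap) (simp add: sum_left scale_left mult.commute)
  also have "\<dots> = (\<Sum>i\<in>UNIV. G (L (e i)) (e i))"
    using basis_expansion[of "L (e _)"] by (simp add: scalar_mult_eq_scaleR)
  finally show ?thesis .
qed

end

section \<open>The derivative of a determinant\<close>

text \<open>In the Leibniz formula every permutation other than the identity moves at least two points, so
  the derivative of its product still contains an off-diagonal entry of the identity matrix.\<close>

lemma det_has_derivative_at_identity:
  fixes M :: "'x::real_normed_vector \<Rightarrow> real ^ 'm ^ 'm::finite"
  assumes D: "\<And>i j. ((\<lambda>x. M x $ i $ j) has_derivative D i j) (at x)" and 1: "M x = mat 1"
  shows "((\<lambda>x. det (M x)) has_derivative (\<lambda>z. \<Sum>i\<in>UNIV. D i i z)) (at x)"
proof -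
  let ?P = "{p. p permutes (UNIV :: 'm set)}"
  let ?t = "\<lambda>p z. of_int (sign p) * (\<Sum>i\<in>UNIV. D i (p i) z * (\<Prod>j\<in>UNIV - {i}. M x $ j $ p j))"
  have "((\<lambda>x. det (M x)) has_derivative (\<lambda>z. \<Sum>p\<in>?P. ?t p z)) (at x)"
    unfolding det_def
    by (intro has_derivative_sum has_derivative_mult_right has_derivative_prod D)
  moreover have "?t p z = 0" if p: "p \<in> ?P - {id}" for p z
  proof -
    have "D i (p i) z * (\<Prod>j\<in>UNIV - {i}. M x $ j $ p j) = 0" for i
    proof -
      \<comment> \<open>a permutation cannot move exactly one point\<close>
      have "\<exists>j. j \<noteq> i \<and> p j \<noteq> j"
      proof (rule ccontr)
        assume "\<nexists>j. j \<noteq> i \<and> p j \<noteq> j"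
        then have fix_others: "p j = j" if "j \<noteq> i" for j using that by blast
        have "inj p" using p permutes_inj by auto
        then have "p i = i" using fix_others[of "p i"] by (metis injD)
        then have "p = id" using fix_others by (metis eq_id_iff)
        then show False using p by simp
      qed
      then obtain j where "j \<noteq> i" "p j \<noteq> j" by blast
      then have "(\<Prod>j\<in>UNIV - {i}. M x $ j $ p j) = 0"
        by (intro prod_zero bexI[of _ j]) (auto simp: 1 mat_def)
      then show ?thesis by simp
    qed
    then have "(\<Sum>i\<in>UNIV. D i (p i) z * (\<Prod>j\<in>UNIV - {i}. M x $ j $ p j)) = 0"
      by (intro sum.neutral) blast
    then show ?thesis by simp
  qed
  then have "(\<Sum>p\<in>?P. ?t p z) = (\<Sum>p\<in>{id}. ?t p z)" for z
    by (intro sum.mono_neutral_right) (auto simp: permutes_id finite_permutations)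
  moreover have "(\<Sum>p\<in>{id}. ?t p z) = (\<Sum>i\<in>UNIV. D i i z)" for z
    by (simp add: 1 mat_def sign_id)
  ultimately show ?thesis by simp
qed

text \<open>With respect to a basis that is orthonormal at \<open>x\<close> the Gram matrix is the identity at \<open>x\<close>.
  Changing to this basis multiplies the determinant by a constant, which does not affect its
  logarithmic derivative.\<close>

lemma gram_det_has_derivative:
  fixes G :: "'x::euclidean_space \<Rightarrow> real ^ 'm \<Rightarrow> real ^ 'm::finite \<Rightarrow> real" and e :: "'m \<Rightarrow> real ^ 'm"
  assumes S: "open S" "x \<in> S" and G: "\<And>x. x \<in> S \<Longrightarrow> inner_form (G x)"
    "\<And>a b. (\<lambda>x. G x a b) differentiable at x"
    and e: "\<And>i j. G x (e i) (e j) = (if i = j then 1 else 0)"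
  shows "((\<lambda>x. det (\<chi> i j. G x (axis i 1) (axis j 1))) has_derivative
    (\<lambda>z. det (\<chi> i j. G x (axis i 1) (axis j 1)) * (\<Sum>i\<in>UNIV. frechet_derivative (\<lambda>x. G x (e i) (e i)) (at x) z))) (at x)"
    (is "((\<lambda>x. det (?g x)) has_derivative _) _")
    and "det (\<chi> i j. G x (axis i 1) (axis j 1)) > 0"
proof -
  let ?E = "(\<chi> i k. e i $ k) :: real ^ 'm ^ 'm"
  have prod: "?E ** ?g y ** transpose ?E = (\<chi> i j. G y (e i) (e j))" if y: "y \<in> S" for y
  proof -
    interpret inner_form "G y" using G y by blast
    have e: "e i = (\<Sum>k\<in>UNIV. e i $ k *\<^sub>R axis k 1)" for i
      using basis_expansion[of "e i"] by (simp add: scalar_mult_eq_scaleR)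
    have "G y (e i) (e j) = (\<Sum>l\<in>UNIV. (\<Sum>k\<in>UNIV. e i $ k * G y (axis k 1) (axis l 1)) * e j $ l)" for i j
      by (subst e[of i], subst e[of j])
         (simp add: sum_left sum_right scale_left scale_right mult_ac)
    then show ?thesis by (simp add: vec_eq_iff matrix_matrix_mult_def transpose_def)
  qed
  have detprod: "det (?g y) * (det ?E)\<^sup>2 = det (\<chi> i j. G y (e i) (e j))" if "y \<in> S" for y
    using arg_cong[OF prod[OF that], of det]
    by (simp add: det_mul det_transpose power2_eq_square mult_ac)
  have id: "(\<chi> i j. G x (e i) (e j)) = (mat 1 :: real ^ 'm ^ 'm)"
    by (simp add: e mat_def vec_eq_iff)
  have one: "det (?g x) * (det ?E)\<^sup>2 = 1" using detprod[OF S(2)] id by simp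
  then have E0: "det ?E \<noteq> 0" by auto
  then show "det (?g x) > 0" using one
    by (metis zero_less_mult_pos2 zero_less_one zero_less_power2)
  have "((\<lambda>y. det ((\<chi> i j. G y (e i) (e j)) :: real ^ 'm ^ 'm)) has_derivative
     (\<lambda>z. \<Sum>i\<in>UNIV. frechet_derivative (\<lambda>y. G y (e i) (e i)) (at x) z)) (at x)"
    by (rule det_has_derivative_at_identity[where M = "\<lambda>y. (\<chi> i j. G y (e i) (e j))"
          and D = "\<lambda>i j. frechet_derivative (\<lambda>y. G y (e i) (e j)) (at x)"])
      (simp_all only: vec_lambda_beta id, rule iffD1[OF frechet_derivative_works G(2)])
  then have "((\<lambda>y. inverse ((det ?E)\<^sup>2) * det ((\<chi> i j. G y (e i) (e j)) :: real ^ 'm ^ 'm)) has_derivative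
     (\<lambda>z. inverse ((det ?E)\<^sup>2) * (\<Sum>i\<in>UNIV. frechet_derivative (\<lambda>y. G y (e i) (e i)) (at x) z))) (at x)"
    by (rule has_derivative_mult_right)
  moreover have "inverse ((det ?E)\<^sup>2) = det (?g x)"
    using one E0 by (simp add: field_simps)
  ultimately have "((\<lambda>y. inverse ((det ?E)\<^sup>2) * det ((\<chi> i j. G y (e i) (e j)) :: real ^ 'm ^ 'm)) has_derivative
     (\<lambda>z. det (?g x) * (\<Sum>i\<in>UNIV. frechet_derivative (\<lambda>y. G y (e i) (e i)) (at x) z))) (at x)"
    by simp
  then show "((\<lambda>x. det (?g x)) has_derivative
    (\<lambda>z. det (?g x) * (\<Sum>i\<in>UNIV. frechet_derivative (\<lambda>x. G x (e i) (e i)) (at x) z))) (at x)"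
  proof (rule has_derivative_transform_within_open[OF _ S])
    fix y assume "y \<in> S"
    from detprod[OF this] E0
    show "inverse ((det ?E)\<^sup>2) * det ((\<chi> i j. G y (e i) (e j)) :: real ^ 'm ^ 'm) = det (?g y)"
      by (simp add: field_simps)
  qed
qed

section \<open>Local orthonormal frames\<close>

text \<open>The Gram-Schmidt process.  A vector \<open>w\<close> outside the span of the frame at \<open>x\<^sub>0\<close> has a nonzero
  component \<open>f\<close> orthogonal to the frame at all nearby points, where \<open>f\<close> can therefore be normalized
  smoothly.\<close>

lemma smooth_gram_schmidt:
  fixes G :: "'x::euclidean_space \<Rightarrow> real ^ 'm \<Rightarrow> real ^ 'm::finite \<Rightarrow> real"
  assumes S: "open S" "x\<^sub>0 \<in> S" and G: "\<And>x. x \<in> S \<Longrightarrow> inner_form (G x)" "\<And>a b. smooth_on S (\<lambda>x. G x a b)"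
  shows "\<exists>V e. open V \<and> x\<^sub>0 \<in> V \<and> V \<subseteq> S \<and> (\<forall>i\<in>I. smooth_on V (e i)) \<and>
    (\<forall>x\<in>V. \<forall>i\<in>I. \<forall>j\<in>I. G x (e i x) (e j x) = (if i = (j::'m) then 1 else 0))"
proof (induction I rule: finite_induct[OF finite])
  case 1
  show ?case using S by (intro exI[of _ S]) auto
next
  case (2 k I)
  then obtain V e where V: "open V" "x\<^sub>0 \<in> V" "V \<subseteq> S" and sm: "\<And>i. i \<in> I \<Longrightarrow> smooth_on V (e i)"
    and on: "\<And>x i j. x \<in> V \<Longrightarrow> i \<in> I \<Longrightarrow> j \<in> I \<Longrightarrow> G x (e i x) (e j x) = (if i = j then 1 else 0)"
    by blast
  have "card ((\<lambda>i. e i x\<^sub>0) ` I) \<le> card I" by (rule card_image_le) simp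
  also have "\<dots> < CARD('m)" using 2 by (metis UNIV_I finite psubset_card_mono top.not_eq_extremum)
  finally have "dim (span ((\<lambda>i. e i x\<^sub>0) ` I)) < CARD('m)"
    by (metis dim_span dim_le_card' finite finite_imageI le_less_trans)
  then have "span ((\<lambda>i. e i x\<^sub>0) ` I) \<noteq> UNIV" by (metis dim_UNIV less_irrefl DIM_cart DIM_real mult.right_neutral)
  then obtain w where w: "w \<notin> span ((\<lambda>i. e i x\<^sub>0) ` I)" by blast
  define f where "f x = w - (\<Sum>i\<in>I. G x w (e i x) *\<^sub>R e i x)" for x
  have form: "smooth_on V (\<lambda>x. G x (a x) (b x))" if "smooth_on V a" "smooth_on V b" for a b
    by (rule smooth_on_bilinear_form[OF V(1) _ _ that])
      (use G V inner_form.bilinear smooth_on_subset in blast)+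
  have f: "smooth_on V f" unfolding f_def
    by (intro smooth_on_diff smooth_on_const smooth_on_sum smooth_on_scaleR form sm V) auto
  have "f x\<^sub>0 \<noteq> 0"
  proof
    assume "f x\<^sub>0 = 0"
    then have "w = (\<Sum>i\<in>I. G x\<^sub>0 w (e i x\<^sub>0) *\<^sub>R e i x\<^sub>0)" by (simp add: f_def)
    also have "\<dots> \<in> span ((\<lambda>i. e i x\<^sub>0) ` I)"
      by (intro span_sum span_scale span_base) auto
    finally show False using w by simp
  qed
  define V' where "V' = V \<inter> f -` (- {0})"
  have V': "open V'" "x\<^sub>0 \<in> V'" "V' \<subseteq> S" "V' \<subseteq> V"
    using V \<open>f x\<^sub>0 \<noteq> 0\<close> continuous_open_preimage[OF smooth_on_imp_continuous_on[OF f] V(1), of "- {0}"]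
    by (auto simp: V'_def)
  define n where "n x = inverse (sqrt (G x (f x) (f x)))" for x
  have f_pos: "G x (f x) (f x) > 0" if "x \<in> V'" for x
    using that V'(3) inner_form.pos[OF G(1), of x "f x"] by (auto simp: V'_def)
  have n: "smooth_on V' (\<lambda>x. n x *\<^sub>R f x)"
    unfolding n_def
    by (intro smooth_on_scaleR smooth_on_rsqrt V' smooth_on_subset[OF form] smooth_on_subset[OF f] f f_pos)
  have perp: "G x (f x) (e j x) = 0" if x: "x \<in> V'" and j: "j \<in> I" for x j
  proof -
    interpret inner_form "G x" using G(1) x V'(3) by blast
    have "G x (f x) (e j x) = G x w (e j x) - (\<Sum>i\<in>I. G x w (e i x) * G x (e i x) (e j x))"
      by (simp add: f_def diff_left sum_left scale_left)
    also have "(\<Sum>i\<in>I. G x w (e i x) * G x (e i x) (e j x)) = (\<Sum>i\<in>I. if i = j then G x w (e j x) else 0)"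
      using x V' j by (intro sum.cong) (auto simp: on)
    also have "G x w (e j x) - \<dots> = 0" using j by simp
    finally show ?thesis .
  qed
  have unit: "G x (n x *\<^sub>R f x) (n x *\<^sub>R f x) = 1" if x: "x \<in> V'" for x
  proof -
    interpret inner_form "G x" using G(1) x V'(3) by blast
    show ?thesis using f_pos[OF x]
      by (simp add: n_def scale_left scale_right field_simps)
  qed
  define e' where "e' = e(k := \<lambda>x. n x *\<^sub>R f x)"
  show ?case
  proof (rule exI[of _ V'], rule exI[of _ e'], intro conjI V' ballI)
    show "smooth_on V' (e' i)" if "i \<in> insert k I" for i
      using that n sm smooth_on_subset[OF _ V'(4)] by (auto simp: e'_def)
    fix x i j assume x: "x \<in> V'" and ij: "i \<in> insert k I" "j \<in> insert k I"
    interpret inner_form "G x" using G(1) x V'(3) by blast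
    show "G x (e' i x) (e' j x) = (if i = j then 1 else 0)"
      using ij unit[OF x] perp[OF x] on[of x i j] x V' 2(2)
      by (auto simp: e'_def scale_left scale_right sym[of "e _ x" "f x"] split: if_splits)
  qed
qed

section \<open>The Levi-Civita connection in a chart\<close>

lemma axis_expansion: "(\<Sum>k\<in>UNIV. (x :: real ^ 'm::finite) $ k *\<^sub>R axis k 1) = x"
  using basis_expansion[of x] by (simp add: scalar_mult_eq_scaleR)

locale lc_manifold = smooth_manifold A
  for A :: "('a::{t2_space,second_countable_topology}, 'm::finite) chart set" +
  fixes g :: "('a, 'm) metric" and D :: "('a, 'm) connection"
  assumes metric: "riemannian_metric A g" and levi_civita: "levi_civita_connection A g D"
begin

definition coord_metric :: "('a, 'm) chart \<Rightarrow> real ^ 'm \<Rightarrow> real ^ 'm \<Rightarrow> real ^ 'm \<Rightarrow> real" where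
  "coord_metric c x v w =
     g (chart_inv c x) (coord_field A c v (chart_inv c x)) (coord_field A c w (chart_inv c x))"

text \<open>As a bilinear map, the Christoffel symbols of \<open>c\<close> at \<open>p\<close>: the components of the covariant
  derivative of the field with constant components \<open>w\<close> in the direction with components \<open>v\<close>.\<close>

definition christoffel :: "('a, 'm) chart \<Rightarrow> 'a \<Rightarrow> real ^ 'm \<Rightarrow> real ^ 'm \<Rightarrow> real ^ 'm" where
  "christoffel c p v w = tangent_coord A c p (D p (coord_field A c v p) (coord_field A c w))"

lemma inner_form_metric: "inner_form (g p)"
  using metric unfolding riemannian_metric_def inner_form_def by blast

lemma metric_chart:
  assumes "c \<in> A" "p \<in> chart_dom c"
  shows "g p X Y = coord_metric c (chart_map c p) (tangent_coord A c p X) (tangent_coord A c p Y)"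
  by (simp add: coord_metric_def chart_inv_map coord_field_tangent_coord assms)

lemma inner_form_coord_metric:
  assumes "c \<in> A" "x \<in> img c" shows "inner_form (coord_metric c x)"
proof -
  let ?p = "chart_inv c x"
  interpret inner_form "g ?p" by (rule inner_form_metric)
  have p: "?p \<in> chart_dom c" using chart_inv_dom assms by blast
  note lin = linear_coord_field[OF assms(1) p]
  have "bilinear (coord_metric c x)"
    unfolding bilinear_def coord_metric_def
    using linear_compose[OF lin linear_left] linear_compose[OF lin linear_right]
    by (simp add: comp_def)
  moreover have "coord_metric c x v v > 0" if "v \<noteq> 0" for v
    unfolding coord_metric_def
    using that tangent_coord_coord_field[OF assms(1) p, of v] linear_0[OF linear_tangent_coord[OF assms(1) p]]
    by (intro pos) metis
  ultimately show ?thesis by (simp add: inner_form_def coord_metric_def sym)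
qed

lemma smooth_coord_metric:
  assumes "c \<in> A" shows "smooth_on (img c) (\<lambda>x. coord_metric c x v w)"
  using metric assms smooth_fun_onD[of "chart_dom c" "\<lambda>p. g p (coord_field A c v p) (coord_field A c w p)" c]
  by (simp add: riemannian_metric_def comp_def coord_metric_def)

lemma
  assumes "open W" "p \<in> W" "smooth_field_on A W Y"
  shows linear_connection: "linear (\<lambda>X. D p X Y)"
    and connection_local: "(\<And>q. q \<in> W \<Longrightarrow> Y q = Z q) \<Longrightarrow> D p X Y = D p X Z"
    and connection_add: "smooth_field_on A W Z \<Longrightarrow> D p X (\<lambda>q. Y q + Z q) = D p X Y + D p X Z"
    and connection_scale: "smooth_fun_on A W f \<Longrightarrow>
      D p X (\<lambda>q. f q *\<^sub>R Y q) = deriv_at A f p X *\<^sub>R Y p + f p *\<^sub>R D p X Y"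
    and connection_torsion_free: "smooth_field_on A W Z \<Longrightarrow> D p (Y p) Z - D p (Z p) Y = lie_bracket A Y Z p"
    and connection_metric: "smooth_field_on A W Z \<Longrightarrow>
      deriv_at A (\<lambda>q. g q (Y q) (Z q)) p X = g p (D p X Y) (Z p) + g p (Y p) (D p X Z)"
proof -
  note L = levi_civita[unfolded levi_civita_connection_def affine_connection_def]
  note L1 = conjunct1[OF L, THEN spec[of _ W], THEN mp[OF _ assms(1)]]
  note L2 = conjunct2[OF L, THEN spec[of _ W], THEN mp[OF _ assms(1)]]
  show "linear (\<lambda>X. D p X Y)" using L1 assms(2,3) by blast
  show "D p X Y = D p X Z" if "\<And>q. q \<in> W \<Longrightarrow> Y q = Z q" using L1 assms(2,3) that by blast
  show "D p X (\<lambda>q. Y q + Z q) = D p X Y + D p X Z" if "smooth_field_on A W Z"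
    using L1 assms(2,3) that by blast
  show "D p X (\<lambda>q. f q *\<^sub>R Y q) = deriv_at A f p X *\<^sub>R Y p + f p *\<^sub>R D p X Y" if "smooth_fun_on A W f"
    using L1 assms(2,3) that by blast
  show "D p (Y p) Z - D p (Z p) Y = lie_bracket A Y Z p" if "smooth_field_on A W Z"
    using L2 assms(2,3) that by blast
  show "deriv_at A (\<lambda>q. g q (Y q) (Z q)) p X = g p (D p X Y) (Z p) + g p (Y p) (D p X Z)"
    if "smooth_field_on A W Z"
    using L2 assms(2,3) that by blast
qed

lemma deriv_at_const: "deriv_at A (\<lambda>q. k) p X = 0"
  by (simp add: deriv_at_def comp_def)

lemma smooth_fun_on_const:
  "c \<in> A \<Longrightarrow> open W \<Longrightarrow> W \<subseteq> chart_dom c \<Longrightarrow> smooth_fun_on A W (\<lambda>q. k)"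
  by (rule smooth_fun_onI) (auto simp: comp_def intro!: smooth_on_const open_chart_image)

context
  fixes c p assumes c: "c \<in> A" and p: "p \<in> chart_dom c"
begin

lemma connection_coord_sum:
  assumes W: "open W" "p \<in> W" "W \<subseteq> chart_dom c" and f: "\<And>k. smooth_fun_on A W (f k)"
  shows "D p X (\<lambda>q. \<Sum>k\<in>I. f k q *\<^sub>R coord_field A c (v k) q) =
    (\<Sum>k\<in>I. deriv_at A (f k) p X *\<^sub>R coord_field A c (v k) p + f k p *\<^sub>R D p X (coord_field A c (v k)))"
proof -
  have S: "open (chart_map c ` W)" by (rule open_chart_image[OF c W(1,3)])
  have sm: "smooth_field_on A W (\<lambda>q. \<Sum>k\<in>I. f k q *\<^sub>R coord_field A c (v k) q)" for I
  proof (rule smooth_field_onI[OF c W(1,3)], rule smooth_on_cong[OF S])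
    show "smooth_on (chart_map c ` W) (\<lambda>x. \<Sum>k\<in>I. (f k \<circ> chart_inv c) x *\<^sub>R v k)"
      using smooth_fun_onD[OF f c] W(3)
      by (intro smooth_on_sum smooth_on_scaleR smooth_on_const S) (simp add: Int_absorb1 del: o_apply)
    fix x assume "x \<in> chart_map c ` W"
    then have x: "chart_inv c x \<in> chart_dom c" using W(3) c chart_inv_map by auto
    show "(\<Sum>k\<in>I. (f k \<circ> chart_inv c) x *\<^sub>R v k) =
      field_coord c (\<lambda>q. \<Sum>k\<in>I. f k q *\<^sub>R coord_field A c (v k) q) x"
      by (simp add: tangent_coord_coord_field[OF c x] linear_sum[OF linear_tangent_coord[OF c x]]
          linear_scale[OF linear_tangent_coord[OF c x]])
  qed
  have sm1: "smooth_field_on A W (coord_field A c w)" for w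
    using smooth_field_on_subset[OF smooth_coord_field[OF c] W(3)] .
  have sm2: "smooth_field_on A W (\<lambda>q. f k q *\<^sub>R coord_field A c (v k) q)" for k
    using sm[of "{k}"] by simp
  show ?thesis
  proof (induction I rule: infinite_finite_induct)
    case (insert k I)
    then show ?case
      using connection_add[OF W(1,2) sm2[of k] sm[of I]] connection_scale[OF W(1,2) sm1 f]
      by simp
  next
    case empty
    then show ?case
      using connection_scale[OF W(1,2) sm1[of 0] smooth_fun_on_const[OF c W(1,3), of 0]]
      by (simp add: deriv_at_const)
  next
    case (infinite I)
    then show ?case
      using connection_scale[OF W(1,2) sm1[of 0] smooth_fun_on_const[OF c W(1,3), of 0]]
      by (simp add: deriv_at_const)
  qed
qed

text \<open>Near \<open>p\<close> the field is \<open>\<Sum>\<^sub>k Y\<^sup>k \<partial>\<^sub>k\<close>; the connection is local and satisfies the Leibniz rule.  This is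
  stated with the Christoffel symbols expanded in the second argument, because their linearity in that
  argument is a consequence.\<close>

lemma connection_chart_components:
  assumes W: "open W" "p \<in> W" "smooth_field_on A W Y"
  shows "tangent_coord A c p (D p X Y) =
    frechet_derivative (field_coord c Y) (at (chart_map c p)) (tangent_coord A c p X) +
    (\<Sum>k\<in>UNIV. tangent_coord A c p (Y p) $ k *\<^sub>R christoffel c p (tangent_coord A c p X) (axis k 1))"
proof -
  define V where "V = W \<inter> chart_dom c"
  have V: "open V" "p \<in> V" "V \<subseteq> chart_dom c" using W p open_dom[OF c] by (auto simp: V_def)
  have S: "open (chart_map c ` V)" "chart_map c p \<in> chart_map c ` V"
    using open_chart_image[OF c V(1,3)] V by auto
  have Ysm: "smooth_on (chart_map c ` V) (field_coord c Y)"
    using smooth_field_onD[OF W(3) c] by (simp add: V_def Int_commute)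
  define f where "f k q = tangent_coord A c q (Y q) $ k" for k q
  have f: "smooth_fun_on A V (f k)" for k
    unfolding f_def using smooth_on_vec_nth[OF S(1) Ysm]
    by (intro smooth_fun_onI[OF c V(1,3)]) (simp add: comp_def)
  have Y: "Y q = (\<Sum>k\<in>UNIV. f k q *\<^sub>R coord_field A c (axis k 1) q)" if "q \<in> V" for q
  proof -
    have q: "q \<in> chart_dom c" using that V by auto
    have "(\<Sum>k\<in>UNIV. f k q *\<^sub>R coord_field A c (axis k 1) q)
       = coord_field A c (\<Sum>k\<in>UNIV. f k q *\<^sub>R axis k 1) q"
      by (simp add: linear_sum[OF linear_coord_field[OF c q]] linear_scale[OF linear_coord_field[OF c q]])
    also have "(\<Sum>k\<in>UNIV. f k q *\<^sub>R axis k 1) = tangent_coord A c q (Y q)"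
      by (simp add: f_def axis_expansion)
    finally show ?thesis by (simp add: coord_field_tangent_coord[OF c q])
  qed
  have DY: "D p X Y = (\<Sum>k\<in>UNIV. deriv_at A (f k) p X *\<^sub>R coord_field A c (axis k 1) p
      + f k p *\<^sub>R D p X (coord_field A c (axis k 1)))"
    using connection_local[OF V(1,2) smooth_field_on_subset[OF W(3)] Y] connection_coord_sum[OF V f]
    by (simp add: V_def)
  have d: "deriv_at A (f k) p X =
    frechet_derivative (field_coord c Y) (at (chart_map c p)) (tangent_coord A c p X) $ k" for k
  proof -
    have "((f k \<circ> chart_inv c) has_derivative
       (\<lambda>z. frechet_derivative (field_coord c Y) (at (chart_map c p)) z $ k)) (at (chart_map c p))"
      using bounded_linear.has_derivative[OF bounded_linear_vec_nth smooth_on_has_derivative[OF Ysm S(2)], of k]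
      by (simp add: comp_def f_def)
    note E = this frechet_derivative_at[OF this, symmetric]
    show ?thesis by (subst deriv_at_chart[OF c p differentiableI[OF E(1)]]) (simp only: E(2))
  qed
  have lin: "linear (tangent_coord A c p)" by (rule linear_tangent_coord[OF c p])
  have "tangent_coord A c p (D p X Y) = (\<Sum>k\<in>UNIV. deriv_at A (f k) p X *\<^sub>R axis k 1)
    + (\<Sum>k\<in>UNIV. f k p *\<^sub>R christoffel c p (tangent_coord A c p X) (axis k 1))"
    unfolding DY
    by (simp add: linear_sum[OF lin] linear_scale[OF lin] linear_add[OF lin] sum.distrib
        tangent_coord_coord_field[OF c p] christoffel_def coord_field_tangent_coord[OF c p])
  then show ?thesis
    by (simp add: d f_def axis_expansion)
qed

text \<open>A field with constant components has no derivative term.\<close>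

lemma christoffel_expansion: "christoffel c p v w = (\<Sum>k\<in>UNIV. w $ k *\<^sub>R christoffel c p v (axis k 1))"
proof -
  have x: "chart_map c p \<in> img c" using p by simp
  have "((\<lambda>_. w) has_derivative (\<lambda>_. 0)) (at (chart_map c p))" by simp
  then have "(field_coord c (coord_field A c w) has_derivative (\<lambda>_. 0)) (at (chart_map c p))"
    by (rule has_derivative_transform_within_open[OF _ open_img[OF c] x])
      (simp only: field_coord_coord_field[OF c])
  then have "frechet_derivative (field_coord c (coord_field A c w)) (at (chart_map c p)) = (\<lambda>_. 0)"
    by (rule frechet_derivative_at[symmetric])
  then show ?thesis
    using connection_chart_components[OF open_dom[OF c] p smooth_coord_field[OF c], of "coord_field A c v p" w]
    by (simp add: tangent_coord_coord_field[OF c p] christoffel_def)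
qed

lemma bilinear_christoffel: "bilinear (christoffel c p)"
proof -
  have 1: "linear (\<lambda>v. christoffel c p v w)" for w
    using linear_compose[OF linear_compose[OF linear_coord_field[OF c p]
        linear_connection[OF open_dom[OF c] p smooth_coord_field[OF c]]] linear_tangent_coord[OF c p], of w]
    by (simp add: comp_def christoffel_def)
  have 2: "linear (christoffel c p v)" for v
  proof (rule linearI)
    fix a b :: "real ^ 'm" and r :: real
    show "christoffel c p v (a + b) = christoffel c p v a + christoffel c p v b"
      by (subst (1 2 3) christoffel_expansion) (simp add: scaleR_left_distrib sum.distrib)
    show "christoffel c p v (r *\<^sub>R a) = r *\<^sub>R christoffel c p v a"
      by (subst (1 2) christoffel_expansion) (simp add: scaleR_sum_right)
  qed
  show ?thesis using 1 2 by (simp add: bilinear_def)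
qed

lemma connection_chart:
  assumes "open W" "p \<in> W" "smooth_field_on A W Y"
  shows "tangent_coord A c p (D p X Y) =
    frechet_derivative (field_coord c Y) (at (chart_map c p)) (tangent_coord A c p X) +
    christoffel c p (tangent_coord A c p X) (tangent_coord A c p (Y p))"
  using connection_chart_components[OF assms]
  by (subst christoffel_expansion)

text \<open>Coordinate fields commute because second derivatives do.\<close>

lemma christoffel_symmetric: "christoffel c p v w = christoffel c p w v"
proof -
  let ?d = "chart_at A p" and ?x = "chart_map c p"
  let ?T = "chart_map ?d \<circ> chart_inv c" and ?S = "chart_map c ` (chart_dom c \<inter> chart_dom ?d)"
  have S: "open ?S" "?x \<in> ?S" using open_overlap[OF c chart_at(1)] p chart_at by auto
  have sm: "smooth_on ?S ?T" by (rule smooth_transition[OF c chart_at(1)])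
  have *: "deriv_at A (\<lambda>q. tangent_coord A ?d q (coord_field A c b q)) p (coord_field A c a p) =
    frechet_derivative (\<lambda>x. frechet_derivative ?T (at x) b) (at ?x) a" for a b
  proof -
    have D: "((\<lambda>x. frechet_derivative ?T (at x) b) has_derivative
        frechet_derivative (\<lambda>x. frechet_derivative ?T (at x) b) (at ?x)) (at ?x)"
      by (rule smooth_on_has_derivative[OF smooth_on_frechet_derivative[OF sm] S(2)])
    have "((\<lambda>q. tangent_coord A ?d q (coord_field A c b q)) \<circ> chart_inv c has_derivative
        frechet_derivative (\<lambda>x. frechet_derivative ?T (at x) b) (at ?x)) (at ?x)"
    proof (rule has_derivative_transform_within_open[OF D S])
      fix x assume "x \<in> ?S"
      then obtain q where q: "q \<in> chart_dom c" "q \<in> chart_dom ?d" "x = chart_map c q" by auto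
      then show "frechet_derivative ?T (at x) b =
        ((\<lambda>q. tangent_coord A ?d q (coord_field A c b q)) \<circ> chart_inv c) x"
        using tangent_coord_coord_field'[OF c q(1) chart_at(1) q(2), of b] chart_inv_map[OF c] by simp
    qed
    note E = this frechet_derivative_at[OF this, symmetric]
    show ?thesis
      by (subst deriv_at_chart[OF c p differentiableI[OF E(1)]])
        (simp only: E(2) tangent_coord_coord_field[OF c p])
  qed
  have "lie_bracket A (coord_field A c v) (coord_field A c w) p = 0"
    unfolding lie_bracket_def Let_def * using second_derivative_symmetric[OF S(1) sm S(2)] by simp
  then have "D p (coord_field A c v p) (coord_field A c w) = D p (coord_field A c w p) (coord_field A c v)"
    using connection_torsion_free[OF open_dom[OF c] p smooth_coord_field[OF c, of v] smooth_coord_field[OF c, of w]]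
    by simp
  then show ?thesis by (simp add: christoffel_def)
qed

lemma coord_metric_derivative:
  "frechet_derivative (\<lambda>x. coord_metric c x v w) (at (chart_map c p)) z =
    coord_metric c (chart_map c p) (christoffel c p z v) w +
    coord_metric c (chart_map c p) v (christoffel c p z w)"
proof -
  have eq: "(\<lambda>q. g q (coord_field A c v q) (coord_field A c w q)) \<circ> chart_inv c = (\<lambda>x. coord_metric c x v w)"
    by (auto simp: coord_metric_def)
  have "(\<lambda>x. coord_metric c x v w) differentiable at (chart_map c p)"
    using p by (intro smooth_on_differentiable[OF smooth_coord_metric[OF c]]) simp
  then have "deriv_at A (\<lambda>q. g q (coord_field A c v q) (coord_field A c w q)) p (coord_field A c z p) =
    frechet_derivative (\<lambda>x. coord_metric c x v w) (at (chart_map c p)) z"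
    using deriv_at_chart[OF c p, of "\<lambda>q. g q (coord_field A c v q) (coord_field A c w q)"]
    by (simp add: eq tangent_coord_coord_field[OF c p])
  then show ?thesis
    using connection_metric[OF open_dom[OF c] p smooth_coord_field[OF c] smooth_coord_field[OF c], of v w "coord_field A c z p"]
    by (simp add: metric_chart[OF c p] tangent_coord_coord_field[OF c p] christoffel_def)
qed

end

text \<open>Along a map \<open>y\<close> into the chart, \<open>a' z + \<Gamma> (y' z) (a x)\<close> is the covariant derivative of the vector
  field \<open>a\<close> along \<open>y\<close>, that is, the induced connection.  Its metric compatibility combines the product
  rule for bilinear forms with that of the Levi-Civita connection.\<close>

lemma coord_metric_along_has_derivative:
  fixes y a b :: "'x::euclidean_space \<Rightarrow> real ^ 'm"
  assumes c: "c \<in> A" and S: "open S" "x \<in> S" "\<And>x. x \<in> S \<Longrightarrow> y x \<in> img c"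
    and y: "(y has_derivative y') (at x)" and a: "(a has_derivative a') (at x)" and b: "(b has_derivative b') (at x)"
  defines "\<Gamma> \<equiv> christoffel c (chart_inv c (y x))"
  shows "((\<lambda>x. coord_metric c (y x) (a x) (b x)) has_derivative
     (\<lambda>z. coord_metric c (y x) (a' z + \<Gamma> (y' z) (a x)) (b x) +
          coord_metric c (y x) (a x) (b' z + \<Gamma> (y' z) (b x)))) (at x)"
proof -
  interpret inner_form "coord_metric c (y x)" by (rule inner_form_coord_metric[OF c S(3)[OF S(2)]])
  note yx = S(3)[OF S(2)]
  have D: "((\<lambda>x. coord_metric c (y x) v w) has_derivative
     (\<lambda>z. frechet_derivative (\<lambda>x. coord_metric c x v w) (at (y x)) (y' z))) (at x)" for v w
    by (rule has_derivative_compose[OF y smooth_on_has_derivative[OF smooth_coord_metric[OF c] yx]])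
  have frozen: "frechet_derivative (\<lambda>x. coord_metric c (y x) v w) (at x) z =
     coord_metric c (y x) (\<Gamma> (y' z) v) w + coord_metric c (y x) v (\<Gamma> (y' z) w)" for v w z
    unfolding frechet_derivative_at[OF D, symmetric]
    using coord_metric_derivative[OF c chart_inv_dom[OF c yx], of v w]
    by (simp add: chart_map_inv[OF c yx] \<Gamma>_def)
  have "((\<lambda>x. coord_metric c (y x) (a x) (b x)) has_derivative
    (\<lambda>z. frechet_derivative (\<lambda>x'. coord_metric c (y x') (a x) (b x)) (at x) z +
      (coord_metric c (y x) (a' z) (b x) + coord_metric c (y x) (a x) (b' z)))) (at x)"
    by (rule bilinear_form_has_derivative[OF S(1,2) _ differentiableI[OF D] a b])
      (rule inner_form.bilinear[OF inner_form_coord_metric[OF c S(3)]])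
  then show ?thesis
    by (rule has_derivative_eq_rhs) (simp add: frozen add_left add_right add_ac fun_eq_iff)
qed

lemma local_orthonormal_frame_exists:
  "\<exists>e W. p \<in> W \<and> local_orthonormal_frame A g W e"
proof -
  let ?c = "chart_at A p"
  note c = chart_at(1)[of p] and p = chart_at(2)[of p]
  obtain V and f :: "'m \<Rightarrow> _" where V: "open V" "chart_map ?c p \<in> V" "V \<subseteq> img ?c" and f: "\<And>i. smooth_on V (f i)"
    and on: "\<And>x i j. x \<in> V \<Longrightarrow> coord_metric ?c x (f i x) (f j x) = (if i = j then 1 else 0)"
  proof -
    have "\<exists>V (f :: 'm \<Rightarrow> _). open V \<and> chart_map ?c p \<in> V \<and> V \<subseteq> img ?c \<and> (\<forall>i\<in>UNIV. smooth_on V (f i)) \<and>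
      (\<forall>x\<in>V. \<forall>i\<in>UNIV. \<forall>j\<in>UNIV. coord_metric ?c x (f i x) (f j x) = (if i = j then 1 else 0))"
      using p
      by (intro smooth_gram_schmidt open_img[OF c] inner_form_coord_metric[OF c] smooth_coord_metric[OF c])
         simp_all
    then obtain V and f :: "'m \<Rightarrow> _" where "open V" "chart_map ?c p \<in> V" "V \<subseteq> img ?c"
      "\<forall>i\<in>UNIV. smooth_on V (f i)"
      "\<forall>x\<in>V. \<forall>i\<in>UNIV. \<forall>j\<in>UNIV. coord_metric ?c x (f i x) (f j x) = (if i = j then 1 else 0)"
      by (elim exE conjE)
    then show ?thesis by (intro that[of V f]) simp_all
  qed
  define W where "W = chart_inv ?c ` V"
  define e where "e i q = coord_field A ?c (f i (chart_map ?c q)) q" for i q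
  have W: "open W" "W \<subseteq> chart_dom ?c" "chart_map ?c ` W = V"
    unfolding W_def by (fact open_chart_inv_image[OF c V(1,3)] chart_inv_image_subset[OF c V(3)]
      chart_image_inv_image[OF c V(3)])+
  have pW: "p \<in> W" unfolding W_def using imageI[OF V(2), of "chart_inv ?c"] by (simp only: chart_inv_map[OF c p])
  have "smooth_field_on A W (e i)" for i
  proof (rule smooth_field_onI[OF c W(1,2)], rule smooth_on_cong)
    show "smooth_on (chart_map ?c ` W) (f i)" using f W by simp
    show "open (chart_map ?c ` W)" using W V by simp
    fix x assume "x \<in> chart_map ?c ` W"
    then have "x \<in> img ?c" using W V by auto
    then show "f i x = field_coord ?c (e i) x"
      by (simp add: e_def tangent_coord_coord_field[OF c] chart_inv_dom[OF c] chart_map_inv[OF c])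
  qed
  moreover have "orthonormal_basis_at g q (\<lambda>i. e i q)" if "q \<in> W" for q
  proof -
    have "q \<in> chart_dom ?c" "chart_map ?c q \<in> V" using that W by auto
    then show ?thesis using on[of "chart_map ?c q"]
      by (simp add: orthonormal_basis_at_def metric_chart[OF c] e_def tangent_coord_coord_field[OF c])
  qed
  ultimately show ?thesis using W pW by (auto simp: local_orthonormal_frame_def)
qed

lemma orthonormal_basis_exists: "\<exists>e. orthonormal_basis_at g p e"
  using local_orthonormal_frame_exists[of p] unfolding local_orthonormal_frame_def by blast

end

section \<open>Variations in local coordinates\<close>

locale energy_variation = M: lc_manifold A g DM + N: lc_manifold B h DN
  for A :: "('a::{t2_space,second_countable_topology}, 'm::finite) chart set"
    and g :: "('a, 'm) metric" and DM :: "('a, 'm) connection"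
    and B :: "('b::{t2_space,second_countable_topology}, 'n::finite) chart set"
    and h :: "('b, 'n) metric" and DN :: "('b, 'n) connection" +
  fixes u :: "'a \<Rightarrow> 'b" and \<delta> :: real and U :: "real \<Rightarrow> 'a \<Rightarrow> 'b"
  assumes \<delta>: "\<delta> > 0" and variation: "smooth_variation A B u \<delta> U"
begin

sublocale two_manifolds A B ..

lemma U_0: "U 0 = u"
  using variation by (simp add: smooth_variation_def)

text \<open>The vector field dual to the 1-form \<open>Y \<mapsto> h(v, d\<^sub>(\<^sub>3\<^sub>)u(Y))\<close>; the first variation formula
  integrates its divergence.\<close>

definition flux :: "'a \<Rightarrow> real ^ 'm" where
  "flux q = (let e = (SOME e. orthonormal_basis_at g q e)
     in \<Sum>i\<in>UNIV. h (u q) (variation_field B U q) (d3 A g B h u q (e i)) *\<^sub>R e i)"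

end

text \<open>Near a given point of \<open>M\<close> all maps \<open>u\<^sub>t\<close> with small \<open>t\<close> are described by one and the same pair of
  charts, and traces can be computed in a smooth orthonormal frame.\<close>

locale variation_chart = energy_variation A g DM B h DN u \<delta> U
  for A :: "('a::{t2_space,second_countable_topology}, 'm::finite) chart set"
    and g :: "('a, 'm) metric" and DM :: "('a, 'm) connection"
    and B :: "('b::{t2_space,second_countable_topology}, 'n::finite) chart set"
    and h :: "('b, 'n) metric" and DN :: "('b, 'n) connection" and u \<delta> U +
  fixes c :: "('a, 'm) chart" and d :: "('b, 'n) chart" and \<epsilon> :: real
    and W :: "'a set" and e :: "'m \<Rightarrow> 'a \<Rightarrow> real ^ 'm"
  assumes c: "c \<in> A" and d: "d \<in> B" and \<epsilon>: "0 < \<epsilon>" "\<epsilon> \<le> \<delta>"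
    and W: "W \<subseteq> chart_dom c" and frame: "local_orthonormal_frame A g W e"
    and U_dom: "\<And>t q. t \<in> {-\<epsilon><..<\<epsilon>} \<Longrightarrow> q \<in> W \<Longrightarrow> U t q \<in> chart_dom d"
begin

abbreviation "I \<equiv> {-\<epsilon><..<\<epsilon>}"
abbreviation "R \<equiv> chart_map c ` W"
abbreviation "cyl \<equiv> I \<times> R"
abbreviation "E i \<equiv> M.field_coord c (e i)"
abbreviation "G \<equiv> M.coord_metric c"

text \<open>The following functions of \<open>z = (t, x)\<close> are the components in the charts \<open>c\<close> and \<open>d\<close> of the geometric
  objects of \<open>u\<^sub>t\<close>: \<open>u\<^sub>t\<close> itself, \<open>du\<^sub>t\<close>, the velocity \<open>\<partial>u\<^sub>t/\<partial>t\<close>, \<open>du\<^sub>t(e\<^sub>i)\<close>, the matrix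
  \<open>h(du\<^sub>t(e\<^sub>i), du\<^sub>t(e\<^sub>j))\<close>, \<open>d\<^sub>(\<^sub>3\<^sub>)u\<^sub>t(e\<^sub>i)\<close>, the component \<open>h(v, d\<^sub>(\<^sub>3\<^sub>)u\<^sub>t(e\<^sub>i))\<close> of the flux, and
  \<open>\<parallel>d\<^sub>(\<^sub>3\<^sub>)u\<^sub>t\<parallel>\<^sup>2\<close>.  That they are so is shown below, after their smoothness.\<close>

definition u_coord :: "real \<times> (real ^ 'm) \<Rightarrow> real ^ 'n" where
  "u_coord z = chart_map d (U (fst z) (chart_inv c (snd z)))"

abbreviation "H z \<equiv> N.coord_metric d (u_coord z)"

definition "du z X = frechet_derivative u_coord (at z) (0, X)"
definition "v_coord z = frechet_derivative u_coord (at z) (1, 0)"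
definition "du_frame i z = du z (E i (snd z))"
definition "gram i j z = H z (du_frame i z) (du_frame j z)"
definition "d3_frame i z = (\<Sum>j\<in>UNIV. \<Sum>k\<in>UNIV. (gram i j z * gram j k z) *\<^sub>R du_frame k z)"
definition "flux_comp i z = H z (v_coord z) (d3_frame i z)"
definition "\<Phi> z = (\<Sum>i\<in>UNIV. \<Sum>j\<in>UNIV. \<Sum>k\<in>UNIV. gram i j z * gram j k z * gram k i z)"

lemma open_W: "open W" and smooth_e: "smooth_field_on A W (e i)"
  and on_e: "q \<in> W \<Longrightarrow> orthonormal_basis_at g q (\<lambda>i. e i q)"
  using frame by (auto simp: local_orthonormal_frame_def)

lemma open_R: "open R" and R_img: "R \<subseteq> M.img c" and open_cyl: "open cyl"
  using M.open_chart_image[OF c open_W W] W by (auto intro: open_Times)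

lemma zero_I: "0 \<in> I" using \<epsilon> by simp

lemma inv_W: "x \<in> R \<Longrightarrow> chart_inv c x \<in> W" "q \<in> W \<Longrightarrow> chart_inv c (chart_map c q) = q"
  "x \<in> R \<Longrightarrow> chart_map c (chart_inv c x) = x"
  using W M.chart_inv_map[OF c] by auto

lemma u_coord_in: "z \<in> cyl \<Longrightarrow> u_coord z \<in> N.img d"
  using U_dom inv_W by (auto simp: u_coord_def)

lemma smooth_u_coord: "smooth_on cyl u_coord"
proof -
  have "smooth_on {(t, x). t \<in> {-\<delta><..<\<delta>} \<and> x \<in> M.img c \<and> U t (chart_inv c x) \<in> chart_dom d}
          (\<lambda>(t, x). chart_map d (U t (chart_inv c x)))"
    using variation c d by (simp add: smooth_variation_def)
  then have "smooth_on cyl (\<lambda>(t, x). chart_map d (U t (chart_inv c x)))"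
    by (rule smooth_on_subset) (use \<epsilon> R_img U_dom inv_W in auto)
  then show ?thesis by (simp add: u_coord_def[abs_def] case_prod_unfold)
qed

lemma smooth_E: "smooth_on R (E i)"
  using M.smooth_field_onD[OF smooth_e c] W by (simp add: Int_absorb1)

lemma smooth_snd: "smooth_on R f \<Longrightarrow> smooth_on cyl (\<lambda>z. f (snd z))"
  by (rule smooth_on_compose[OF open_cyl open_R]) (auto intro: smooth_on_linear open_cyl bounded_linear_snd)

lemma smooth_at_0: "smooth_on cyl f \<Longrightarrow> smooth_on R (\<lambda>x. f (0, x))"
proof (rule smooth_on_compose[OF open_R open_cyl])
  show "smooth_on R (\<lambda>x. (0::real, x))"
    by (intro smooth_on_Pair open_R smooth_on_const smooth_on_linear bounded_linear_ident)
qed (use zero_I in auto)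

lemma smooth_du:
  assumes "smooth_on cyl X" shows "smooth_on cyl (\<lambda>z. du z (X z))"
  unfolding du_def
  by (rule smooth_on_frechet_derivative_along[OF open_cyl open_cyl smooth_u_coord
      smooth_on_linear[OF open_cyl bounded_linear_ident]
      smooth_on_Pair[OF open_cyl smooth_on_const[OF open_cyl] assms]])

lemma smooth_v_coord: "smooth_on cyl v_coord"
  unfolding v_coord_def[abs_def] by (rule smooth_on_frechet_derivative[OF smooth_u_coord])

lemma smooth_du_frame: "smooth_on cyl (du_frame i)"
  unfolding du_frame_def[abs_def] by (intro smooth_du smooth_snd smooth_E)

lemma inner_form_H: "z \<in> cyl \<Longrightarrow> inner_form (H z)"
  by (rule N.inner_form_coord_metric[OF d u_coord_in])

lemma smooth_H: "smooth_on cyl a \<Longrightarrow> smooth_on cyl b \<Longrightarrow> smooth_on cyl (\<lambda>z. H z (a z) (b z))"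
  by (rule smooth_on_bilinear_form[OF open_cyl inner_form.bilinear[OF inner_form_H]
        smooth_on_compose[OF open_cyl N.open_img[OF d] u_coord_in N.smooth_coord_metric[OF d] smooth_u_coord]])

lemma smooth_gram: "smooth_on cyl (gram i j)"
  unfolding gram_def[abs_def] by (intro smooth_H smooth_du_frame)

lemma smooth_d3_frame: "smooth_on cyl (d3_frame i)"
  unfolding d3_frame_def[abs_def]
  by (intro smooth_on_sum smooth_on_scaleR smooth_on_mult smooth_gram smooth_du_frame open_cyl)

lemma smooth_flux_comp: "smooth_on cyl (flux_comp i)"
  unfolding flux_comp_def[abs_def] by (intro smooth_H smooth_v_coord smooth_d3_frame)

lemma smooth_\<Phi>: "smooth_on cyl \<Phi>"
  unfolding \<Phi>_def[abs_def] by (intro smooth_on_sum smooth_on_mult smooth_gram open_cyl)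

lemma partial_t:
  assumes "smooth_on cyl f" "(t, x) \<in> cyl"
  shows "((\<lambda>t. f (t, x)) has_derivative (\<lambda>s. frechet_derivative f (at (t, x)) (s, 0))) (at t)"
proof -
  have "((\<lambda>t. (t, x)) has_derivative (\<lambda>s. (s, 0))) (at t)"
    by (auto intro!: derivative_eq_intros)
  from has_derivative_compose[OF this smooth_on_has_derivative[OF assms]] show ?thesis .
qed

lemma partial_x:
  assumes "smooth_on cyl f" "(t, x) \<in> cyl"
  shows "((\<lambda>x. f (t, x)) has_derivative (\<lambda>s. frechet_derivative f (at (t, x)) (0, s))) (at x)"
proof -
  have "((\<lambda>x. (t, x)) has_derivative (\<lambda>s. (0, s))) (at x)"
    by (auto intro!: derivative_eq_intros)
  from has_derivative_compose[OF this smooth_on_has_derivative[OF assms]] show ?thesis .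
qed

lemma linear_du: "z \<in> cyl \<Longrightarrow> linear (du z)"
  using linear_compose[OF bounded_linear.linear[OF bounded_linear_Pair[OF bounded_linear_zero bounded_linear_ident]]
      smooth_on_linear_derivative[OF smooth_u_coord], of z]
  by (simp add: comp_def du_def[abs_def])

subsection \<open>The geometric quantities in the chart\<close>

lemma differential_coord:
  assumes t: "t \<in> I" and q: "q \<in> W"
  shows "tangent_coord B d (U t q) (differential A B (U t) q X) = du (t, chart_map c q) (tangent_coord A c q X)"
proof -
  let ?x = "chart_map c q"
  have z: "(t, ?x) \<in> cyl" using t q by auto
  have D: "((\<lambda>x. chart_map d (U t (chart_inv c x))) has_derivative du (t, ?x)) (at ?x)"
    using partial_x[OF smooth_u_coord z] by (simp add: u_coord_def du_def[abs_def])
  show ?thesis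
    using differential_chart[OF c _ d open_R _ R_img, of q "U t", OF _ _ _ differentiableI[OF D]]
      q W t U_dom inv_W by (auto simp: frechet_derivative_at[OF D, symmetric])
qed

lemma h_coord:
  assumes t: "t \<in> I" and q: "q \<in> W"
  shows "h (U t q) Y Z = H (t, chart_map c q) (tangent_coord B d (U t q) Y) (tangent_coord B d (U t q) Z)"
  using N.metric_chart[OF d U_dom[OF t q]] by (simp add: u_coord_def inv_W(2)[OF q])

lemma variation_field_coord:
  assumes q: "q \<in> W"
  shows "tangent_coord B d (u q) (variation_field B U q) = v_coord (0, chart_map c q)"
proof -
  let ?x = "chart_map c q" and ?b = "chart_at B (U 0 q)"
  let ?F = "chart_map ?b \<circ> chart_inv d"
  have z: "(0, ?x) \<in> cyl" using zero_I q by auto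
  note qd = U_dom[OF zero_I q]
  have u_coord0: "u_coord (0, ?x) = chart_map d (U 0 q)" by (simp add: u_coord_def inv_W(2)[OF q])
  have F: "(?F has_derivative frechet_derivative ?F (at (u_coord (0, ?x)))) (at (u_coord (0, ?x)))"
    unfolding u_coord0 using N.transition_differentiable[OF d qd N.chart_at]
    by (rule iffD1[OF frechet_derivative_works])
  have "((\<lambda>t. ?F (u_coord (t, ?x))) has_derivative
     (\<lambda>s. frechet_derivative ?F (at (u_coord (0, ?x))) (frechet_derivative u_coord (at (0, ?x)) (s, 0)))) (at 0)"
    by (rule has_derivative_compose[OF partial_t[OF smooth_u_coord z] F])
  then have "((\<lambda>t. chart_map ?b (U t q)) has_derivative
     (\<lambda>s. frechet_derivative ?F (at (u_coord (0, ?x))) (frechet_derivative u_coord (at (0, ?x)) (s, 0)))) (at 0)"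
  proof (rule has_derivative_transform_within_open[OF _ open_greaterThanLessThan zero_I])
    fix t assume "t \<in> I"
    from U_dom[OF this q] show "?F (u_coord (t, ?x)) = chart_map ?b (U t q)"
      by (simp add: u_coord_def inv_W(2)[OF q] N.chart_inv_map[OF d])
  qed
  moreover have "(\<lambda>s. frechet_derivative ?F (at (u_coord (0, ?x))) (frechet_derivative u_coord (at (0, ?x)) (s, 0)))
    = (\<lambda>s. s *\<^sub>R coord_field B d (v_coord (0, ?x)) (U 0 q))"
  proof
    fix s :: real
    have "frechet_derivative u_coord (at (0, ?x)) (s, 0) = s *\<^sub>R v_coord (0, ?x)"
      using linear_scale[OF smooth_on_linear_derivative[OF smooth_u_coord z], of s "(1, 0)"]
      by (simp add: v_coord_def)
    then show "frechet_derivative ?F (at (u_coord (0, ?x))) (frechet_derivative u_coord (at (0, ?x)) (s, 0))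
      = s *\<^sub>R coord_field B d (v_coord (0, ?x)) (U 0 q)"
      using linear_scale[OF has_derivative_linear[OF F]] by (simp add: coord_field_def u_coord0)
  qed
  ultimately have "((\<lambda>t. chart_map ?b (U t q)) has_vector_derivative coord_field B d (v_coord (0, ?x)) (U 0 q)) (at 0)"
    by (simp add: has_vector_derivative_def)
  then have "variation_field B U q = coord_field B d (v_coord (0, ?x)) (U 0 q)"
    unfolding variation_field_def by (rule vector_derivative_at)
  then show ?thesis using N.tangent_coord_coord_field[OF d qd] by (simp add: U_0)
qed

lemma differential_linear:
  assumes t: "t \<in> I" and q: "q \<in> W"
  shows "linear (differential A B (U t) q)"
proof -
  note td = U_dom[OF t q]
  have qc: "q \<in> chart_dom c" using q W by auto
  have z: "(t, chart_map c q) \<in> cyl" using t q by auto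
  have "differential A B (U t) q =
    (\<lambda>X. coord_field B d (du (t, chart_map c q) (tangent_coord A c q X)) (U t q))"
    by (rule ext, simp only: differential_coord[OF t q, symmetric] N.coord_field_tangent_coord[OF d td])
  then show ?thesis
    using linear_compose[OF linear_compose[OF M.linear_tangent_coord[OF c qc] linear_du[OF z]]
        N.linear_coord_field[OF d td]]
    by (simp only: comp_def)
qed

text \<open>The definition of \<open>d\<^sub>(\<^sub>3\<^sub>)u\<close> contains two traces with respect to a basis chosen at each point
  separately.  Replacing it by the smooth frame, one trace at a time, makes \<open>d\<^sub>(\<^sub>3\<^sub>)u\<close> accessible to
  differentiation.\<close>

lemma d3_orthonormal:
  assumes t: "t \<in> I" and q: "q \<in> W"
  defines "D \<equiv> differential A B (U t) q"
  shows "d3 A g B h (U t) q X = (\<Sum>j\<in>UNIV. \<Sum>k\<in>UNIV.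
     (h (U t q) (D X) (D (e j q)) * h (U t q) (D (e j q)) (D (e k q))) *\<^sub>R D (e k q))"
proof -
  define f where "f = (SOME f. orthonormal_basis_at g q f)"
  have f: "orthonormal_basis_at g q f"
    unfolding f_def by (rule someI_ex[OF M.orthonormal_basis_exists])
  interpret g: inner_form "g q" by (rule M.inner_form_metric)
  interpret h: inner_form "h (U t q)" by (rule N.inner_form_metric)
  note D = differential_linear[OF t q, folded D_def]
  have on: "g.orthonormal f" "g.orthonormal (\<lambda>i. e i q)"
    using f on_e[OF q] by (auto simp: orthonormal_basis_at_def)
  note lin = h.add_left h.add_right h.scale_left h.scale_right linear_add[OF D] linear_scale[OF D]
  have k: "(\<Sum>k\<in>UNIV. (h (U t q) w (D y) * h (U t q) (D y') (D (f k))) *\<^sub>R D (f k)) =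
    (\<Sum>k\<in>UNIV. (h (U t q) w (D y) * h (U t q) (D y') (D (e k q))) *\<^sub>R D (e k q))" for w y y'
    by (rule g.orthonormal_trace[OF on])
      (auto simp: bilinear_def lin algebra_simps intro!: linearI)
  have "d3 A g B h (U t) q X = (\<Sum>j\<in>UNIV. \<Sum>k\<in>UNIV.
     (h (U t q) (D X) (D (f j)) * h (U t q) (D (f j)) (D (f k))) *\<^sub>R D (f k))"
    by (simp add: d3_def D_def f_def Let_def)
  also have "\<dots> = (\<Sum>j\<in>UNIV. \<Sum>k\<in>UNIV.
     (h (U t q) (D X) (D (f j)) * h (U t q) (D (f j)) (D (e k q))) *\<^sub>R D (e k q))"
    by (simp only: k)
  also have "\<dots> = (\<Sum>j\<in>UNIV. \<Sum>k\<in>UNIV.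
     (h (U t q) (D X) (D (e j q)) * h (U t q) (D (e j q)) (D (e k q))) *\<^sub>R D (e k q))"
    by (rule g.orthonormal_trace[OF on])
      (auto simp: bilinear_def lin algebra_simps sum.distrib scaleR_sum_right intro!: linearI)
  finally show ?thesis .
qed

lemma d3_linear:
  assumes t: "t \<in> I" and q: "q \<in> W"
  shows "linear (d3 A g B h (U t) q)"
proof -
  interpret h: inner_form "h (U t q)" by (rule N.inner_form_metric)
  note D = differential_linear[OF t q]
  show ?thesis
    unfolding d3_orthonormal[OF t q, abs_def]
    by (rule linearI)
      (simp_all add: h.add_left h.scale_left linear_add[OF D] linear_scale[OF D] algebra_simps
        sum.distrib scaleR_sum_right)
qed

lemma d3_coord:
  assumes t: "t \<in> I" and q: "q \<in> W"
  shows "tangent_coord B d (U t q) (d3 A g B h (U t) q (e i q)) = d3_frame i (t, chart_map c q)"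
proof -
  note T = N.linear_tangent_coord[OF d U_dom[OF t q]]
  show ?thesis
    unfolding d3_orthonormal[OF t q] d3_frame_def gram_def du_frame_def
    by (simp add: linear_sum[OF T] linear_scale[OF T] h_coord[OF t q] differential_coord[OF t q] inv_W(2)[OF q])
qed

lemma d3_norm2_coord:
  assumes t: "t \<in> I" and q: "q \<in> W"
  shows "d3_norm2 A g B h (U t) q = \<Phi> (t, chart_map c q)"
proof -
  define f where "f = (SOME f. orthonormal_basis_at g q f)"
  have f: "orthonormal_basis_at g q f"
    unfolding f_def by (rule someI_ex[OF M.orthonormal_basis_exists])
  interpret g: inner_form "g q" by (rule M.inner_form_metric)
  interpret h: inner_form "h (U t q)" by (rule N.inner_form_metric)
  interpret H: inner_form "H (t, chart_map c q)" using t q by (intro inner_form_H) auto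
  note D = differential_linear[OF t q] and D3 = d3_linear[OF t q]
  have on: "g.orthonormal f" "g.orthonormal (\<lambda>i. e i q)"
    using f on_e[OF q] by (auto simp: orthonormal_basis_at_def)
  have "d3_norm2 A g B h (U t) q = (\<Sum>i\<in>UNIV. h (U t q) (d3 A g B h (U t) q (f i)) (differential A B (U t) q (f i)))"
    by (simp add: d3_norm2_def f_def Let_def)
  also have "\<dots> = (\<Sum>i\<in>UNIV. h (U t q) (d3 A g B h (U t) q (e i q)) (differential A B (U t) q (e i q)))"
    by (rule g.orthonormal_trace[OF on])
      (auto simp: bilinear_def h.add_left h.add_right h.scale_left h.scale_right
        linear_add[OF D] linear_scale[OF D] linear_add[OF D3] linear_scale[OF D3] intro!: linearI)
  also have "\<dots> = (\<Sum>i\<in>UNIV. H (t, chart_map c q) (d3_frame i (t, chart_map c q)) (du_frame i (t, chart_map c q)))"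
    by (simp add: h_coord[OF t q] d3_coord[OF t q] differential_coord[OF t q] du_frame_def inv_W(2)[OF q])
  also have "\<dots> = \<Phi> (t, chart_map c q)"
    by (simp add: \<Phi>_def d3_frame_def H.sum_left H.scale_left flip: gram_def)
  finally show ?thesis .
qed

lemma flux_coord:
  assumes q: "q \<in> W"
  shows "tangent_coord A c q (flux q) = (\<Sum>i\<in>UNIV. flux_comp i (0, chart_map c q) *\<^sub>R E i (chart_map c q))"
proof -
  define f where "f = (SOME f. orthonormal_basis_at g q f)"
  have f: "orthonormal_basis_at g q f"
    unfolding f_def by (rule someI_ex[OF M.orthonormal_basis_exists])
  interpret g: inner_form "g q" by (rule M.inner_form_metric)
  interpret h: inner_form "h (u q)" by (rule N.inner_form_metric)
  have D3: "linear (d3 A g B h u q)" using d3_linear[OF zero_I q] by (simp add: U_0)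
  have on: "g.orthonormal f" "g.orthonormal (\<lambda>i. e i q)"
    using f on_e[OF q] by (auto simp: orthonormal_basis_at_def)
  have "flux q = (\<Sum>i\<in>UNIV. h (u q) (variation_field B U q) (d3 A g B h u q (f i)) *\<^sub>R f i)"
    by (simp add: flux_def f_def Let_def)
  also have "\<dots> = (\<Sum>i\<in>UNIV. h (u q) (variation_field B U q) (d3 A g B h u q (e i q)) *\<^sub>R e i q)"
    by (rule g.orthonormal_trace[OF on])
      (auto simp: bilinear_def h.add_right h.scale_right linear_add[OF D3] linear_scale[OF D3]
        algebra_simps intro!: linearI)
  also have "\<dots> = (\<Sum>i\<in>UNIV. flux_comp i (0, chart_map c q) *\<^sub>R e i q)"
    using h_coord[OF zero_I q] d3_coord[OF zero_I q] variation_field_coord[OF q]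
    by (simp add: U_0 flux_comp_def)
  finally show ?thesis
    using q W M.linear_tangent_coord[OF c, of q]
    by (simp add: linear_sum linear_scale inv_W(2)[OF q] subsetD)
qed

end

section \<open>The Riemannian density\<close>

context lc_manifold
begin

definition vol_density :: "('a, 'm) chart \<Rightarrow> real ^ 'm \<Rightarrow> real" where
  "vol_density c x = sqrt (det (metric_matrix A g c x))"

lemma metric_matrix_coord_metric:
  "metric_matrix A g c x = (\<chi> i j. coord_metric c x (axis i 1) (axis j 1))"
  by (simp add: metric_matrix_def coord_metric_def)

lemma orthonormal_coord_basis_exists:
  assumes "c \<in> A" "x \<in> img c"
  shows "\<exists>e :: 'm \<Rightarrow> real ^ 'm. \<forall>i j. coord_metric c x (e i) (e j) = (if i = j then 1 else 0)"
proof -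
  obtain e where "orthonormal_basis_at g (chart_inv c x) e" using orthonormal_basis_exists by blast
  then have "\<forall>i j. coord_metric c x (tangent_coord A c (chart_inv c x) (e i)) (tangent_coord A c (chart_inv c x) (e j))
     = (if i = j then 1 else 0)"
    using metric_chart[OF assms(1) chart_inv_dom[OF assms]]
    by (simp add: orthonormal_basis_at_def chart_map_inv[OF assms])
  then show ?thesis by (intro exI[of _ "\<lambda>i. tangent_coord A c (chart_inv c x) (e i)"])
qed

lemma det_metric_matrix_pos:
  assumes c: "c \<in> A" and x: "x \<in> img c"
  shows "det (metric_matrix A g c x) > 0"
proof -
  obtain e :: "'m \<Rightarrow> real ^ 'm" where "\<And>i j. coord_metric c x (e i) (e j) = (if i = j then 1 else 0)"
    using orthonormal_coord_basis_exists[OF assms] by blast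
  then show ?thesis
    unfolding metric_matrix_coord_metric
    by (intro gram_det_has_derivative(2)[OF open_img[OF c] x inner_form_coord_metric[OF c]
          smooth_on_differentiable[OF smooth_coord_metric[OF c] x]])
qed

lemma vol_density_pos: "c \<in> A \<Longrightarrow> x \<in> img c \<Longrightarrow> vol_density c x > 0"
  by (simp add: vol_density_def det_metric_matrix_pos)

lemma smooth_vol_density:
  assumes c: "c \<in> A" shows "smooth_on (img c) (vol_density c)"
  unfolding vol_density_def[abs_def]
proof (rule smooth_on_sqrt[OF open_img[OF c] _ det_metric_matrix_pos[OF c]])
  show "smooth_on (img c) (\<lambda>x. det (metric_matrix A g c x))"
    unfolding det_def metric_matrix_coord_metric vec_lambda_beta
    by (intro smooth_on_sum smooth_on_mult smooth_on_const smooth_on_prod smooth_coord_metric[OF c] open_img[OF c])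
qed

text \<open>Half of the logarithmic derivative of the Gram determinant; the factor 2 that is cancelled comes from
  metric compatibility applied to \<open>g(e\<^sub>i, e\<^sub>i)\<close>.\<close>

lemma vol_density_has_derivative:
  assumes c: "c \<in> A" and x: "x \<in> img c"
    and e: "\<And>i j :: 'm. coord_metric c x (e i) (e j) = (if i = j then 1 else 0)"
  shows "(vol_density c has_derivative
    (\<lambda>z. vol_density c x * (\<Sum>i\<in>UNIV. coord_metric c x (christoffel c (chart_inv c x) z (e i)) (e i)))) (at x)"
proof -
  interpret inner_form "coord_metric c x" by (rule inner_form_coord_metric[OF c x])
  let ?d = "det (metric_matrix A g c x)"
  let ?S = "\<lambda>z. \<Sum>i\<in>UNIV. coord_metric c x (christoffel c (chart_inv c x) z (e i)) (e i)"
  note pos = det_metric_matrix_pos[OF c x]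
  have "frechet_derivative (\<lambda>x. coord_metric c x (e i) (e i)) (at x) z =
     2 * coord_metric c x (christoffel c (chart_inv c x) z (e i)) (e i)" for i z
    using coord_metric_derivative[OF c chart_inv_dom[OF c x], of "e i" "e i" z]
    by (simp add: chart_map_inv[OF c x] sym)
  then have "((\<lambda>x. det (metric_matrix A g c x)) has_derivative (\<lambda>z. ?d * (2 * ?S z))) (at x)"
    using gram_det_has_derivative(1)[OF open_img[OF c] x inner_form_coord_metric[OF c]
        smooth_on_differentiable[OF smooth_coord_metric[OF c] x] e]
    unfolding metric_matrix_coord_metric by (simp add: sum_distrib_left)
  from has_derivative_real_sqrt[OF pos this]
  show ?thesis
    unfolding vol_density_def[abs_def]
    by (rule has_derivative_eq_rhs) (use pos in \<open>simp add: fun_eq_iff field_simps\<close>)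
qed

end

section \<open>The first variation of the energy density\<close>

lemma sum_rotate:
  "(\<Sum>i\<in>I. \<Sum>j\<in>J. \<Sum>k\<in>L. f j k i) = (\<Sum>j\<in>J. \<Sum>k\<in>L. \<Sum>i\<in>I. f j k i)"
  for f :: "'b \<Rightarrow> 'c \<Rightarrow> 'a \<Rightarrow> real"
  by (subst sum.swap) (intro sum.cong refl sum.swap)

lemma sum_reverse:
  "(\<Sum>i\<in>I. \<Sum>j\<in>J. \<Sum>k\<in>L. f k j i) = (\<Sum>k\<in>L. \<Sum>j\<in>J. \<Sum>i\<in>I. f k j i)"
  for f :: "'c \<Rightarrow> 'b \<Rightarrow> 'a \<Rightarrow> real"
proof -
  have "(\<Sum>i\<in>I. \<Sum>j\<in>J. \<Sum>k\<in>L. f k j i) = (\<Sum>j\<in>J. \<Sum>k\<in>L. \<Sum>i\<in>I. f k j i)"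
    by (rule sum_rotate)
  then show ?thesis by (simp add: sum.swap[of _ J L])
qed

text \<open>The derivative of \<open>tr K\<^sup>3\<close> for a symmetric matrix \<open>K\<close> with derivative \<open>P + P\<^sup>T\<close>.  Cyclic
  permutation identifies the three terms of the product rule, and transposition the contributions of
  \<open>P\<close> and \<open>P\<^sup>T\<close>, hence the factor 6.\<close>

lemma trace_cube_derivative:
  fixes K K' P :: "'m::finite \<Rightarrow> 'm \<Rightarrow> real"
  assumes K: "\<And>i j. K i j = K j i" and K': "\<And>i j. K' i j = P i j + P j i"
  shows "(\<Sum>i\<in>UNIV. \<Sum>j\<in>UNIV. \<Sum>k\<in>UNIV. K i j * K j k * K' k i + (K i j * K' j k + K' i j * K j k) * K k i)
    = 6 * (\<Sum>i\<in>UNIV. \<Sum>j\<in>UNIV. \<Sum>k\<in>UNIV. K i j * K j k * P i k)"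
    (is "?L = 6 * ?A")
proof -
  let ?S = "\<lambda>f :: 'm \<Rightarrow> 'm \<Rightarrow> 'm \<Rightarrow> real. \<Sum>i\<in>UNIV. \<Sum>j\<in>UNIV. \<Sum>k\<in>UNIV. f i j k"
  have rev: "?S (\<lambda>i j k. K i j * K j k * P k i) = ?A"
    using sum_reverse[of "\<lambda>k j i. K k j * K j i * P k i" UNIV UNIV UNIV]
    by (simp add: K mult_ac)
  have 1: "?S (\<lambda>i j k. K i j * K j k * K' k i) = 2 * ?A"
    using rev by (simp add: K' distrib_left sum.distrib)
  have "?S (\<lambda>i j k. K i j * K j k * K' k i) = (\<Sum>i\<in>UNIV. \<Sum>j\<in>UNIV. \<Sum>k\<in>UNIV. K j k * K' k i * K i j)"
    by (simp add: mult_ac)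
  also have "\<dots> = ?S (\<lambda>i j k. K i j * K' j k * K k i)"
    by (rule sum_rotate)
  finally have 2: "?S (\<lambda>i j k. K i j * K' j k * K k i) = 2 * ?A" using 1 by simp
  have "?S (\<lambda>i j k. K' i j * K j k * K k i) = (\<Sum>i\<in>UNIV. \<Sum>j\<in>UNIV. \<Sum>k\<in>UNIV. K j k * K k i * K' i j)"
    by (simp add: mult_ac)
  also have "\<dots> = ?S (\<lambda>i j k. K i j * K j k * K' k i)"
    by (rule sum_rotate)
  finally have 3: "?S (\<lambda>i j k. K' i j * K j k * K k i) = 2 * ?A" using 1 by simp
  have "?L = ?S (\<lambda>i j k. K i j * K j k * K' k i) + ?S (\<lambda>i j k. K i j * K' j k * K k i)
     + ?S (\<lambda>i j k. K' i j * K j k * K k i)"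
    by (simp add: distrib_right sum.distrib)
  then show ?thesis unfolding 1 2 3 by simp
qed

context variation_chart
begin

context
  fixes q assumes q: "q \<in> W"
begin

abbreviation "x\<^sub>q \<equiv> chart_map c q"
abbreviation "z\<^sub>q \<equiv> (0 :: real, x\<^sub>q)"
abbreviation "\<Gamma> \<equiv> M.christoffel c q"
abbreviation "\<Gamma>' \<equiv> N.christoffel d (u q)"

lemma x_R: "x\<^sub>q \<in> R" and x_img: "x\<^sub>q \<in> M.img c" and z_cyl: "z\<^sub>q \<in> cyl" and q_dom: "q \<in> chart_dom c"
  and uq_dom: "u q \<in> chart_dom d"
  using q W zero_I U_dom[OF zero_I q] by (auto simp: U_0)

lemma u_coord_z: "chart_inv d (u_coord z\<^sub>q) = u q"
  using N.chart_inv_map[OF d uq_dom] by (simp add: u_coord_def inv_W(2)[OF q] U_0)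

lemma \<Gamma>'_symmetric: "\<Gamma>' v w = \<Gamma>' w v"
  by (rule N.christoffel_symmetric[OF d uq_dom])

lemma bilinear_\<Gamma>: "bilinear \<Gamma>" and \<Gamma>_symmetric: "\<Gamma> v w = \<Gamma> w v"
  by (rule M.bilinear_christoffel[OF c q_dom]) (rule M.christoffel_symmetric[OF c q_dom])

definition "nabla_v Y = frechet_derivative v_coord (at z\<^sub>q) (0, Y) + \<Gamma>' (du z\<^sub>q Y) (v_coord z\<^sub>q)"

text \<open>The covariant derivative of \<open>du(e\<^sub>i)\<close> in the direction of \<open>t\<close> is that of \<open>v\<close> in the direction
  of \<open>e\<^sub>i\<close>: second derivatives commute and the connection is torsion free.\<close>

lemma nabla_t_du_frame:
  "frechet_derivative (du_frame i) (at z\<^sub>q) (1, 0) + \<Gamma>' (v_coord z\<^sub>q) (du_frame i z\<^sub>q) = nabla_v (E i x\<^sub>q)"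
proof -
  let ?f = "\<lambda>y. frechet_derivative u_coord (at y) (0, E i x\<^sub>q)"
  have f: "smooth_on cyl ?f" by (rule smooth_on_frechet_derivative[OF smooth_u_coord])
  have "(\<lambda>t. du_frame i (t, x\<^sub>q)) = (\<lambda>t. ?f (t, x\<^sub>q))" by (simp add: du_frame_def du_def)
  then have "(\<lambda>s. frechet_derivative (du_frame i) (at z\<^sub>q) (s, 0)) = (\<lambda>s. frechet_derivative ?f (at z\<^sub>q) (s, 0))"
    using has_derivative_unique[OF partial_t[OF smooth_du_frame[of i] z_cyl], of "\<lambda>s. frechet_derivative ?f (at z\<^sub>q) (s, 0)"]
      partial_t[OF f z_cyl] by simp
  then have "frechet_derivative (du_frame i) (at z\<^sub>q) (1, 0) = frechet_derivative ?f (at z\<^sub>q) (1, 0)"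
    by (rule fun_cong)
  also have "\<dots> = frechet_derivative v_coord (at z\<^sub>q) (0, E i x\<^sub>q)"
    unfolding v_coord_def[abs_def] by (rule second_derivative_symmetric[OF open_cyl smooth_u_coord z_cyl])
  finally show ?thesis by (simp add: nabla_v_def du_frame_def \<Gamma>'_symmetric)
qed

lemma energy_density_derivative:
  "frechet_derivative \<Phi> (at z\<^sub>q) (1, 0) = 6 * (\<Sum>i\<in>UNIV. H z\<^sub>q (nabla_v (E i x\<^sub>q)) (d3_frame i z\<^sub>q))"
proof -
  interpret H: inner_form "H z\<^sub>q" by (rule inner_form_H[OF z_cyl])
  define P where "P i j = H z\<^sub>q (nabla_v (E i x\<^sub>q)) (du_frame j z\<^sub>q)" for i j
  define gram' where "gram' i j = frechet_derivative (gram i j) (at z\<^sub>q)" for i j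
  have gram': "(gram i j has_derivative gram' i j) (at z\<^sub>q)" for i j
    unfolding gram'_def by (rule smooth_on_has_derivative[OF smooth_gram z_cyl])
  have "gram' i j (1, 0) = P i j + P j i" for i j
  proof -
    have "(gram i j has_derivative
       (\<lambda>\<zeta>. H z\<^sub>q (frechet_derivative (du_frame i) (at z\<^sub>q) \<zeta> + \<Gamma>' (frechet_derivative u_coord (at z\<^sub>q) \<zeta>) (du_frame i z\<^sub>q)) (du_frame j z\<^sub>q)
         + H z\<^sub>q (du_frame i z\<^sub>q) (frechet_derivative (du_frame j) (at z\<^sub>q) \<zeta> + \<Gamma>' (frechet_derivative u_coord (at z\<^sub>q) \<zeta>) (du_frame j z\<^sub>q)))) (at z\<^sub>q)"
      unfolding gram_def[abs_def]
      using N.coord_metric_along_has_derivative[OF d open_cyl z_cyl u_coord_in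
          smooth_on_has_derivative[OF smooth_u_coord z_cyl] smooth_on_has_derivative[OF smooth_du_frame z_cyl]
          smooth_on_has_derivative[OF smooth_du_frame z_cyl]]
      unfolding u_coord_z .
    from has_derivative_unique[OF gram' this]
    have "gram' i j (1, 0) = H z\<^sub>q (frechet_derivative (du_frame i) (at z\<^sub>q) (1, 0) + \<Gamma>' (v_coord z\<^sub>q) (du_frame i z\<^sub>q)) (du_frame j z\<^sub>q)
         + H z\<^sub>q (du_frame i z\<^sub>q) (frechet_derivative (du_frame j) (at z\<^sub>q) (1, 0) + \<Gamma>' (v_coord z\<^sub>q) (du_frame j z\<^sub>q))"
      by (simp add: v_coord_def)
    then show ?thesis unfolding nabla_t_du_frame by (simp add: P_def H.sym)
  qed
  moreover have "gram i j z\<^sub>q = gram j i z\<^sub>q" for i j by (simp add: gram_def H.sym)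
  ultimately have tr: "(\<Sum>i\<in>UNIV. \<Sum>j\<in>UNIV. \<Sum>k\<in>UNIV. gram i j z\<^sub>q * gram j k z\<^sub>q * gram' k i (1, 0)
      + (gram i j z\<^sub>q * gram' j k (1, 0) + gram' i j (1, 0) * gram j k z\<^sub>q) * gram k i z\<^sub>q)
    = 6 * (\<Sum>i\<in>UNIV. \<Sum>j\<in>UNIV. \<Sum>k\<in>UNIV. gram i j z\<^sub>q * gram j k z\<^sub>q * P i k)"
    by (rule trace_cube_derivative[of "\<lambda>i j. gram i j z\<^sub>q" "\<lambda>i j. gram' i j (1, 0)" P, rotated])
  have "(\<Phi> has_derivative (\<lambda>\<zeta>. \<Sum>i\<in>UNIV. \<Sum>j\<in>UNIV. \<Sum>k\<in>UNIV. gram i j z\<^sub>q * gram j k z\<^sub>q * gram' k i \<zeta>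
      + (gram i j z\<^sub>q * gram' j k \<zeta> + gram' i j \<zeta> * gram j k z\<^sub>q) * gram k i z\<^sub>q)) (at z\<^sub>q)"
    unfolding \<Phi>_def[abs_def] by (intro has_derivative_sum has_derivative_mult gram')
  note frechet_derivative_at[OF this, symmetric]
  then have "frechet_derivative \<Phi> (at z\<^sub>q) (1, 0)
     = 6 * (\<Sum>i\<in>UNIV. \<Sum>j\<in>UNIV. \<Sum>k\<in>UNIV. gram i j z\<^sub>q * gram j k z\<^sub>q * P i k)"
    using tr by simp
  then show ?thesis by (simp add: d3_frame_def P_def H.sum_right H.scale_right)
qed

lemma flux_comp_has_derivative:
  "((\<lambda>y. flux_comp i (0, y)) has_derivative
    (\<lambda>Y. H z\<^sub>q (nabla_v Y) (d3_frame i z\<^sub>q) + H z\<^sub>q (v_coord z\<^sub>q) (frechet_derivative (d3_frame i) (at z\<^sub>q) (0, Y) + \<Gamma>' (du z\<^sub>q Y) (d3_frame i z\<^sub>q)))) (at x\<^sub>q)"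
proof -
  have "(flux_comp i has_derivative
     (\<lambda>\<zeta>. H z\<^sub>q (frechet_derivative v_coord (at z\<^sub>q) \<zeta> + \<Gamma>' (frechet_derivative u_coord (at z\<^sub>q) \<zeta>) (v_coord z\<^sub>q)) (d3_frame i z\<^sub>q)
       + H z\<^sub>q (v_coord z\<^sub>q) (frechet_derivative (d3_frame i) (at z\<^sub>q) \<zeta> + \<Gamma>' (frechet_derivative u_coord (at z\<^sub>q) \<zeta>) (d3_frame i z\<^sub>q)))) (at z\<^sub>q)"
    unfolding flux_comp_def[abs_def]
    using N.coord_metric_along_has_derivative[OF d open_cyl z_cyl u_coord_in
        smooth_on_has_derivative[OF smooth_u_coord z_cyl] smooth_on_has_derivative[OF smooth_v_coord z_cyl]
        smooth_on_has_derivative[OF smooth_d3_frame z_cyl]]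
    unfolding u_coord_z .
  then show ?thesis
    using partial_x[OF smooth_flux_comp z_cyl, of i] frechet_derivative_at[of "flux_comp i" _ z\<^sub>q]
    by (simp add: nabla_v_def du_def)
qed

text \<open>The coordinate fields of \<open>d\<close> that occur in the definition have constant components, so the
  definition is the expansion of the bilinear map \<open>\<Gamma>'\<close> in its second argument.  Here \<open>d\<close> has to be the
  chart used in the definition.\<close>

lemma pullback_connection_coord:
  assumes dq: "d = chart_at B (u q)"
    and V: "((\<lambda>y. tangent_coord B d (u (chart_inv c y)) (V (chart_inv c y))) has_derivative V') (at x\<^sub>q)"
  shows "tangent_coord B d (u q) (pullback_connection A B DN u q X V) =
    V' (tangent_coord A c q X) + \<Gamma>' (du z\<^sub>q (tangent_coord A c q X)) (tangent_coord B d (u q) (V q))"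
proof -
  note T = N.linear_tangent_coord[OF d uq_dom]
  have der: "deriv_at A (\<lambda>q. tangent_coord B d (u q) (V q) $ a) q X = V' (tangent_coord A c q X) $ a" for a
  proof -
    have "(((\<lambda>q. tangent_coord B d (u q) (V q) $ a) \<circ> chart_inv c) has_derivative (\<lambda>y. V' y $ a)) (at x\<^sub>q)"
      using bounded_linear.has_derivative[OF bounded_linear_vec_nth V] by (simp add: comp_def)
    note E = this frechet_derivative_at[OF this, symmetric]
    show ?thesis
      by (subst M.deriv_at_chart[OF c q_dom differentiableI[OF E(1)]]) (simp only: E(2))
  qed
  have "tangent_coord B d (u q) (pullback_connection A B DN u q X V) =
    (\<Sum>a\<in>UNIV. V' (tangent_coord A c q X) $ a *\<^sub>R axis a 1 +
       tangent_coord B d (u q) (V q) $ a *\<^sub>R \<Gamma>' (tangent_coord B d (u q) (differential A B u q X)) (axis a 1))"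
    unfolding pullback_connection_def Let_def dq[symmetric]
    by (simp add: linear_sum[OF T] linear_add[OF T] linear_scale[OF T] der
        N.tangent_coord_coord_field[OF d uq_dom] N.christoffel_def N.coord_field_tangent_coord[OF d uq_dom])
  also have "tangent_coord B d (u q) (differential A B u q X) = du z\<^sub>q (tangent_coord A c q X)"
    using differential_coord[OF zero_I q, of X] by (simp add: U_0)
  finally show ?thesis
    by (subst N.christoffel_expansion[OF d uq_dom]) (simp add: sum.distrib axis_expansion)
qed

lemma frame_covariant_derivative:
  "tangent_coord A c q (DM q (e i q) (e j)) = frechet_derivative (E j) (at x\<^sub>q) (E i x\<^sub>q) + \<Gamma> (E i x\<^sub>q) (E j x\<^sub>q)"
  using M.connection_chart[OF c q_dom open_W q smooth_e, of "e i q" j] by (simp add: inv_W(2)[OF q])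

lemma E_orthonormal: "y \<in> R \<Longrightarrow> G y (E i y) (E j y) = (if i = j then 1 else 0)"
  using on_e[OF inv_W(1)[of y]] M.metric_chart[OF c, of "chart_inv c y"] inv_W W
  by (simp add: orthonormal_basis_at_def subset_iff)

text \<open>The functions \<open>g(e\<^sub>i, e\<^sub>j)\<close> are constant.\<close>

lemma E_skew:
  "G x\<^sub>q (frechet_derivative (E i) (at x\<^sub>q) Y + \<Gamma> Y (E i x\<^sub>q)) (E j x\<^sub>q) +
   G x\<^sub>q (E i x\<^sub>q) (frechet_derivative (E j) (at x\<^sub>q) Y + \<Gamma> Y (E j x\<^sub>q)) = 0"
proof -
  have 1: "((\<lambda>y. G y (E i y) (E j y)) has_derivative
    (\<lambda>Y. G x\<^sub>q (frechet_derivative (E i) (at x\<^sub>q) Y + \<Gamma> Y (E i x\<^sub>q)) (E j x\<^sub>q) +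
     G x\<^sub>q (E i x\<^sub>q) (frechet_derivative (E j) (at x\<^sub>q) Y + \<Gamma> Y (E j x\<^sub>q)))) (at x\<^sub>q)"
    using M.coord_metric_along_has_derivative[OF c open_R x_R subsetD[OF R_img] has_derivative_ident
        smooth_on_has_derivative[OF smooth_E x_R] smooth_on_has_derivative[OF smooth_E x_R], of i j]
    unfolding inv_W(2)[OF q] .
  have 2: "((\<lambda>y. G y (E i y) (E j y)) has_derivative (\<lambda>_. 0)) (at x\<^sub>q)"
    by (rule has_derivative_transform_within_open[OF has_derivative_const[of "if i = j then 1 else 0"] open_R x_R])
      (simp only: E_orthonormal)
  show ?thesis using fun_cong[OF has_derivative_unique[OF 1 2], of Y] .
qed

text \<open>The frame is the one that the definition of the divergence selects at \<open>q\<close>.  The second sum is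
  \<open>\<Sum>\<^sub>i h(v, d\<^sub>(\<^sub>3\<^sub>)u(\<nabla>\<^sub>e\<^sub>i e\<^sub>i))\<close>, with \<open>\<nabla>\<^sub>e\<^sub>i e\<^sub>i\<close> expanded in the frame.\<close>

lemma tension_inner:
  assumes dq: "d = chart_at B (u q)"
    and fr: "e = (SOME e. \<exists>W. q \<in> W \<and> local_orthonormal_frame A g W e)"
  shows "h (u q) (variation_field B U q) (Phi3_tension A g DM B h DN u q) =
    (\<Sum>i\<in>UNIV. H z\<^sub>q (v_coord z\<^sub>q) (frechet_derivative (d3_frame i) (at z\<^sub>q) (0, E i x\<^sub>q) + \<Gamma>' (du_frame i z\<^sub>q) (d3_frame i z\<^sub>q)))
    - (\<Sum>i\<in>UNIV. \<Sum>j\<in>UNIV. G x\<^sub>q (frechet_derivative (E i) (at x\<^sub>q) (E i x\<^sub>q) + \<Gamma> (E i x\<^sub>q) (E i x\<^sub>q)) (E j x\<^sub>q) * flux_comp j z\<^sub>q)"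
proof -
  interpret g: inner_form "g q" by (rule M.inner_form_metric)
  interpret hq: inner_form "h (u q)" by (rule N.inner_form_metric)
  interpret Hz: inner_form "H z\<^sub>q" by (rule inner_form_H[OF z_cyl])
  note D3 = d3_linear[OF zero_I q, unfolded U_0]
  note T = N.linear_tangent_coord[OF d uq_dom]
  note H = h_coord[OF zero_I q, unfolded U_0] and vf = variation_field_coord[OF q]
  have pb: "h (u q) (variation_field B U q) (pullback_connection A B DN u q (e i q) (\<lambda>q. d3 A g B h u q (e i q)))
     = H z\<^sub>q (v_coord z\<^sub>q) (frechet_derivative (d3_frame i) (at z\<^sub>q) (0, E i x\<^sub>q) + \<Gamma>' (du_frame i z\<^sub>q) (d3_frame i z\<^sub>q))" for i
  proof -
    have "((\<lambda>y. tangent_coord B d (u (chart_inv c y)) (d3 A g B h u (chart_inv c y) (e i (chart_inv c y)))) has_derivative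
      (\<lambda>Y. frechet_derivative (d3_frame i) (at z\<^sub>q) (0, Y))) (at x\<^sub>q)"
      using partial_x[OF smooth_d3_frame z_cyl]
      by (rule has_derivative_transform_within_open[OF _ open_R x_R])
        (use d3_coord[OF zero_I inv_W(1)] inv_W(3) in \<open>simp add: U_0\<close>)
    from pullback_connection_coord[OF dq this, of "e i q"]
    show ?thesis
      using d3_coord[OF zero_I q, of i] by (simp add: H vf U_0 du_frame_def inv_W(2)[OF q])
  qed
  have d3Y: "h (u q) (variation_field B U q) (d3 A g B h u q Y) = (\<Sum>j\<in>UNIV. g q Y (e j q) * flux_comp j z\<^sub>q)" for Y
  proof -
    have "d3 A g B h u q Y = d3 A g B h u q (\<Sum>j\<in>UNIV. g q Y (e j q) *\<^sub>R e j q)"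
      using on_e[OF q] by (simp add: g.orthonormal_expansion orthonormal_basis_at_def)
    then show ?thesis
      using d3_coord[OF zero_I q] by (simp add: linear_sum[OF D3] linear_scale[OF D3] hq.sum_right hq.scale_right H vf U_0 flux_comp_def
          linear_sum[OF T] linear_scale[OF T] Hz.sum_right Hz.scale_right)
  qed
  have "Phi3_tension A g DM B h DN u q = (\<Sum>i\<in>UNIV. pullback_connection A B DN u q (e i q) (\<lambda>q. d3 A g B h u q (e i q))
      - d3 A g B h u q (DM q (e i q) (e i)))"
    by (simp add: Phi3_tension_def divergence_def Let_def flip: fr)
  then show ?thesis
    by (simp add: hq.sum_right hq.diff_right pb d3Y M.metric_chart[OF c q_dom] frame_covariant_derivative
        sum_subtractf inv_W(2)[OF q])
qed

text \<open>Here \<open>\<Sum>\<^sub>k \<partial>\<^sub>k(w X\<^sup>k) = dw(X) + w tr DX\<close>.  The trace is evaluated in the frame, and the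
  logarithmic derivative of \<open>w\<close> supplies the Christoffel terms which complete \<open>De\<^sub>j(e\<^sub>i)\<close> to
  \<open>\<nabla>\<^sub>e\<^sub>i e\<^sub>j\<close>; symmetry of the Christoffel symbols exchanges their arguments.\<close>

lemma flux_divergence_coord:
  "(\<Sum>k\<in>UNIV. frechet_derivative (\<lambda>y. M.vol_density c y *\<^sub>R M.field_coord c flux y) (at x\<^sub>q) (axis k 1) $ k) =
   M.vol_density c x\<^sub>q * ((\<Sum>i\<in>UNIV. frechet_derivative (\<lambda>y. flux_comp i (0, y)) (at x\<^sub>q) (E i x\<^sub>q)) +
     (\<Sum>i\<in>UNIV. \<Sum>j\<in>UNIV. flux_comp j z\<^sub>q * G x\<^sub>q (frechet_derivative (E j) (at x\<^sub>q) (E i x\<^sub>q) + \<Gamma> (E i x\<^sub>q) (E j x\<^sub>q)) (E i x\<^sub>q)))"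
proof -
  interpret G: inner_form "G x\<^sub>q" by (rule M.inner_form_coord_metric[OF c x_img])
  let ?w = "M.vol_density c"
  let ?X = "\<lambda>y. \<Sum>j\<in>UNIV. flux_comp j (0, y) *\<^sub>R E j y"
  let ?X' = "\<lambda>Y. \<Sum>j\<in>UNIV. flux_comp j (0, x\<^sub>q) *\<^sub>R frechet_derivative (E j) (at x\<^sub>q) Y + frechet_derivative (\<lambda>y. flux_comp j (0, y)) (at x\<^sub>q) Y *\<^sub>R E j x\<^sub>q"
  let ?w' = "\<lambda>Y. ?w x\<^sub>q * (\<Sum>i\<in>UNIV. G x\<^sub>q (\<Gamma> Y (E i x\<^sub>q)) (E i x\<^sub>q))"
  have on: "G.orthonormal (\<lambda>i. E i x\<^sub>q)" using E_orthonormal[OF x_R] by blast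
  have w': "(?w has_derivative ?w') (at x\<^sub>q)"
    using M.vol_density_has_derivative[OF c x_img, of "\<lambda>i. E i x\<^sub>q"] on by (simp add: inv_W(2)[OF q])
  have flux_comp': "((\<lambda>y. flux_comp j (0, y)) has_derivative frechet_derivative (\<lambda>y. flux_comp j (0, y)) (at x\<^sub>q)) (at x\<^sub>q)" for j
    by (rule smooth_on_has_derivative[OF smooth_at_0[OF smooth_flux_comp] x_R])
  have X': "(?X has_derivative ?X') (at x\<^sub>q)"
    by (intro has_derivative_sum has_derivative_scaleR flux_comp' smooth_on_has_derivative[OF smooth_E x_R])
  have "((\<lambda>y. ?w y *\<^sub>R ?X y) has_derivative (\<lambda>Y. ?w x\<^sub>q *\<^sub>R ?X' Y + ?w' Y *\<^sub>R ?X x\<^sub>q)) (at x\<^sub>q)"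
    by (rule has_derivative_scaleR[OF w' X'])
  then have "((\<lambda>y. ?w y *\<^sub>R M.field_coord c flux y) has_derivative (\<lambda>Y. ?w x\<^sub>q *\<^sub>R ?X' Y + ?w' Y *\<^sub>R ?X x\<^sub>q)) (at x\<^sub>q)"
    by (rule has_derivative_transform_within_open[OF _ open_R x_R])
      (use flux_coord[OF inv_W(1)] inv_W(3) in simp)
  then have "frechet_derivative (\<lambda>y. ?w y *\<^sub>R M.field_coord c flux y) (at x\<^sub>q) = (\<lambda>Y. ?w x\<^sub>q *\<^sub>R ?X' Y + ?w' Y *\<^sub>R ?X x\<^sub>q)"
    by (rule frechet_derivative_at[symmetric])
  then have "(\<Sum>k\<in>UNIV. frechet_derivative (\<lambda>y. ?w y *\<^sub>R M.field_coord c flux y) (at x\<^sub>q) (axis k 1) $ k)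
     = ?w x\<^sub>q * (\<Sum>k\<in>UNIV. ?X' (axis k 1) $ k) + (\<Sum>k\<in>UNIV. ?X x\<^sub>q $ k *\<^sub>R ?w' (axis k 1))"
    by (simp add: sum.distrib sum_distrib_left distrib_left mult.commute del: sum_component)
  also have "(\<Sum>k\<in>UNIV. ?X x\<^sub>q $ k *\<^sub>R ?w' (axis k 1)) = ?w' (?X x\<^sub>q)"
    using linear_sum[OF has_derivative_linear[OF w'], of "\<lambda>k. ?X x\<^sub>q $ k *\<^sub>R axis k 1" UNIV]
      linear_scale[OF has_derivative_linear[OF w']] axis_expansion[of "?X x\<^sub>q"] by simp
  also have "(\<Sum>k\<in>UNIV. ?X' (axis k 1) $ k) = (\<Sum>i\<in>UNIV. G x\<^sub>q (?X' (E i x\<^sub>q)) (E i x\<^sub>q))"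
    by (rule G.trace_orthonormal[OF on has_derivative_linear[OF X']])
  also have "\<dots> = (\<Sum>i\<in>UNIV. frechet_derivative (\<lambda>y. flux_comp i (0, y)) (at x\<^sub>q) (E i x\<^sub>q)) +
     (\<Sum>i\<in>UNIV. \<Sum>j\<in>UNIV. flux_comp j z\<^sub>q * G x\<^sub>q (frechet_derivative (E j) (at x\<^sub>q) (E i x\<^sub>q)) (E i x\<^sub>q))"
    by (simp add: E_orthonormal[OF x_R] G.sum_left G.add_left G.scale_left sum.distrib if_distrib cong: if_cong)
  also have "?w' (?X x\<^sub>q) = ?w x\<^sub>q * (\<Sum>i\<in>UNIV. \<Sum>j\<in>UNIV. flux_comp j z\<^sub>q * G x\<^sub>q (\<Gamma> (E i x\<^sub>q) (E j x\<^sub>q)) (E i x\<^sub>q))"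
  proof -
    have lin: "linear (\<lambda>Y. \<Gamma> Y v)" for v using bilinear_\<Gamma> by (simp add: bilinear_def)
    have "G x\<^sub>q (\<Gamma> (?X x\<^sub>q) (E i x\<^sub>q)) (E i x\<^sub>q) = (\<Sum>j\<in>UNIV. flux_comp j z\<^sub>q * G x\<^sub>q (\<Gamma> (E i x\<^sub>q) (E j x\<^sub>q)) (E i x\<^sub>q))" for i
      by (simp add: linear_sum[OF lin] linear_scale[OF lin] G.sum_left G.scale_left \<Gamma>_symmetric[of "E i x\<^sub>q"])
    then show ?thesis by simp
  qed
  finally show ?thesis
    by (simp add: G.add_left distrib_left sum.distrib)
qed

text \<open>By the product rule \<open>e\<^sub>i(h(v, d\<^sub>(\<^sub>3\<^sub>)u(e\<^sub>i)))\<close> splits into the term that occurs in the derivative of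
  the energy density and the one that occurs in the tension field.  The rest is
  the identity \<open>g(\<nabla>\<^sub>X e\<^sub>j, e\<^sub>i) = - g(\<nabla>\<^sub>X e\<^sub>i, e\<^sub>j)\<close>.\<close>

lemma flux_divergence:
  assumes dq: "d = chart_at B (u q)"
    and fr: "e = (SOME e. \<exists>W. q \<in> W \<and> local_orthonormal_frame A g W e)"
  shows "(\<Sum>k\<in>UNIV. frechet_derivative (\<lambda>y. M.vol_density c y *\<^sub>R M.field_coord c flux y) (at x\<^sub>q) (axis k 1) $ k) =
    M.vol_density c x\<^sub>q * (frechet_derivative \<Phi> (at z\<^sub>q) (1, 0) / 6
      + h (u q) (variation_field B U q) (Phi3_tension A g DM B h DN u q))"
proof -
  interpret G: inner_form "G x\<^sub>q" by (rule M.inner_form_coord_metric[OF c x_img])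
  let ?D = "\<lambda>i j. frechet_derivative (E j) (at x\<^sub>q) (E i x\<^sub>q) + \<Gamma> (E i x\<^sub>q) (E j x\<^sub>q)"
  have flux_comp: "frechet_derivative (\<lambda>y. flux_comp i (0, y)) (at x\<^sub>q) (E i x\<^sub>q) = H z\<^sub>q (nabla_v (E i x\<^sub>q)) (d3_frame i z\<^sub>q)
     + H z\<^sub>q (v_coord z\<^sub>q) (frechet_derivative (d3_frame i) (at z\<^sub>q) (0, E i x\<^sub>q) + \<Gamma>' (du_frame i z\<^sub>q) (d3_frame i z\<^sub>q))" for i
    using fun_cong[OF frechet_derivative_at[OF flux_comp_has_derivative[of i]], of "E i x\<^sub>q"] by (simp add: du_frame_def)
  have skew: "G x\<^sub>q (?D i j) (E i x\<^sub>q) = - G x\<^sub>q (?D i i) (E j x\<^sub>q)" for i j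
    using E_skew[of j "E i x\<^sub>q" i] by (simp add: G.sym)
  show ?thesis
    unfolding flux_divergence_coord tension_inner[OF dq fr] energy_density_derivative flux_comp skew
    by (simp add: sum.distrib sum_negf mult.commute)
qed

end

end

section \<open>Differentiation under the integral sign\<close>

text \<open>By the mean value theorem the bound on the derivatives also dominates the difference quotients, so
  that dominated convergence applies along every sequence tending to zero.\<close>

lemma derivative_under_integral:
  fixes F F' :: "real \<Rightarrow> 'a \<Rightarrow> real"
  assumes \<eta>: "\<eta> > 0" and int: "\<And>t. \<bar>t\<bar> < \<eta> \<Longrightarrow> integrable M (F t)"
    and der: "\<And>t p. \<bar>t\<bar> < \<eta> \<Longrightarrow> p \<in> space M \<Longrightarrow> ((\<lambda>t. F t p) has_real_derivative F' t p) (at t)"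
    and w: "integrable M w" "\<And>t p. \<bar>t\<bar> < \<eta> \<Longrightarrow> p \<in> space M \<Longrightarrow> \<bar>F' t p\<bar> \<le> w p"
  shows "integrable M (F' 0)"
    and "((\<lambda>t. \<integral>p. F t p \<partial>M) has_real_derivative (\<integral>p. F' 0 p \<partial>M)) (at 0)"
proof -
  have bound: "\<bar>(F t p - F 0 p) / t\<bar> \<le> w p" if t: "\<bar>t\<bar> < \<eta>" "t \<noteq> 0" and p: "p \<in> space M" for t p
  proof -
    have "norm (F t p - F 0 p) \<le> w p * norm (t - 0)"
    proof (rule field_differentiable_bound[where S = "{-\<eta><..<\<eta>}" and f' = "\<lambda>t. F' t p"])
      show "((\<lambda>t. F t p) has_field_derivative F' s p) (at s within {-\<eta><..<\<eta>})" if "s \<in> {-\<eta><..<\<eta>}" for s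
        using der[of s p] p that by (auto intro: has_field_derivative_at_within)
      show "norm (F' s p) \<le> w p" if "s \<in> {-\<eta><..<\<eta>}" for s
        using w(2)[of s p] p that by auto
    qed (use t \<eta> in auto)
    then show ?thesis using t by (simp add: abs_divide divide_le_eq)
  qed
  have lim: "(\<lambda>i. (F (X i) p - F 0 p) / X i) \<longlonglongrightarrow> F' 0 p"
    if X: "\<And>i. X i \<noteq> 0" "X \<longlonglongrightarrow> 0" and p: "p \<in> space M" for X :: "nat \<Rightarrow> real" and p
  proof -
    have "((\<lambda>t. (F t p - F 0 p) / (t - 0)) \<longlongrightarrow> F' 0 p) (at 0)"
      using der[of 0 p] \<eta> p by (simp add: has_field_derivative_iff)
    then show ?thesis
      using X unfolding tendsto_at_iff_sequentially by (auto simp: comp_def)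
  qed
  have main: "integrable M (F' 0) \<and> (\<lambda>i. ((\<integral>p. F (X i) p \<partial>M) - (\<integral>p. F 0 p \<partial>M)) / X i) \<longlonglongrightarrow> (\<integral>p. F' 0 p \<partial>M)"
    if X: "\<And>i. X i \<noteq> 0" "X \<longlonglongrightarrow> 0" "\<And>i. \<bar>X i\<bar> < \<eta>" for X :: "nat \<Rightarrow> real"
  proof -
    let ?s = "\<lambda>i p. (F (X i) p - F 0 p) / X i"
    have s: "?s i \<in> borel_measurable M" for i
      using int[of "X i"] int[of 0] X \<eta>
      by (intro borel_measurable_divide borel_measurable_diff borel_measurable_integrable) auto
    have f: "F' 0 \<in> borel_measurable M"
      by (rule borel_measurable_LIMSEQ_real[OF lim[of X] s]) (use X in auto)
    have l: "AE p in M. (\<lambda>i. ?s i p) \<longlonglongrightarrow> F' 0 p"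
      using lim[of X] X by (intro AE_I2) auto
    have b: "AE p in M. norm (?s i p) \<le> w p" for i
      using bound[of "X i"] X by (intro AE_I2) auto
    have dc: "integrable M (F' 0)" "(\<lambda>i. integral\<^sup>L M (?s i)) \<longlonglongrightarrow> integral\<^sup>L M (F' 0)"
      using integrable_dominated_convergence[OF f s w(1) l b]
        integral_dominated_convergence[OF f s w(1) l b] by simp_all
    have eq: "integral\<^sup>L M (?s i) = ((\<integral>p. F (X i) p \<partial>M) - (\<integral>p. F 0 p \<partial>M)) / X i" for i
      using int[of "X i"] int[of 0] X \<eta> by simp
    show ?thesis using dc unfolding eq by (rule conjI)
  qed
  have X0: "(\<lambda>i. \<eta> / 2 * inverse (real (Suc i))) \<longlonglongrightarrow> 0"
    by (rule tendsto_mult_right_zero[OF LIMSEQ_inverse_real_of_nat])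
  have "\<bar>\<eta> / 2 * inverse (real (Suc i))\<bar> < \<eta>" for i
  proof -
    have "\<eta> / 2 * inverse (real (Suc i)) \<le> \<eta> / 2 * 1"
      using \<eta> by (intro mult_left_mono) (auto simp: field_simps)
    then show ?thesis using \<eta> by (simp add: abs_mult)
  qed
  with main[of "\<lambda>i. \<eta> / 2 * inverse (real (Suc i))"] X0 \<eta>
  show "integrable M (F' 0)" by simp
  show "((\<lambda>t. \<integral>p. F t p \<partial>M) has_real_derivative (\<integral>p. F' 0 p \<partial>M)) (at 0)"
    unfolding has_field_derivative_iff tendsto_at_iff_sequentially
  proof (intro allI impI)
    fix X :: "nat \<Rightarrow> real" assume X: "\<forall>i. X i \<in> UNIV - {0}" "X \<longlonglongrightarrow> 0"
    then obtain N where N: "\<And>i. i \<ge> N \<Longrightarrow> \<bar>X i\<bar> < \<eta>"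
      using LIMSEQ_D[OF X(2) \<eta>] by auto
    have "(\<lambda>i. X (i + N)) \<longlonglongrightarrow> 0" using X(2) by (rule LIMSEQ_ignore_initial_segment)
    with main[of "\<lambda>i. X (i + N)"] X N
    have "(\<lambda>i. ((\<integral>p. F (X (i + N)) p \<partial>M) - (\<integral>p. F 0 p \<partial>M)) / X (i + N)) \<longlonglongrightarrow> (\<integral>p. F' 0 p \<partial>M)"
      by simp
    then have "(\<lambda>i. ((\<integral>p. F (X i) p \<partial>M) - (\<integral>p. F 0 p \<partial>M)) / X i) \<longlonglongrightarrow> (\<integral>p. F' 0 p \<partial>M)"
      by (rule LIMSEQ_offset)
    then show "((\<lambda>t. ((\<integral>p. F t p \<partial>M) - (\<integral>p. F 0 p \<partial>M)) / (t - 0)) \<circ> X) \<longlonglongrightarrow> (\<integral>p. F' 0 p \<partial>M)"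
      by (simp add: comp_def)
  qed
qed

section \<open>The divergence theorem for compactly supported fields in Euclidean space\<close>

lemma frechet_derivative_zero_outside:
  assumes "closed C" "\<And>x. x \<notin> C \<Longrightarrow> f x = 0" "x \<notin> C"
  shows "frechet_derivative f (at x) = (\<lambda>_. 0)"
proof -
  have "(f has_derivative (\<lambda>_. 0)) (at x)"
    by (rule has_derivative_transform_within_open[OF has_derivative_const, of "- C"])
      (use assms in auto)
  then show ?thesis by (rule frechet_derivative_at[symmetric])
qed

lemma integrable_continuous_compact_support:
  fixes f :: "'e::euclidean_space \<Rightarrow> real"
  assumes "continuous_on UNIV f" "compact C" "\<And>x. x \<notin> C \<Longrightarrow> f x = 0"
  shows "integrable lborel f"
proof -
  have "indicator C x *\<^sub>R f x = f x" for x using assms(3) by (cases "x \<in> C") auto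
  then have eq: "(\<lambda>x. indicator C x *\<^sub>R f x) = f" by (rule ext)
  from borel_integrable_compact[OF assms(2) continuous_on_subset[OF assms(1) subset_UNIV]]
  show ?thesis unfolding eq .
qed

text \<open>By translation invariance \<open>\<integral>f(x + tv) dx\<close> does not depend on \<open>t\<close>; differentiate at \<open>t = 0\<close>.\<close>

lemma integral_directional_derivative_zero:
  fixes f :: "'e::euclidean_space \<Rightarrow> real"
  assumes f: "Ck_on (Suc 0) UNIV f" and C: "compact C" "\<And>x. x \<notin> C \<Longrightarrow> f x = 0"
  shows "integrable lborel (\<lambda>x. frechet_derivative f (at x) v)"
    and "(\<integral>x. frechet_derivative f (at x) v \<partial>lborel) = 0"
proof -
  let ?D = "\<lambda>x. frechet_derivative f (at x) v"
  have cD: "continuous_on UNIV ?D" using f by simp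
  have cf: "continuous_on UNIV f" by (rule Ck_on_imp_continuous_on[OF f])
  have D0: "?D x = 0" if "x \<notin> C" for x
    using frechet_derivative_zero_outside[OF compact_imp_closed[OF C(1)] C(2) that] by simp
  obtain M where M: "\<And>x. \<bar>?D x\<bar> \<le> M"
  proof -
    have "bounded (?D ` C)"
      by (rule compact_imp_bounded[OF compact_continuous_image[OF continuous_on_subset[OF cD] C(1)]]) simp
    then obtain M where "M > 0" "\<And>x. x \<in> C \<Longrightarrow> \<bar>?D x\<bar> \<le> M"
      unfolding bounded_pos by auto
    then show ?thesis using D0 by (intro that[of M]) (metis abs_zero less_imp_le)
  qed
  \<comment> \<open>contains every point that a translation by \<open>t v\<close> with \<open>\<bar>t\<bar> \<le> 1\<close> moves into the support\<close>
  define C' where "C' = (\<lambda>(y, t). y - t *\<^sub>R v) ` (C \<times> {-1..1})"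
  have "compact C'" unfolding C'_def case_prod_unfold
    by (intro compact_continuous_image compact_Times C continuous_intros compact_Icc)
  then have w: "integrable lborel (\<lambda>x. indicator C' x *\<^sub>R M)"
    by (rule borel_integrable_compact) simp
  have meas: "f \<in> borel_measurable borel" by (rule borel_measurable_continuous_onI[OF cf])
  have intf: "integrable lborel f" by (rule integrable_continuous_compact_support[OF cf C])
  have int: "integrable lborel (\<lambda>x. f (t *\<^sub>R v + x))" for t
    using intf integrable_distr_eq[of "(+) (t *\<^sub>R v)" lborel borel f] meas
    by (simp add: lborel_distr_plus)
  have "integral\<^sup>L (distr lborel borel ((+) (t *\<^sub>R v))) f = integral\<^sup>L lborel (\<lambda>x. f (t *\<^sub>R v + x))" for t
    by (rule integral_distr) (use meas in auto)
  then have const: "(\<integral>x. f (t *\<^sub>R v + x) \<partial>lborel) = integral\<^sup>L lborel f" for t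
    by (simp add: lborel_distr_plus)
  have der: "((\<lambda>t. f (t *\<^sub>R v + x)) has_real_derivative ?D (t *\<^sub>R v + x)) (at t)" for t x
  proof -
    have "((\<lambda>t. t *\<^sub>R v + x) has_derivative (\<lambda>s. s *\<^sub>R v)) (at t)"
      by (auto intro!: derivative_eq_intros)
    from has_derivative_compose[OF this Ck_on_has_derivative[OF f UNIV_I]]
    show ?thesis
      using linear_scale[OF has_derivative_linear[OF Ck_on_has_derivative[OF f UNIV_I]]]
      by (simp add: has_field_derivative_def mult_commute_abs)
  qed
  have bound: "\<bar>?D (t *\<^sub>R v + x)\<bar> \<le> indicator C' x *\<^sub>R M" if t: "\<bar>t\<bar> < 1" for t x
  proof (cases "t *\<^sub>R v + x \<in> C")
    case True
    then have "(t *\<^sub>R v + x) - t *\<^sub>R v \<in> C'" using t unfolding C'_def by (intro image_eqI[of _ _ "(t *\<^sub>R v + x, t)"]) auto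
    then show ?thesis using M by simp
  next
    case False
    moreover have "0 \<le> M" using M[of 0] by linarith
    ultimately show ?thesis using D0 by (simp add: indicator_def)
  qed
  note D = derivative_under_integral[of 1 lborel "\<lambda>t x. f (t *\<^sub>R v + x)" "\<lambda>t x. ?D (t *\<^sub>R v + x)",
      OF zero_less_one int der w bound]
  show "integrable lborel ?D" using D(1) by simp
  have "((\<lambda>t. \<integral>x. f (t *\<^sub>R v + x) \<partial>lborel) has_real_derivative 0) (at 0)"
    unfolding const by simp
  from DERIV_unique[OF D(2) this] show "(\<integral>x. ?D x \<partial>lborel) = 0" by simp
qed

lemma integral_divergence_zero:
  fixes F :: "real ^ 'm \<Rightarrow> real ^ 'm::finite"
  assumes F: "Ck_on (Suc 0) UNIV F" and C: "compact C" "\<And>x. x \<notin> C \<Longrightarrow> F x = 0"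
  shows "integrable lborel (\<lambda>x. \<Sum>k\<in>UNIV. frechet_derivative F (at x) (axis k 1) $ k)"
    and "(\<integral>x. (\<Sum>k\<in>UNIV. frechet_derivative F (at x) (axis k 1) $ k) \<partial>lborel) = 0"
proof -
  have comp: "frechet_derivative F (at x) v $ k = frechet_derivative (\<lambda>x. F x $ k) (at x) v" for x v k
  proof -
    have "((\<lambda>x. F x $ k) has_derivative (\<lambda>v. frechet_derivative F (at x) v $ k)) (at x)"
      by (rule bounded_linear.has_derivative[OF bounded_linear_vec_nth Ck_on_has_derivative[OF F UNIV_I]])
    from fun_cong[OF frechet_derivative_at[OF this], of v] show ?thesis .
  qed
  have Fk: "Ck_on (Suc 0) UNIV (\<lambda>x. F x $ k)" for k
    by (rule Ck_on_compose_linear[OF open_UNIV bounded_linear_vec_nth F])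
  have zero: "F x $ k = 0" if "x \<notin> C" for x k using C(2)[OF that] by simp
  note Z = integral_directional_derivative_zero[OF Fk C(1) zero]
  show "integrable lborel (\<lambda>x. \<Sum>k\<in>UNIV. frechet_derivative F (at x) (axis k 1) $ k)"
    unfolding comp by (intro Bochner_Integration.integrable_sum Z)
  show "(\<integral>x. (\<Sum>k\<in>UNIV. frechet_derivative F (at x) (axis k 1) $ k) \<partial>lborel) = 0"
    unfolding comp by (subst Bochner_Integration.integral_sum) (simp_all add: Z)
qed

section \<open>Integration on a Riemannian manifold\<close>

locale measured_manifold = lc_manifold A g D
  for A :: "('a::{t2_space,second_countable_topology}, 'm::finite) chart set"
    and g :: "('a, 'm) metric" and D :: "('a, 'm) connection" +
  fixes \<mu> :: "'a measure"
  assumes measure: "riemannian_measure A g \<mu>"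
begin

lemma sets_\<mu>: "sets \<mu> = sets borel" and space_\<mu>: "space \<mu> = UNIV"
  using measure sets_eq_imp_space_eq[of \<mu> borel] by (simp_all add: riemannian_measure_def)

lemma emeasure_chart:
  "c \<in> A \<Longrightarrow> S \<in> sets borel \<Longrightarrow> S \<subseteq> chart_dom c \<Longrightarrow>
    emeasure \<mu> S = (\<integral>\<^sup>+ x \<in> chart_map c ` S. ennreal (vol_density c x) \<partial>lborel)"
  using measure by (simp add: riemannian_measure_def vol_density_def)

context
  fixes c assumes c: "c \<in> A"
begin

text \<open>The density and the inverse chart, extended to all of Euclidean space so that they are Borel functions
  there.\<close>

definition "density_ext x = (indicator (img c) x *\<^sub>R vol_density c x :: real)"

lemma density_ext_measurable: "density_ext \<in> borel_measurable borel"
  unfolding density_ext_def[abs_def]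
  using open_img[OF c] smooth_on_imp_continuous_on[OF smooth_vol_density[OF c]]
  by (intro borel_measurable_continuous_on_indicator) auto

lemma density_ext_nonneg: "0 \<le> density_ext x"
  using less_imp_le[OF vol_density_pos[OF c, of x]] by (cases "x \<in> img c") (simp_all add: density_ext_def)

definition "chart_inv_ext x = (if x \<in> img c then chart_inv c x else undefined)"

lemma chart_inv_ext_measurable: "chart_inv_ext \<in> borel_measurable borel"
  unfolding chart_inv_ext_def[abs_def]
  by (rule borel_measurable_continuous_on_if)
    (use open_img[OF c] continuous_on_chart_inv[OF c] in auto)

text \<open>The defining property of the Riemannian measure, as an equality of measures; the transformation
  formula for integrals then follows from the rules for densities and image measures.\<close>

lemma chart_measure:
  "distr (density lborel (\<lambda>x. ennreal (density_ext x))) borel chart_inv_ext =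
   density \<mu> (\<lambda>p. ennreal (indicator (chart_dom c) p))"
proof (rule measure_eqI)
  fix S assume "S \<in> sets (distr (density lborel (\<lambda>x. ennreal (density_ext x))) borel chart_inv_ext)"
  then have S: "S \<in> sets borel" by simp
  let ?D = "chart_dom c"
  have D: "?D \<in> sets borel" using open_dom[OF c] by simp
  have pre: "chart_inv_ext -` S \<in> sets borel" using measurable_sets[OF chart_inv_ext_measurable S] by simp
  have "emeasure (distr (density lborel (\<lambda>x. ennreal (density_ext x))) borel chart_inv_ext) S
     = emeasure (density lborel (\<lambda>x. ennreal (density_ext x))) (chart_inv_ext -` S)"
    using S chart_inv_ext_measurable by (subst emeasure_distr) auto
  also have "\<dots> = (\<integral>\<^sup>+ x. ennreal (density_ext x) * indicator (chart_inv_ext -` S) x \<partial>lborel)"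
    using pre density_ext_measurable by (subst emeasure_density) auto
  also have "\<dots> = (\<integral>\<^sup>+ x. ennreal (vol_density c x) * indicator (chart_map c ` (?D \<inter> S)) x \<partial>lborel)"
  proof (rule nn_integral_cong)
    fix x
    have "x \<in> chart_map c ` (?D \<inter> S) \<longleftrightarrow> x \<in> img c \<and> chart_inv_ext x \<in> S"
      using chart_inv_map[OF c] chart_map_inv[OF c] chart_inv_dom[OF c]
      by (auto simp: chart_inv_ext_def intro!: image_eqI[of x _ "chart_inv c x"])
    then show "ennreal (density_ext x) * indicator (chart_inv_ext -` S) x = ennreal (vol_density c x) * indicator (chart_map c ` (?D \<inter> S)) x"
      by (auto simp: density_ext_def indicator_def)
  qed
  also have "\<dots> = emeasure \<mu> (?D \<inter> S)"
    using emeasure_chart[OF c, of "?D \<inter> S"] S D by simp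
  also have "\<dots> = (\<integral>\<^sup>+ p. indicator (?D \<inter> S) p \<partial>\<mu>)"
    using S D by (intro nn_integral_indicator[symmetric]) (simp add: sets_\<mu>)
  also have "\<dots> = (\<integral>\<^sup>+ p. ennreal (indicator ?D p) * indicator S p \<partial>\<mu>)"
    by (rule nn_integral_cong) (auto simp: indicator_def)
  also have "\<dots> = emeasure (density \<mu> (\<lambda>p. ennreal (indicator ?D p))) S"
    using S D by (subst emeasure_density) (auto simp: sets_\<mu> measurable_cong_sets[OF sets_\<mu> refl])
  finally show "emeasure (distr (density lborel (\<lambda>x. ennreal (density_ext x))) borel chart_inv_ext) S
    = emeasure (density \<mu> (\<lambda>p. ennreal (indicator ?D p))) S" .
qed (simp add: sets_\<mu>)

text \<open>The function \<open>F\<close> is \<open>f\<close> in coordinates times the density.  Measurability of \<open>f\<close> follows from that of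
  \<open>F\<close>, because the density is positive.\<close>

lemma chart_integral:
  fixes f :: "'a \<Rightarrow> real"
  assumes f0: "\<And>p. p \<notin> chart_dom c \<Longrightarrow> f p = 0"
    and F: "\<And>x. x \<in> img c \<Longrightarrow> F x = vol_density c x * f (chart_inv c x)" "\<And>x. x \<notin> img c \<Longrightarrow> F x = 0"
    and int: "integrable lborel F"
  shows "integrable \<mu> f" "integral\<^sup>L \<mu> f = integral\<^sup>L lborel F"
proof -
  let ?D = "chart_dom c"
  have D: "?D \<in> sets borel" using open_dom[OF c] by simp
  have Fm: "F \<in> borel_measurable borel" using borel_measurable_integrable[OF int] by simp
  have "chart_map c \<in> borel_measurable (restrict_space borel ?D)"
    by (rule borel_measurable_continuous_on_restrict[OF continuous_on_chart_map[OF c]])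
  then have "(\<lambda>p. F (chart_map c p) / density_ext (chart_map c p)) \<in> borel_measurable (restrict_space borel ?D)"
    using Fm density_ext_measurable by (intro borel_measurable_divide) (auto intro: measurable_compose)
  then have "(\<lambda>p. if p \<in> ?D then F (chart_map c p) / density_ext (chart_map c p) else 0) \<in> borel_measurable borel"
    using D by (subst measurable_If_restrict_space_iff) auto
  also have "(\<lambda>p. if p \<in> ?D then F (chart_map c p) / density_ext (chart_map c p) else 0) = f"
    using f0 F(1) vol_density_pos[OF c] chart_inv_map[OF c] by (fastforce simp: density_ext_def fun_eq_iff)
  finally have fm: "f \<in> borel_measurable borel" .
  have fm\<mu>: "f \<in> borel_measurable \<mu>" using fm by (simp add: measurable_cong_sets[OF sets_\<mu> refl])
  have ind: "(indicator ?D :: 'a \<Rightarrow> real) \<in> borel_measurable \<mu>"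
    using D by (auto simp: measurable_cong_sets[OF sets_\<mu> refl])
  let ?N = "density \<mu> (\<lambda>p. ennreal (indicator ?D p))"
  let ?L = "density lborel (\<lambda>x. ennreal (density_ext x))"
  have "indicator ?D p *\<^sub>R f p = f p" for p using f0 by (cases "p \<in> ?D") auto
  then have eq1: "(\<lambda>p. indicator ?D p *\<^sub>R f p) = f" by (rule ext)
  have eq2: "(\<lambda>x. density_ext x *\<^sub>R f (chart_inv_ext x)) = F"
    using F by (auto simp: density_ext_def chart_inv_ext_def indicator_def)
  have ci: "chart_inv_ext \<in> measurable ?L borel" 
    by (subst measurable_cong_sets[of _ borel _ borel]) (simp_all add: chart_inv_ext_measurable)
  have fci: "(\<lambda>x. f (chart_inv_ext x)) \<in> borel_measurable lborel"
    using measurable_compose[OF chart_inv_ext_measurable fm] by simp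
  have cd: "density_ext \<in> borel_measurable lborel" using density_ext_measurable by simp
  note densities =
    integrable_density[OF fm\<mu> ind, unfolded eq1] integral_density[OF fm\<mu> ind, unfolded eq1]
    integrable_density[OF fci cd, unfolded eq2] integral_density[OF fci cd, unfolded eq2]
  have nn: "AE p in \<mu>. 0 \<le> (indicator ?D p :: real)" "AE x in lborel. 0 \<le> density_ext x"
    by (simp_all add: density_ext_nonneg)
  have "integrable \<mu> f \<longleftrightarrow> integrable ?N f"
    by (rule densities(1)[OF nn(1), symmetric])
  also have "\<dots> \<longleftrightarrow> integrable ?L (\<lambda>x. f (chart_inv_ext x))"
    unfolding chart_measure[symmetric] by (rule integrable_distr_eq[OF ci fm])
  also have "\<dots> \<longleftrightarrow> integrable lborel F"
    by (rule densities(3)[OF nn(2)])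
  finally show "integrable \<mu> f" using int by simp
  have "integral\<^sup>L \<mu> f = integral\<^sup>L ?N f"
    by (rule densities(2)[OF nn(1), symmetric])
  also have "\<dots> = integral\<^sup>L ?L (\<lambda>x. f (chart_inv_ext x))"
    unfolding chart_measure[symmetric] by (rule integral_distr[OF ci fm])
  also have "\<dots> = integral\<^sup>L lborel F"
    by (rule densities(4)[OF nn(2)])
  finally show "integral\<^sup>L \<mu> f = integral\<^sup>L lborel F" .
qed

end

end

section \<open>Bump functions\<close>

text \<open>The bump functions are only continuously differentiable.  This suffices for the divergence theorem
  and allows the square of a positive part instead of \<open>exp(-1/s)\<close>.\<close>

lemma max_zero_square_has_derivative:
  "((\<lambda>s. (max 0 s)\<^sup>2) has_real_derivative 2 * max 0 s) (at (s::real))"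
proof -
  consider "s > 0" | "s < 0" | "s = 0" by linarith
  then show ?thesis
  proof cases
    case 1
    have "((\<lambda>s. s\<^sup>2) has_real_derivative 2 * s) (at s)" by (auto intro!: derivative_eq_intros)
    then have "((\<lambda>s. (max 0 s)\<^sup>2) has_real_derivative 2 * s) (at s)"
      by (rule has_field_derivative_transform_within_open[of _ _ _ "{0<..}"]) (use 1 in auto)
    then show ?thesis using 1 by simp
  next
    case 2
    have "((\<lambda>s. 0) has_real_derivative 0) (at s)" by simp
    then have "((\<lambda>s. (max 0 s)\<^sup>2) has_real_derivative 0) (at s)"
      by (rule has_field_derivative_transform_within_open[of _ _ _ "{..<0}"]) (use 2 in auto)
    then show ?thesis using 2 by simp
  next
    case 3
    have "((\<lambda>h. (max 0 h)\<^sup>2 / h) \<longlongrightarrow> 0) (at (0::real))"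
    proof (rule Lim_null_comparison)
      show "\<forall>\<^sub>F h in at 0. norm ((max 0 h)\<^sup>2 / h) \<le> \<bar>h::real\<bar>"
        by (rule always_eventually) (auto simp: max_def power2_eq_square)
      show "((\<lambda>h::real. \<bar>h\<bar>) \<longlongrightarrow> 0) (at 0)" by (rule tendsto_rabs_zero[OF tendsto_ident_at])
    qed
    then show ?thesis using 3 by (simp add: has_field_derivative_iff)
  qed
qed

lemma Ck_on_bump:
  fixes a :: "'e::euclidean_space"
  shows "Ck_on (Suc 0) UNIV (\<lambda>y. (max 0 (r\<^sup>2 - (y - a) \<bullet> (y - a)))\<^sup>2)"
proof (rule Ck_on_compose[where f = "\<lambda>s. (max 0 s)\<^sup>2" and T = UNIV])
  show "Ck_on (Suc 0) UNIV (\<lambda>s::real. (max 0 s)\<^sup>2)"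
  proof (rule Ck_on_SucI)
    show "((\<lambda>s. (max 0 s)\<^sup>2) has_derivative (\<lambda>h. 2 * max 0 s * h)) (at s)" for s :: real
      using max_zero_square_has_derivative[of s] by (simp add: has_field_derivative_def)
  qed (auto intro!: continuous_intros)
  have id: "smooth_on UNIV (\<lambda>y. y - a)"
    by (intro smooth_on_diff smooth_on_const smooth_on_linear bounded_linear_ident open_UNIV)
  have "smooth_on UNIV (\<lambda>y. r\<^sup>2 - (y - a) \<bullet> (y - a))"
    by (intro smooth_on_diff smooth_on_const open_UNIV)
      (use Ck_on_bilinear[OF bounded_bilinear_inner open_UNIV smooth_onD[OF id] smooth_onD[OF id]]
        in \<open>simp add: smooth_on_def\<close>)
  then show "Ck_on (Suc 0) UNIV (\<lambda>y. r\<^sup>2 - (y - a) \<bullet> (y - a))" by (rule smooth_onD)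
qed auto

context smooth_manifold
begin

abbreviation "ccenter p \<equiv> chart_map (chart_at A p) p"

text \<open>Finitely many of the open coordinate balls \<open>nball p\<close> cover a compact set.  The function \<open>bump p\<close> is
  positive on such a ball and vanishes outside its compact closure \<open>ncball p\<close> in the chart.\<close>

definition "cradius p = (SOME r. r > 0 \<and> cball (ccenter p) r \<subseteq> img (chart_at A p))"

definition "nball p = chart_inv (chart_at A p) ` ball (ccenter p) (cradius p)"
definition "ncball p = chart_inv (chart_at A p) ` cball (ccenter p) (cradius p)"

definition "bump p q = (if q \<in> chart_dom (chart_at A p)
  then (max 0 ((cradius p)\<^sup>2 - (chart_map (chart_at A p) q - ccenter p) \<bullet> (chart_map (chart_at A p) q - ccenter p)))\<^sup>2
  else (0::real))"

lemma cradius: "cradius p > 0" "cball (ccenter p) (cradius p) \<subseteq> img (chart_at A p)"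
proof -
  have "\<exists>r>0. cball (ccenter p) r \<subseteq> img (chart_at A p)"
    using open_contains_cball[of "img (chart_at A p)"] open_img[OF chart_at(1)] chart_at(2) by blast
  from someI_ex[OF this] show "cradius p > 0" "cball (ccenter p) (cradius p) \<subseteq> img (chart_at A p)"
    unfolding cradius_def by auto
qed

lemma ball_img: "ball (ccenter p) (cradius p) \<subseteq> img (chart_at A p)"
  using cradius(2)[of p] ball_subset_cball by blast

lemma open_nball: "open (nball p)"
  unfolding nball_def by (rule open_chart_inv_image[OF chart_at(1) open_ball ball_img])

lemma in_nball: "p \<in> nball p"
  unfolding nball_def using cradius(1)[of p] chart_inv_map[OF chart_at(1) chart_at(2), of p]
  by (intro image_eqI[of _ _ "ccenter p"]) auto

lemma nball_ncball: "nball p \<subseteq> ncball p" and ncball_dom: "ncball p \<subseteq> chart_dom (chart_at A p)"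
  unfolding nball_def ncball_def using chart_inv_image_subset[OF chart_at(1) cradius(2)] by auto

lemma compact_ncball: "compact (ncball p)"
  unfolding ncball_def
  by (intro compact_continuous_image continuous_on_subset[OF continuous_on_chart_inv[OF chart_at(1)] cradius(2)]
      compact_cball)

lemma closed_ncball: "closed (ncball p)"
  by (rule compact_imp_closed[OF compact_ncball])

lemma chart_ncball: "chart_map (chart_at A p) ` ncball p = cball (ccenter p) (cradius p)"
  unfolding ncball_def by (rule chart_image_inv_image[OF chart_at(1) cradius(2)])

lemma bump_nonneg: "bump p q \<ge> 0" by (simp add: bump_def)

lemma bump_pos:
  assumes "q \<in> nball p" shows "bump p q > 0"
proof -
  let ?c = "chart_at A p"
  obtain y where y: "y \<in> ball (ccenter p) (cradius p)" "q = chart_inv ?c y"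
    using assms by (auto simp: nball_def)
  have yi: "y \<in> img ?c" using y ball_img by blast
  have "(y - ccenter p) \<bullet> (y - ccenter p) = (dist (ccenter p) y)\<^sup>2"
    by (simp add: dist_norm norm_minus_commute dot_square_norm)
  also have "\<dots> < (cradius p)\<^sup>2" using y by (intro power_strict_mono) auto
  finally show ?thesis
    using y chart_inv_dom[OF chart_at(1) yi] chart_map_inv[OF chart_at(1) yi] by (simp add: bump_def)
qed

lemma bump_zero:
  assumes "q \<notin> ncball p" shows "bump p q = 0"
proof (cases "q \<in> chart_dom (chart_at A p)")
  case True
  let ?c = "chart_at A p"
  have "chart_map ?c q \<notin> cball (ccenter p) (cradius p)"
  proof
    assume "chart_map ?c q \<in> cball (ccenter p) (cradius p)"
    from imageI[OF this, of "chart_inv ?c"] have "q \<in> ncball p"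
      unfolding ncball_def chart_inv_map[OF chart_at(1) True] .
    with assms show False by contradiction
  qed
  then have "(cradius p)\<^sup>2 \<le> (dist (ccenter p) (chart_map ?c q))\<^sup>2"
    using cradius(1)[of p] by (intro power_mono) auto
  also have "\<dots> = (chart_map ?c q - ccenter p) \<bullet> (chart_map ?c q - ccenter p)"
    by (simp add: dist_norm norm_minus_commute dot_square_norm)
  finally show ?thesis by (simp add: bump_def)
qed (simp add: bump_def)

text \<open>Outside the domain of the chart around \<open>p\<close> the bump function vanishes near every point, because the
  compact set \<open>ncball p\<close> is closed.\<close>

lemma Ck_on_chart_bump:
  assumes c: "c \<in> A" shows "Ck_on (Suc 0) (img c) (\<lambda>x. bump p (chart_inv c x))"
proof (rule Ck_on_locally)
  fix x assume x: "x \<in> img c"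
  let ?b = "chart_at A p" and ?q = "chart_inv c x"
  have q: "?q \<in> chart_dom c" "chart_map c ?q = x" using chart_inv_dom[OF c x] chart_map_inv[OF c x] by auto
  show "\<exists>T. open T \<and> x \<in> T \<and> Ck_on (Suc 0) T (\<lambda>x. bump p (chart_inv c x))"
  proof (cases "?q \<in> chart_dom ?b")
    case True
    let ?T = "chart_map c ` (chart_dom c \<inter> chart_dom ?b)"
    have T: "open ?T" by (rule open_overlap[OF c chart_at(1)])
    have "x \<in> ?T" using True q by (intro image_eqI[of _ _ ?q]) auto
    moreover have "Ck_on (Suc 0) ?T (\<lambda>x. bump p (chart_inv c x))"
    proof (rule Ck_on_cong[OF T])
      show "Ck_on (Suc 0) ?T (\<lambda>x. (max 0 ((cradius p)\<^sup>2 -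
        ((chart_map ?b \<circ> chart_inv c) x - ccenter p) \<bullet> ((chart_map ?b \<circ> chart_inv c) x - ccenter p)))\<^sup>2)"
        by (rule Ck_on_compose[OF T open_UNIV _ Ck_on_bump smooth_onD[OF smooth_transition[OF c chart_at(1)]]]) simp
    qed (auto simp: bump_def chart_inv_map[OF c])
    ultimately show ?thesis using T by blast
  next
    case False
    let ?T = "chart_map c ` (chart_dom c - ncball p)"
    have T: "open ?T" by (rule open_chart_image[OF c open_Diff[OF open_dom[OF c] closed_ncball]]) auto
    have "x \<in> ?T" using False q ncball_dom by (intro image_eqI[of _ _ ?q]) auto
    moreover have "Ck_on (Suc 0) ?T (\<lambda>x. bump p (chart_inv c x))"
      by (rule Ck_on_cong[OF T _ Ck_on_const[OF T, where c = 0]]) (auto simp: chart_inv_map[OF c] bump_zero)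
    ultimately show ?thesis using T by blast
  qed
qed

lemma compact_chart_cover:
  assumes "compact K"
  obtains P where "finite P" "K \<subseteq> (\<Union>p\<in>P. nball p)"
proof -
  have "K \<subseteq> (\<Union>p\<in>K. nball p)" using in_nball by blast
  then show ?thesis using compactE_image[OF assms, of K nball] open_nball that by metis
qed

end

section \<open>The divergence theorem on a Riemannian manifold\<close>

context measured_manifold
begin

lemma emeasure_ncball_finite: "emeasure \<mu> (ncball p) < \<infinity>"
proof -
  let ?c = "chart_at A p" and ?B = "cball (ccenter p) (cradius p)"
  have "compact (vol_density ?c ` ?B)"
    by (intro compact_continuous_image compact_cball
        continuous_on_subset[OF smooth_on_imp_continuous_on[OF smooth_vol_density[OF chart_at(1)]] cradius(2)])
  then obtain m where m: "\<And>x. x \<in> ?B \<Longrightarrow> norm (vol_density ?c x) \<le> m"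
    using compact_imp_bounded bounded_iff by (metis image_eqI)
  have "emeasure \<mu> (ncball p) = (\<integral>\<^sup>+ x. ennreal (vol_density ?c x) * indicator ?B x \<partial>lborel)"
    using emeasure_chart[OF chart_at(1) _ ncball_dom, of p] closed_ncball[of p] by (simp add: chart_ncball)
  also have "\<dots> \<le> (\<integral>\<^sup>+ x. ennreal m * indicator ?B x \<partial>lborel)"
  proof (rule nn_integral_mono)
    fix x
    have "ennreal (vol_density ?c x) \<le> ennreal m" if "x \<in> ?B"
      by (rule ennreal_leI[OF order_trans[OF abs_ge_self m[OF that, unfolded real_norm_def]]])
    then show "ennreal (vol_density ?c x) * indicator ?B x \<le> ennreal m * indicator ?B x"
      by (cases "x \<in> ?B") simp_all
  qed
  also have "\<dots> = ennreal m * emeasure lborel ?B"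
    by (rule nn_integral_cmult_indicator) simp
  also have "\<dots> < \<infinity>" using emeasure_lborel_cball_finite[of "ccenter p" "cradius p"]
    by (simp add: ennreal_mult_less_top)
  finally show ?thesis .
qed

lemma emeasure_compact_finite: "compact K \<Longrightarrow> emeasure \<mu> K < \<infinity>"
proof -
  assume "compact K"
  then obtain P where P: "finite P" "K \<subseteq> (\<Union>p\<in>P. nball p)" by (rule compact_chart_cover)
  have sets: "ncball p \<in> sets \<mu>" for p using closed_ncball by (simp add: sets_\<mu>)
  have "emeasure \<mu> K \<le> emeasure \<mu> (\<Union>p\<in>P. ncball p)"
    using P(1) sets
    by (intro emeasure_mono order_trans[OF P(2) UN_mono[OF subset_refl nball_ncball]] sets.finite_UN)
  also have "\<dots> \<le> (\<Sum>p\<in>P. emeasure \<mu> (ncball p))"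
    using P sets by (intro emeasure_subadditive_finite) auto
  also have "\<dots> < \<infinity>" using P emeasure_ncball_finite by simp
  finally show ?thesis .
qed

text \<open>Here \<open>Q\<close> is the divergence of \<open>X\<close>, characterized by its coordinate expression in all charts.
  Normalized bump functions \<open>\<phi>\<^sub>p\<close> with sum 1 near \<open>K\<close> split it into the divergences
  \<open>\<phi>\<^sub>p Q + d\<phi>\<^sub>p(X)\<close> of fields supported in one chart each, because \<open>\<Sum>\<^sub>p d\<phi>\<^sub>p = 0\<close> near \<open>K\<close>.\<close>

theorem divergence_theorem:
  assumes K: "compact K" and X: "\<And>c. c \<in> A \<Longrightarrow> smooth_on (img c) (field_coord c X)"
    and X0: "\<And>q. q \<notin> K \<Longrightarrow> X q = 0"
    and Q: "\<And>c q. c \<in> A \<Longrightarrow> q \<in> chart_dom c \<Longrightarrow>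
      (\<Sum>k\<in>UNIV. frechet_derivative (\<lambda>y. vol_density c y *\<^sub>R field_coord c X y) (at (chart_map c q)) (axis k 1) $ k)
      = vol_density c (chart_map c q) * Q q"
  shows "integrable \<mu> Q" "integral\<^sup>L \<mu> Q = 0"
proof -
  have clK: "closed K" using compact_imp_closed[OF K] .
  obtain P where P: "finite P" "K \<subseteq> (\<Union>p\<in>P. nball p)" using K by (rule compact_chart_cover)
  define O\<^sub>P where "O\<^sub>P = (\<Union>p\<in>P. nball p)"
  have O\<^sub>P: "open O\<^sub>P" "K \<subseteq> O\<^sub>P" using P open_nball by (auto simp: O\<^sub>P_def)
  define S where "S q = (\<Sum>p\<in>P. bump p q)" for q
  define \<phi> where "\<phi> p q = bump p q * inverse (S q)" for p q
  have S: "S q > 0" if q: "q \<in> O\<^sub>P" for q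
  proof -
    obtain p where p: "p \<in> P" "q \<in> nball p" using q by (auto simp: O\<^sub>P_def)
    then show ?thesis unfolding S_def
      using P(1) bump_pos bump_nonneg by (intro sum_pos2[of _ p]) auto
  qed
  have V: "open (chart_map c ` (chart_dom c \<inter> O\<^sub>P))" if "c \<in> A" for c
    using that O\<^sub>P by (intro open_chart_image open_Int open_dom) auto
  have \<phi>C: "Ck_on (Suc 0) (chart_map c ` (chart_dom c \<inter> O\<^sub>P)) (\<lambda>x. \<phi> p (chart_inv c x))" if c: "c \<in> A" for c p
  proof -
    let ?V = "chart_map c ` (chart_dom c \<inter> O\<^sub>P)"
    have b: "Ck_on (Suc 0) ?V (\<lambda>x. bump p (chart_inv c x))" for p
      by (rule Ck_on_subset[OF Ck_on_chart_bump[OF c]]) auto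
    have "Ck_on (Suc 0) ?V (\<lambda>x. S (chart_inv c x))"
      unfolding S_def by (rule Ck_on_sum[OF V[OF c] b])
    moreover have "S (chart_inv c x) \<in> - {0}" if "x \<in> ?V" for x
      using that S[of "chart_inv c x"] chart_inv_map[OF c] by auto
    ultimately have "Ck_on (Suc 0) ?V (\<lambda>x. inverse (S (chart_inv c x)))"
      by (intro Ck_on_compose[OF V[OF c] open_Compl[OF closed_singleton] _ Ck_on_inverse_real])
    from Ck_on_mult[OF V[OF c] b this] show ?thesis unfolding \<phi>_def .
  qed
  have \<phi>0: "\<phi> p q = 0" if "q \<notin> ncball p" for p q using bump_zero[OF that] by (simp add: \<phi>_def)
  have xV: "chart_map c q \<in> chart_map c ` (chart_dom c \<inter> O\<^sub>P)" if "q \<in> chart_dom c" "q \<in> K" for c q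
    using that O\<^sub>P by auto
  have Q0: "Q q = 0" if q: "q \<notin> K" for q
  proof -
    let ?c = "chart_at A q"
    let ?T = "chart_map ?c ` (chart_dom ?c - K)"
    have T: "open ?T" "chart_map ?c q \<in> ?T"
      using open_chart_image[OF chart_at(1) open_Diff[OF open_dom[OF chart_at(1)] clK]] q chart_at(2) by auto
    have "((\<lambda>y. vol_density ?c y *\<^sub>R field_coord ?c X y) has_derivative (\<lambda>_. 0)) (at (chart_map ?c q))"
      by (rule has_derivative_transform_within_open[OF has_derivative_const[of 0] T])
        (auto simp: chart_inv_map[OF chart_at(1)] X0 linear_0[OF linear_tangent_coord[OF chart_at(1)]])
    from frechet_derivative_at[OF this, symmetric]
    show ?thesis
      using Q[OF chart_at(1) chart_at(2), of q] vol_density_pos[OF chart_at(1), of "chart_map ?c q" q] chart_at(2)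
      by (simp add: less_le)
  qed
  define f where "f p q = (if q \<in> K then \<phi> p q * Q q + deriv_at A (\<phi> p) q (X q) else 0)" for p q
  have piece: "integrable \<mu> (f p) \<and> integral\<^sup>L \<mu> (f p) = 0" for p
  proof -
    let ?c = "chart_at A p"
    note c = chart_at(1)[of p]
    let ?V = "chart_map ?c ` (chart_dom ?c \<inter> O\<^sub>P)"
    let ?W = "\<lambda>x. vol_density ?c x *\<^sub>R field_coord ?c X x"
    \<comment> \<open>\<open>\<phi>\<^sub>p X\<close> times the density in coordinates, extended by zero to a field on Euclidean space\<close>
    define Z where "Z x = (if x \<in> img ?c then \<phi> p (chart_inv ?c x) *\<^sub>R ?W x else 0)" for x
    define C where "C = chart_map ?c ` (ncball p \<inter> K)"
    have C: "compact C" unfolding C_def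
      by (intro compact_continuous_image continuous_on_subset[OF continuous_on_chart_map[OF c]]
          compact_Int_closed compact_ncball clK) (use ncball_dom in auto)
    have Cin: "x \<in> C \<longleftrightarrow> x \<in> img ?c \<and> chart_inv ?c x \<in> ncball p \<and> chart_inv ?c x \<in> K" for x
      unfolding C_def using ncball_dom[of p] chart_inv_map[OF c] chart_map_inv[OF c]
      by (auto simp: image_iff subset_iff)
    have Z0: "Z x = 0" if "x \<notin> C" for x
      using that X0[of "chart_inv ?c x"] linear_0[OF linear_tangent_coord[OF c chart_inv_dom[OF c, of x]]]
        \<phi>0[of "chart_inv ?c x" p] by (auto simp: Z_def Cin)
    have W: "smooth_on (img ?c) ?W"
      by (intro smooth_on_scaleR open_img c smooth_vol_density X)
    have ZV: "Z x = \<phi> p (chart_inv ?c x) *\<^sub>R ?W x" if "x \<in> ?V" for x using that by (auto simp: Z_def)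
    have CV: "C \<subseteq> ?V" using ncball_dom O\<^sub>P by (auto simp: C_def)
    have ZC: "Ck_on (Suc 0) UNIV Z"
    proof (rule Ck_on_locally)
      fix x
      show "\<exists>T. open T \<and> x \<in> T \<and> Ck_on (Suc 0) T Z"
      proof (cases "x \<in> C")
        case True
        have "Ck_on (Suc 0) ?V Z"
          by (rule Ck_on_cong[OF V[OF c] ZV[symmetric]
                Ck_on_scaleR[OF V[OF c] \<phi>C[OF c] Ck_on_subset[OF smooth_onD[OF W]]]]) auto
        then show ?thesis using V[OF c] True CV by blast
      next
        case False
        have "open (- C)" using C compact_imp_closed open_Compl by blast
        moreover have "Ck_on (Suc 0) (- C) Z"
          by (rule Ck_on_cong[OF \<open>open (- C)\<close> _ Ck_on_const[OF \<open>open (- C)\<close>, where c = 0]]) (simp add: Z0)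
        ultimately show ?thesis using False by blast
      qed
    qed
    define DZ where "DZ x = (\<Sum>k\<in>UNIV. frechet_derivative Z (at x) (axis k 1) $ k)" for x
    have DZ0: "DZ x = 0" if "x \<notin> C" for x
      using frechet_derivative_zero_outside[OF compact_imp_closed[OF C] Z0 that] by (simp add: DZ_def)
    have DZ: "DZ x = vol_density ?c x * f p (chart_inv ?c x)" if x: "x \<in> img ?c" for x
    proof (cases "chart_inv ?c x \<in> K")
      case False
      then show ?thesis using DZ0[of x] by (simp add: Cin f_def)
    next
      case True
      let ?q = "chart_inv ?c x" and ?\<phi> = "\<lambda>x. \<phi> p (chart_inv ?c x)"
      have q: "?q \<in> chart_dom ?c" "chart_map ?c ?q = x" using chart_inv_dom[OF c x] chart_map_inv[OF c x] by auto
      have xV: "x \<in> ?V" using xV[OF q(1) True] q(2) by simp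
      let ?\<phi>' = "frechet_derivative ?\<phi> (at x)" and ?W' = "frechet_derivative ?W (at x)"
      have \<phi>': "(?\<phi> has_derivative ?\<phi>') (at x)" by (rule Ck_on_has_derivative[OF \<phi>C[OF c] xV])
      have W': "(?W has_derivative ?W') (at x)" by (rule smooth_on_has_derivative[OF W x])
      have "(Z has_derivative (\<lambda>v. ?\<phi> x *\<^sub>R ?W' v + ?\<phi>' v *\<^sub>R ?W x)) (at x)"
        by (rule has_derivative_transform_within_open[OF has_derivative_scaleR[OF \<phi>' W'] V[OF c] xV ZV[symmetric]])
      from frechet_derivative_at[OF this, symmetric]
      have "DZ x = ?\<phi> x * (\<Sum>k\<in>UNIV. ?W' (axis k 1) $ k) + (\<Sum>k\<in>UNIV. ?W x $ k * ?\<phi>' (axis k 1))"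
        by (simp add: DZ_def sum.distrib sum_distrib_left mult_ac)
      also have "(\<Sum>k\<in>UNIV. ?W' (axis k 1) $ k) = vol_density ?c x * Q ?q"
        using Q[OF c q(1)] by (simp add: q(2))
      also have "(\<Sum>k\<in>UNIV. ?W x $ k * ?\<phi>' (axis k 1)) = ?\<phi>' (?W x)"
        using linear_sum[OF has_derivative_linear[OF \<phi>'], of "\<lambda>k. ?W x $ k *\<^sub>R axis k 1" UNIV]
          linear_scale[OF has_derivative_linear[OF \<phi>']] axis_expansion[of "?W x"] by simp
      also have "\<dots> = vol_density ?c x * ?\<phi>' (field_coord ?c X x)"
        by (simp add: linear_scale[OF has_derivative_linear[OF \<phi>']])
      also have "?\<phi>' (field_coord ?c X x) = deriv_at A (\<phi> p) ?q (X ?q)"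
        using deriv_at_chart[OF c q(1), of "\<phi> p" "X ?q"] differentiableI[OF \<phi>'] by (simp add: q(2) comp_def)
      finally show ?thesis using True by (simp add: f_def algebra_simps)
    qed
    have f0: "f p q = 0" if q: "q \<notin> chart_dom ?c" for q
    proof -
      have qn: "q \<notin> ncball p" using q ncball_dom by blast
      let ?b = "chart_at A q"
      let ?T = "chart_map ?b ` (chart_dom ?b - ncball p)"
      have T: "open ?T" "chart_map ?b q \<in> ?T"
        using open_chart_image[OF chart_at(1) open_Diff[OF open_dom[OF chart_at(1)] closed_ncball]] qn chart_at(2) by auto
      have "((\<phi> p \<circ> chart_inv ?b) has_derivative (\<lambda>_. 0)) (at (chart_map ?b q))"
        by (rule has_derivative_transform_within_open[OF has_derivative_const[of 0] T])
          (auto simp: chart_inv_map[OF chart_at(1)] \<phi>0)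
      from frechet_derivative_at[OF this, symmetric]
      show ?thesis by (simp add: f_def deriv_at_def \<phi>0[OF qn])
    qed
    have DZout: "DZ x = 0" if "x \<notin> img ?c" for x using that by (intro DZ0) (simp add: Cin)
    note E = integral_divergence_zero[OF ZC C Z0, folded DZ_def]
    show ?thesis using chart_integral[OF c f0 DZ DZout E(1)] E(2) by simp
  qed
  have Qsum: "Q q = (\<Sum>p\<in>P. f p q)" for q
  proof (cases "q \<in> K")
    case False
    then show ?thesis by (simp add: Q0 f_def)
  next
    case True
    let ?c = "chart_at A q" and ?x = "ccenter q"
    let ?V = "chart_map ?c ` (chart_dom ?c \<inter> O\<^sub>P)"
    have xV: "?x \<in> ?V" using xV[OF chart_at(2) True] .
    have one: "(\<Sum>p\<in>P. \<phi> p r) = 1" if "r \<in> O\<^sub>P" for r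
      using S[OF that] unfolding \<phi>_def sum_distrib_right[symmetric] S_def[symmetric] by simp
    have "((\<lambda>x. \<Sum>p\<in>P. \<phi> p (chart_inv ?c x)) has_derivative
       (\<lambda>v. \<Sum>p\<in>P. frechet_derivative (\<lambda>x. \<phi> p (chart_inv ?c x)) (at ?x) v)) (at ?x)"
      by (intro has_derivative_sum Ck_on_has_derivative[OF \<phi>C[OF chart_at(1)] xV])
    moreover have "((\<lambda>x. \<Sum>p\<in>P. \<phi> p (chart_inv ?c x)) has_derivative (\<lambda>_. 0)) (at ?x)"
      by (rule has_derivative_transform_within_open[OF has_derivative_const[of 1] V[OF chart_at(1)] xV])
        (auto simp: chart_inv_map[OF chart_at(1)] one)
    ultimately have "(\<lambda>v. \<Sum>p\<in>P. frechet_derivative (\<lambda>x. \<phi> p (chart_inv ?c x)) (at ?x) v) = (\<lambda>_. 0)"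
      by (rule has_derivative_unique)
    from fun_cong[OF this, of "X q"]
    have "(\<Sum>p\<in>P. deriv_at A (\<phi> p) q (X q)) = 0" by (simp add: deriv_at_def comp_def)
    moreover have "(\<Sum>p\<in>P. \<phi> p q * Q q) = Q q"
      using one[of q] True O\<^sub>P by (simp add: sum_distrib_right[symmetric] subset_iff)
    ultimately show ?thesis using True by (simp add: f_def sum.distrib)
  qed
  have Qeq: "Q = (\<lambda>q. \<Sum>p\<in>P. f p q)" using Qsum by (rule ext)
  show "integrable \<mu> Q" unfolding Qeq using piece by (intro Bochner_Integration.integrable_sum) blast
  show "integral\<^sup>L \<mu> Q = 0" unfolding Qeq using piece by (subst Bochner_Integration.integral_sum) auto
qed

end

section \<open>The first variation formula\<close>

context energy_variation
begin

definition energy_density_deriv :: "real \<Rightarrow> 'a \<Rightarrow> real" where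
  "energy_density_deriv t q = deriv (\<lambda>t. d3_norm2 A g B h (U t) q) t"

text \<open>What dominated convergence requires of the energy density on a subset of \<open>M\<close>.\<close>

definition energy_bounded_on :: "'a set \<Rightarrow> real \<Rightarrow> real \<Rightarrow> bool" where
  "energy_bounded_on N \<eta> C \<longleftrightarrow> (\<forall>t. \<bar>t\<bar> < \<eta> \<longrightarrow>
     continuous_on N (d3_norm2 A g B h (U t)) \<and> (\<forall>q\<in>N.
      ((\<lambda>t. d3_norm2 A g B h (U t) q) has_real_derivative energy_density_deriv t q) (at t) \<and>
      \<bar>energy_density_deriv t q\<bar> \<le> C \<and> \<bar>d3_norm2 A g B h (U t) q\<bar> \<le> C))"

text \<open>Continuity of \<open>(t, p) \<mapsto> u\<^sub>t(p)\<close> at \<open>(0, p)\<close> yields the time interval and the neighbourhood.\<close>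

lemma variation_chart_exists:
  assumes c: "c \<in> A" "p \<in> chart_dom c" and d: "d \<in> B" "u p \<in> chart_dom d"
    and W\<^sub>0: "p \<in> W\<^sub>0" "local_orthonormal_frame A g W\<^sub>0 e"
  obtains \<epsilon> W where "p \<in> W" "variation_chart A g DM B h DN u \<delta> U c d \<epsilon> W e"
proof -
  let ?S = "({-\<delta><..<\<delta>} \<times> UNIV) \<inter> (\<lambda>(t, p). U t p) -` chart_dom d"
  have "open ?S"
    using variation N.open_dom[OF d(1)]
    by (intro continuous_open_preimage) (auto simp: smooth_variation_def intro: open_Times)
  moreover have "(0, p) \<in> ?S" using \<delta> d by (simp add: U_0)
  ultimately obtain T N where TN: "open T" "open N" "(0, p) \<in> T \<times> N" "T \<times> N \<subseteq> ?S"
    by (rule open_prod_elim)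
  then obtain r where r: "r > 0" "ball 0 r \<subseteq> T" using openE by blast
  let ?W = "N \<inter> chart_dom c \<inter> W\<^sub>0"
  have "smooth_field_on A ?W (e i)" for i
    by (rule M.smooth_field_on_subset[of W\<^sub>0]) (use W\<^sub>0 in \<open>auto simp: local_orthonormal_frame_def\<close>)
  moreover have "open ?W"
    using W\<^sub>0(2) TN(2) M.open_dom[OF c(1)] by (auto simp: local_orthonormal_frame_def)
  ultimately have fr: "local_orthonormal_frame A g ?W e"
    using W\<^sub>0(2) by (simp add: local_orthonormal_frame_def)
  have dom: "U t q \<in> chart_dom d" if "t \<in> {-min r \<delta><..<min r \<delta>}" "q \<in> ?W" for t q
  proof -
    have "t \<in> ball 0 r" using that(1) by auto
    then have "(t, q) \<in> T \<times> N" using that(2) r(2) by blast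
    then have "(t, q) \<in> ?S" using TN(4) by blast
    then show ?thesis by simp
  qed
  have vc: "variation_chart A g DM B h DN u \<delta> U c d (min r \<delta>) ?W e"
  proof (rule variation_chart.intro[OF energy_variation_axioms variation_chart_axioms.intro[OF c(1) d(1)]])
    show "0 < min r \<delta>" "min r \<delta> \<le> \<delta>" using r(1) \<delta> by simp_all
    show "?W \<subseteq> chart_dom c" by blast
  qed (rule fr dom; assumption)+
  have "p \<in> ?W" using TN(3) c(2) W\<^sub>0(1) by simp
  then show ?thesis using vc by (rule that)
qed

end

context variation_chart
begin

lemma energy_density_has_derivative:
  assumes t: "t \<in> I" and q: "q \<in> W"
  shows "((\<lambda>t. d3_norm2 A g B h (U t) q) has_real_derivative energy_density_deriv t q) (at t)"
    and "energy_density_deriv t q = frechet_derivative \<Phi> (at (t, chart_map c q)) (1, 0)"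
proof -
  have z: "(t, chart_map c q) \<in> cyl" using t q by auto
  have lin: "(\<lambda>s. frechet_derivative \<Phi> (at (t, chart_map c q)) (s, 0)) =
    (\<lambda>s. frechet_derivative \<Phi> (at (t, chart_map c q)) (1, 0) * s)"
  proof
    fix s
    show "frechet_derivative \<Phi> (at (t, chart_map c q)) (s, 0) = frechet_derivative \<Phi> (at (t, chart_map c q)) (1, 0) * s"
    using linear_scale[OF smooth_on_linear_derivative[OF smooth_\<Phi> z], of s "(1, 0)"] by (simp add: mult.commute)
  qed
  have "((\<lambda>t. \<Phi> (t, chart_map c q)) has_real_derivative frechet_derivative \<Phi> (at (t, chart_map c q)) (1, 0)) (at t)"
    using partial_t[OF smooth_\<Phi> z] unfolding has_field_derivative_def lin .
  then have D: "((\<lambda>t. d3_norm2 A g B h (U t) q) has_real_derivative frechet_derivative \<Phi> (at (t, chart_map c q)) (1, 0)) (at t)"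
    by (rule has_field_derivative_transform_within_open[OF _ open_greaterThanLessThan t])
      (rule d3_norm2_coord[OF _ q, symmetric])
  show eq: "energy_density_deriv t q = frechet_derivative \<Phi> (at (t, chart_map c q)) (1, 0)"
    unfolding energy_density_deriv_def by (rule DERIV_imp_deriv[OF D])
  show "((\<lambda>t. d3_norm2 A g B h (U t) q) has_real_derivative energy_density_deriv t q) (at t)"
    using D unfolding eq .
qed

lemma smooth_flux_chart: "smooth_on R (M.field_coord c flux)"
proof (rule smooth_on_cong[OF open_R])
  show "smooth_on R (\<lambda>x. \<Sum>i\<in>UNIV. flux_comp i (0, x) *\<^sub>R E i x)"
    by (intro smooth_on_sum smooth_on_scaleR open_R smooth_at_0 smooth_flux_comp smooth_E)
  show "(\<Sum>i\<in>UNIV. flux_comp i (0, x) *\<^sub>R E i x) = M.field_coord c flux x" if "x \<in> R" for x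
    using flux_coord[OF inv_W(1)[OF that]] by (simp add: inv_W(3)[OF that])
qed

text \<open>The density and its derivative are continuous functions of \<open>(t, x)\<close>, hence bounded on a compact
  box.\<close>

lemma energy_locally_bounded_chart:
  assumes p: "p \<in> W"
  shows "\<exists>N \<eta> C. open N \<and> p \<in> N \<and> \<eta> > 0 \<and> energy_bounded_on N \<eta> C"
proof -
  let ?x = "chart_map c p"
  have "?x \<in> R" using p by simp
  then obtain r where r: "r > 0" "cball ?x r \<subseteq> R" using open_R open_contains_cball by blast
  let ?T = "{-\<epsilon>/2..\<epsilon>/2} \<times> cball ?x r"
  have T: "compact ?T" "?T \<subseteq> cyl" using r \<epsilon> by (auto intro: compact_Times)
  have bd: "\<exists>b. \<forall>z\<in>?T. \<bar>f z\<bar> \<le> b" if "smooth_on cyl f" for f :: "_ \<Rightarrow> real"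
  proof -
    have "bounded (f ` ?T)"
      by (rule compact_imp_bounded[OF compact_continuous_image[OF
            continuous_on_subset[OF smooth_on_imp_continuous_on[OF that] T(2)] T(1)]])
    then show ?thesis unfolding bounded_iff by auto
  qed
  obtain b1 where b1: "\<And>z. z \<in> ?T \<Longrightarrow> \<bar>\<Phi> z\<bar> \<le> b1" using bd[OF smooth_\<Phi>] by blast
  obtain b2 where b2: "\<And>z. z \<in> ?T \<Longrightarrow> \<bar>frechet_derivative \<Phi> (at z) (1, 0)\<bar> \<le> b2"
    using bd[OF smooth_on_frechet_derivative[OF smooth_\<Phi>]] by blast
  let ?N = "chart_inv c ` ball ?x r"
  have bR: "ball ?x r \<subseteq> R" using r(2) ball_subset_cball by blast
  have N: "open ?N" by (rule M.open_chart_inv_image[OF c open_ball order_trans[OF bR R_img]])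
  have NW: "?N \<subseteq> W" using bR inv_W(1) by blast
  have pN: "p \<in> ?N" using r inv_W(2)[OF p] by (intro image_eqI[of _ _ ?x]) auto
  have I: "t \<in> I" if "\<bar>t\<bar> < \<epsilon>/2" for t using that \<epsilon> by auto
  have zT: "(t, chart_map c q) \<in> ?T" if "\<bar>t\<bar> < \<epsilon>/2" "q \<in> ?N" for t q
    using that bR inv_W(3) by (auto simp: subset_iff)
  have "energy_bounded_on ?N (\<epsilon>/2) (max b1 b2)"
    unfolding energy_bounded_on_def
  proof (intro allI impI conjI ballI)
    fix t assume t: "\<bar>t\<bar> < \<epsilon>/2"
    have "continuous_on ?N (\<lambda>q. \<Phi> (t, chart_map c q))"
    proof (rule continuous_on_compose2[OF smooth_on_imp_continuous_on[OF smooth_\<Phi>]])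
      show "continuous_on ?N (\<lambda>q. (t, chart_map c q))"
        using NW W by (intro continuous_on_Pair continuous_on_const
            continuous_on_subset[OF M.continuous_on_chart_map[OF c]]) auto
    qed (use I[OF t] NW in auto)
    then show "continuous_on ?N (d3_norm2 A g B h (U t))"
      using d3_norm2_coord[OF I[OF t]] NW by (subst continuous_on_cong[OF refl]) (auto simp: subset_iff)
    fix q assume q: "q \<in> ?N"
    then have qW: "q \<in> W" using NW by blast
    show "((\<lambda>t. d3_norm2 A g B h (U t) q) has_real_derivative energy_density_deriv t q) (at t)"
      by (rule energy_density_has_derivative(1)[OF I[OF t] qW])
    show "\<bar>energy_density_deriv t q\<bar> \<le> max b1 b2"
      unfolding energy_density_has_derivative(2)[OF I[OF t] qW] using b2[OF zT[OF t q]] by simp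
    show "\<bar>d3_norm2 A g B h (U t) q\<bar> \<le> max b1 b2"
      unfolding d3_norm2_coord[OF I[OF t] qW] using b1[OF zT[OF t q]] by simp
  qed
  moreover have "\<epsilon>/2 > 0" using \<epsilon> by simp
  ultimately show ?thesis using N pN by blast
qed

end

context energy_variation
begin

lemma smooth_flux:
  assumes c: "c \<in> A" shows "smooth_on (M.img c) (M.field_coord c flux)"
proof (rule smooth_on_locally)
  fix x assume x: "x \<in> M.img c"
  let ?p = "chart_inv c x"
  obtain e W\<^sub>0 where e: "?p \<in> W\<^sub>0" "local_orthonormal_frame A g W\<^sub>0 e"
    using M.local_orthonormal_frame_exists by blast
  obtain \<epsilon> W where pW: "?p \<in> W" "variation_chart A g DM B h DN u \<delta> U c (chart_at B (u ?p)) \<epsilon> W e"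
    using variation_chart_exists[OF c M.chart_inv_dom[OF c x] N.chart_at e] .
  interpret variation_chart A g DM B h DN u \<delta> U c "chart_at B (u ?p)" \<epsilon> W e by (rule pW(2))
  have "x \<in> R" using pW(1) M.chart_map_inv[OF c x] by (intro image_eqI[of _ _ ?p]) auto
  then show "\<exists>T. open T \<and> x \<in> T \<and> smooth_on T (M.field_coord c flux)"
    using open_R smooth_flux_chart by blast
qed

text \<open>At each point the chart of \<open>N\<close> and the frame are taken to be those selected in the definitions of the
  induced connection and of the divergence.\<close>

lemma flux_divergence_chart:
  assumes c: "c \<in> A" "q \<in> chart_dom c"
  shows "(\<Sum>k\<in>UNIV. frechet_derivative (\<lambda>y. M.vol_density c y *\<^sub>R M.field_coord c flux y) (at (chart_map c q)) (axis k 1) $ k)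
    = M.vol_density c (chart_map c q) * (energy_density_deriv 0 q / 6
        + h (u q) (variation_field B U q) (Phi3_tension A g DM B h DN u q))"
proof -
  define e where "e = (SOME e. \<exists>W. q \<in> W \<and> local_orthonormal_frame A g W e)"
  obtain W\<^sub>0 where e: "q \<in> W\<^sub>0" "local_orthonormal_frame A g W\<^sub>0 e"
    using someI_ex[OF M.local_orthonormal_frame_exists[of q]] unfolding e_def by blast
  obtain \<epsilon> W where pW: "q \<in> W" "variation_chart A g DM B h DN u \<delta> U c (chart_at B (u q)) \<epsilon> W e"
    using variation_chart_exists[OF c N.chart_at e] .
  interpret variation_chart A g DM B h DN u \<delta> U c "chart_at B (u q)" \<epsilon> W e by (rule pW(2))
  show ?thesis
    using flux_divergence[OF pW(1) refl e_def] energy_density_has_derivative(2)[OF zero_I pW(1)] by simp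
qed

lemma energy_locally_bounded: "\<exists>N \<eta> C. open N \<and> p \<in> N \<and> \<eta> > 0 \<and> energy_bounded_on N \<eta> C"
proof -
  obtain e W\<^sub>0 where e: "p \<in> W\<^sub>0" "local_orthonormal_frame A g W\<^sub>0 e"
    using M.local_orthonormal_frame_exists by blast
  obtain \<epsilon> W where pW: "p \<in> W" "variation_chart A g DM B h DN u \<delta> U (chart_at A p) (chart_at B (u p)) \<epsilon> W e"
    using variation_chart_exists[OF M.chart_at N.chart_at e] .
  show ?thesis by (rule variation_chart.energy_locally_bounded_chart[OF pW(2,1)])
qed

lemma energy_bounded_on_compact:
  assumes K: "compact K"
  obtains \<eta> C where "\<eta> > 0" "energy_bounded_on K \<eta> C"
proof -
  obtain N \<eta> C where N: "\<And>p. open (N p)" "\<And>p. p \<in> N p" "\<And>p. \<eta> p > 0"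
      "\<And>p. energy_bounded_on (N p) (\<eta> p) (C p)"
    using energy_locally_bounded by metis
  obtain P where P: "P \<subseteq> K" "finite P" "K \<subseteq> (\<Union>p\<in>P. N p)"
    by (rule compactE_image[OF K, of K N]) (use N in auto)
  define \<eta>0 where "\<eta>0 = Min (insert 1 (\<eta> ` P))"
  define C0 where "C0 = Max (insert 0 (C ` P))"
  have \<eta>0: "\<eta>0 > 0" "\<And>p. p \<in> P \<Longrightarrow> \<eta>0 \<le> \<eta> p"
    using P(2) N(3) by (auto simp: \<eta>0_def)
  have C0: "\<And>p. p \<in> P \<Longrightarrow> C p \<le> C0" using P(2) by (auto simp: C0_def)
  have *: "((\<lambda>t. d3_norm2 A g B h (U t) q) has_real_derivative energy_density_deriv t q) (at t) \<and>
      \<bar>energy_density_deriv t q\<bar> \<le> C0 \<and> \<bar>d3_norm2 A g B h (U t) q\<bar> \<le> C0"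
    if t: "\<bar>t\<bar> < \<eta>0" and q: "q \<in> K" for t q
  proof -
    obtain p where p: "p \<in> P" "q \<in> N p" using P(3) q by blast
    then have "\<bar>t\<bar> < \<eta> p" using \<eta>0(2) t by force
    then show ?thesis using N(4)[of p] C0[OF p(1)] p(2) unfolding energy_bounded_on_def by force
  qed
  have cont: "continuous_on K (d3_norm2 A g B h (U t))" if t: "\<bar>t\<bar> < \<eta>0" for t
  proof (rule continuous_at_imp_continuous_on, rule ballI)
    fix q assume "q \<in> K"
    then obtain p where p: "p \<in> P" "q \<in> N p" using P(3) by blast
    then have "\<bar>t\<bar> < \<eta> p" using \<eta>0(2) t by force
    then have "continuous_on (N p) (d3_norm2 A g B h (U t))" "open (N p)"
      using N(1,4)[of p] unfolding energy_bounded_on_def by auto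
    then show "isCont (d3_norm2 A g B h (U t)) q" using p(2) continuous_on_eq_continuous_at by blast
  qed
  have "energy_bounded_on K \<eta>0 C0" unfolding energy_bounded_on_def using * cont by simp
  then show ?thesis by (rule that[OF \<eta>0(1)])
qed

text \<open>Near \<open>q\<close> both maps have the same derivatives, if any, and hence the same value of
  \<open>frechet_derivative\<close>, which is a choice among them.\<close>

lemma differential_cong_open:
  assumes "open T" "q \<in> T" "\<And>r. r \<in> T \<Longrightarrow> f r = f' r"
  shows "differential A B f q = differential A B f' q"
proof
  fix X
  let ?c = "chart_at A q" and ?S = "chart_map (chart_at A q) ` (chart_dom (chart_at A q) \<inter> T)"
  have S: "open ?S" "chart_map ?c q \<in> ?S"
    using assms M.chart_at M.open_chart_image[OF M.chart_at(1) open_Int[OF M.open_dom[OF M.chart_at(1)] assms(1)]] by auto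
  have "(k \<circ> f \<circ> chart_inv ?c has_derivative F) (at (chart_map ?c q))
    \<longleftrightarrow> (k \<circ> f' \<circ> chart_inv ?c has_derivative F) (at (chart_map ?c q))" for k :: "'b \<Rightarrow> real ^ 'n" and F
  proof -
    have eq: "(k \<circ> f \<circ> chart_inv ?c) x = (k \<circ> f' \<circ> chart_inv ?c) x" if "x \<in> ?S" for x
      using that assms(3) M.chart_inv_map[OF M.chart_at(1)] by auto
    show ?thesis
      using has_derivative_transform_within_open[OF _ S, of "k \<circ> f \<circ> chart_inv ?c" F UNIV "k \<circ> f' \<circ> chart_inv ?c"]
        has_derivative_transform_within_open[OF _ S, of "k \<circ> f' \<circ> chart_inv ?c" F UNIV "k \<circ> f \<circ> chart_inv ?c"] eq
      by metis
  qed
  then show "differential A B f q X = differential A B f' q X"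
    using assms by (simp add: differential_def deriv_at_def frechet_derivative_def)
qed

context
  fixes K assumes K: "closed K" and supp: "variation_supported_in u \<delta> U K"
begin

lemma U_outside: "t \<in> {-\<delta><..<\<delta>} \<Longrightarrow> q \<notin> K \<Longrightarrow> U t q = u q"
  using supp by (simp add: variation_supported_in_def)

lemma energy_density_deriv_outside:
  assumes q: "q \<notin> K" shows "energy_density_deriv 0 q = 0"
proof -
  have "((\<lambda>t. d3_norm2 A g B h (U t) q) has_real_derivative 0) (at 0)"
  proof (rule has_field_derivative_transform_within_open[OF DERIV_const open_greaterThanLessThan])
    show "0 \<in> {-\<delta><..<\<delta>}" using \<delta> by simp
    fix t assume t: "t \<in> {-\<delta><..<\<delta>}"
    have "differential A B u q = differential A B (U t) q"
      by (rule differential_cong_open[OF open_Compl[OF K]]) (use q U_outside[OF t] in auto)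
    then show "d3_norm2 A g B h u q = d3_norm2 A g B h (U t) q"
      unfolding d3_norm2_def d3_def U_outside[OF t q] by simp
  qed
  then show ?thesis unfolding energy_density_deriv_def by (rule DERIV_imp_deriv)
qed

lemma variation_field_outside:
  assumes q: "q \<notin> K" shows "variation_field B U q = 0"
  unfolding variation_field_def
proof (rule vector_derivative_at, unfold has_vector_derivative_def,
    rule has_derivative_transform_within_open[OF _ open_greaterThanLessThan])
  show "((\<lambda>_. chart_map (chart_at B (U 0 q)) (u q)) has_derivative (\<lambda>x. x *\<^sub>R 0)) (at (0::real))" by simp
  show "0 \<in> {-\<delta><..<\<delta>}" using \<delta> by simp
qed (simp add: U_outside[OF _ q])

lemma flux_outside: "q \<notin> K \<Longrightarrow> flux q = 0"
proof -
  assume q: "q \<notin> K"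
  interpret inner_form "h (u q)" by (rule N.inner_form_metric)
  show ?thesis by (simp add: flux_def Let_def variation_field_outside[OF q] zero_left)
qed

end

text \<open>Over \<open>K\<close> and over \<open>M\<close> the derivative of the energy density has the same integral, since it vanishes
  outside \<open>K\<close>; the divergence theorem identifies this integral up to sign with that of \<open>h(v, \<tau>)\<close>.\<close>

theorem first_variation:
  assumes \<mu>: "riemannian_measure A g \<mu>" and K: "compact K" and supp: "variation_supported_in u \<delta> U K"
  shows "((\<lambda>t. Phi3_energy_on A g \<mu> B h K (U t)) has_real_derivative
    - (LINT p|\<mu>. h (u p) (variation_field B U p) (Phi3_tension A g DM B h DN u p))) (at 0)"
proof -
  interpret \<mu>: measured_manifold A g DM \<mu> by unfold_locales (rule \<mu>)
  have clK: "closed K" using K by (rule compact_imp_closed)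
  have Ks: "K \<in> sets \<mu>" using clK by (simp add: \<mu>.sets_\<mu>)
  let ?T = "\<lambda>q. h (u q) (variation_field B U q) (Phi3_tension A g DM B h DN u q)"
  let ?E = "\<lambda>t q. indicator K q *\<^sub>R (d3_norm2 A g B h (U t) q / 6)"
  let ?E' = "\<lambda>t q. indicator K q *\<^sub>R (energy_density_deriv t q / 6)"
  obtain \<eta> C where \<eta>: "\<eta> > 0" and bounded: "energy_bounded_on K \<eta> C"
    using K by (rule energy_bounded_on_compact)
  note cont = bounded[unfolded energy_bounded_on_def, rule_format, THEN conjunct1]
    and der = bounded[unfolded energy_bounded_on_def, rule_format, THEN conjunct2, rule_format, THEN conjunct1]
    and bd = bounded[unfolded energy_bounded_on_def, rule_format, THEN conjunct2, rule_format, THEN conjunct2]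
  have w: "integrable \<mu> (\<lambda>q. indicator K q *\<^sub>R (C / 6))"
    using Ks \<mu>.emeasure_compact_finite[OF K] by (intro integrable_scaleR_left integrable_real_indicator) auto
  have int: "integrable \<mu> (?E t)" if t: "\<bar>t\<bar> < \<eta>" for t
  proof (rule Bochner_Integration.integrable_bound[OF w])
    have "(\<lambda>q. indicator K q *\<^sub>R (d3_norm2 A g B h (U t) q / 6)) \<in> borel_measurable borel"
      using clK cont[OF t] by (intro borel_measurable_continuous_on_indicator continuous_intros) auto
    then show "?E t \<in> borel_measurable \<mu>" by (simp only: measurable_cong_sets[OF \<mu>.sets_\<mu> refl])
    have "norm (?E t q) \<le> norm (indicator K q *\<^sub>R (C / 6))" for q
      using bd[OF t, of q] by (cases "q \<in> K") auto
    then show "AE q in \<mu>. norm (?E t q) \<le> norm (indicator K q *\<^sub>R (C / 6))" by simp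
  qed
  have dE: "((\<lambda>t. ?E t q) has_real_derivative ?E' t q) (at t)" if t: "\<bar>t\<bar> < \<eta>" for t q
  proof (cases "q \<in> K")
    case True
    then show ?thesis using DERIV_cdivide[OF der[OF t True], of 6] by simp
  qed simp
  have bE: "\<bar>?E' t q\<bar> \<le> indicator K q *\<^sub>R (C / 6)" if t: "\<bar>t\<bar> < \<eta>" for t q
    using bd[OF t, of q] by (cases "q \<in> K") auto
  note D = derivative_under_integral[OF \<eta> int dE w bE]
  have E'0: "?E' 0 = (\<lambda>q. energy_density_deriv 0 q / 6)"
    using energy_density_deriv_outside[OF clK supp] by (auto simp: fun_eq_iff indicator_def)
  have div: "integrable \<mu> (\<lambda>q. energy_density_deriv 0 q / 6 + ?T q)"
    "(LINT q|\<mu>. energy_density_deriv 0 q / 6 + ?T q) = 0"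
    using \<mu>.divergence_theorem[OF K smooth_flux flux_outside[OF clK supp] flux_divergence_chart] by simp_all
  have iE: "integrable \<mu> (\<lambda>q. energy_density_deriv 0 q / 6)" using D(1) unfolding E'0 .
  have "(LINT q|\<mu>. ?T q) = (LINT q|\<mu>. (energy_density_deriv 0 q / 6 + ?T q) - energy_density_deriv 0 q / 6)"
    by simp
  also have "\<dots> = - (LINT q|\<mu>. energy_density_deriv 0 q / 6)"
    using div iE by (subst Bochner_Integration.integral_diff) simp_all
  finally have "(LINT q|\<mu>. ?E' 0 q) = - (LINT q|\<mu>. ?T q)" unfolding E'0 by simp
  with D(2) show ?thesis
    unfolding Phi3_energy_on_def set_lebesgue_integral_def by simp
qed

end

text \<open>If \<open>M\<close> is compact, the total energy is the energy over the compact set \<open>K = M\<close>, which supports every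
  variation.\<close>

theorem theorem2p2:
  fixes A :: "('a::{t2_space,second_countable_topology}, 'm::finite) chart set"
    and g :: "('a, 'm) metric"
    and DM :: "('a, 'm) connection"
    and \<mu> :: "'a measure"
    and B :: "('b::{t2_space,second_countable_topology}, 'n::finite) chart set"
    and h :: "('b, 'n) metric"
    and DN :: "('b, 'n) connection"
    and u :: "'a \<Rightarrow> 'b"
    and \<delta> :: real
    and U :: "real \<Rightarrow> 'a \<Rightarrow> 'b"
  assumes "riemannian_manifold A g"
    and "levi_civita_connection A g DM"
    and "riemannian_measure A g \<mu>"
    and "riemannian_manifold B h"
    and "levi_civita_connection B h DN"
    and "smooth_map A B u"
    and "\<delta> > 0"
    and "smooth_variation A B u \<delta> U"
    and "\<exists>K. compact K \<and> variation_supported_in u \<delta> U K"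
  shows "(compact (UNIV :: 'a set) \<longrightarrow>
      ((\<lambda>t. Phi3_energy A g \<mu> B h (U t)) has_real_derivative
        - (LINT p|\<mu>. h (u p) (variation_field B U p) (Phi3_tension A g DM B h DN u p))) (at 0)) \<and>
    (\<forall>K. compact K \<and> variation_supported_in u \<delta> U K \<longrightarrow>
      ((\<lambda>t. Phi3_energy_on A g \<mu> B h K (U t)) has_real_derivative
        - (LINT p|\<mu>. h (u p) (variation_field B U p) (Phi3_tension A g DM B h DN u p))) (at 0))"
proof -
  interpret energy_variation A g DM B h DN u \<delta> U
    using assms by unfold_locales (auto simp: riemannian_manifold_def)
  note F = first_variation[OF \<open>riemannian_measure A g \<mu>\<close>]
  have "Phi3_energy A g \<mu> B h f = Phi3_energy_on A g \<mu> B h UNIV f" for f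
    by (simp add: Phi3_energy_def Phi3_energy_on_def set_lebesgue_integral_def)
  then show ?thesis using F F[of UNIV] by (auto simp: variation_supported_in_def)
qed

end
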